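(* Let $\{X_t:t\in\mathbb{Z}\}$ be a strictly stationary process taking values in $\mathbb{R}^d$ with true mean $\mathrm{E}X_t=\mu_0\in\mathbb{R}^d$, and suppose assumptions (A.1) and (A.2) of the context hold. Let $p\le d$ and let $H=(H_1,\ldots,H_p)^\prime:\mathbb{R}^d\to\mathbb{R}^p$ be continuously differentiable in a neighborhood of $\mu_0$, and suppose that $\nabla_{\mu_0}$ has rank $p$, where $\nabla_\mu=[\partial H_i(\mu)/\partial\mu_j]_{i=1,\ldots,p;\,j=1,\ldots,d}$ is the $p\times d$ matrix of first-order partial derivatives of $H$. Let $R_n(\theta)$, $\theta\in\mathbb{R}^p$, be the expansive block empirical likelihood ratio for the parameter $\theta=H(\mu)$ defined in the context. Then, at the true parameter $\theta_0=H(\mu_0)$, as $n\to\infty$, $$-\frac{1}{n}\log R_n(\theta_0)\stackrel{d}{\rightarrow}-g_p(Y_p),$$ where $W(t)=(W_1(t),\ldots,W_p(t))^\prime$, $0\le t\le 1$, is a vector of $p$ i.i.d. copies of standard Brownian motion on $[0,1]$, $f(t)=w(t)W(t)$, $g_p(a)=-\int_0^1\log(1+a^\prime f(t))\,dt$ for $a\in\overline{K}_p=\{y\in\mathbb{R}^p:\min_{0\le t\le 1}(1+y^\prime f(t))\ge 0\}$, and $Y_p$ is the (with probability 1 unique) minimizer of $g_p$ over $\overline{K}_p$.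
   Context: Assumptions. (A.1) The weight function $w:[0,1]\to[0,\infty)$ is continuous on $[0,1]$ and strictly positive on an interval $(0,c)$ for some $c\in(0,1]$. (A.2) The $d\times d$ matrix $\Sigma=\sum_{j=-\infty}^{\infty}\mathrm{Cov}(X_0,X_j)$ is positive definite. Let $S_n(t)$, $t\in[0,1]$, be the process defined by linear interpolation of $\{S_n(i/n)=\sum_{j=1}^i(X_j-\mu_0):i=0,\ldots,n\}$ with $S_n(0)=0$. Then $S_n(\cdot)/n^{1/2}\stackrel{d}{\rightarrow}\Sigma^{1/2}B(\cdot)$ in $\mathcal{C}_d[0,1]$, the space of $\mathbb{R}^d$-valued continuous functions on $[0,1]$ with the supremum metric, where $B$ is a vector of $d$ i.i.d. standard Brownian motions on $[0,1]$. Expansive block empirical likelihood ratio for smooth function parameters. Based on $X_1,\ldots,X_n$, for $\mu\in\mathbb{R}^d$ set $T_{i,\mu}=w(i/n)\sum_{j=1}^i(X_j-\mu)$, $i=1,\ldots,n$. For $\theta\in\mathbb{R}^p$, $$R_n(\theta)=n^n\sup\Big\{\prod_{i=1}^n p_i:\ p_i\ge 0,\ \sum_{i=1}^n p_i=1,\ \sum_{i=1}^n p_iT_{i,\mu}=0_d,\ \mu\in\mathbb{R}^d,\ H(\mu)=\theta\Big\},$$ the supremum being over all such $(p_1,\ldots,p_n)$ and $\mu$, and equal to $0$ if there are none (with $-\log 0=+\infty$). Here $0_d$ is the zero vector of $\mathbb{R}^d$, $^\prime$ is transpose, and $\log 0=-\infty$ in the definition of $g_p$. *)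

theory Defs
  imports "HOL-Probability.Probability"
begin

section \<open>Convergence in distribution\<close>

text \<open>
  The likelihood ratio is a supremum over an uncountable constraint set defined by a map that is
  unrestricted away from one point, so it need not be a measurable function of the data. Convergence
  in distribution is therefore taken in the sense of Hoffmann-Joergensen: outer expectations of
  bounded continuous functions of the approximating variables converge to the expectation for the
  (measurable) limit. For measurable variables this is ordinary weak convergence of the laws, by
  the lemma below.
\<close>

definition outer_expectation :: "'a measure \<Rightarrow> ('a \<Rightarrow> real) \<Rightarrow> real" where
  "outer_expectation M h =
     (INF U \<in> {U. integrable M U \<and> (\<forall>\<omega>\<in>space M. h \<omega> \<le> U \<omega>)}. integral\<^sup>L M U)"

lemma outer_expectation_eq_integral:
  assumes "integrable M h"
  shows "outer_expectation M h = integral\<^sup>L M h"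
  unfolding outer_expectation_def
proof (rule cInf_eq_minimum)
  show "integral\<^sup>L M h \<in>
      integral\<^sup>L M ` {U. integrable M U \<and> (\<forall>\<omega>\<in>space M. h \<omega> \<le> U \<omega>)}"
    using assms by blast
next
  fix x
  assume "x \<in> integral\<^sup>L M ` {U. integrable M U \<and> (\<forall>\<omega>\<in>space M. h \<omega> \<le> U \<omega>)}"
  then show "integral\<^sup>L M h \<le> x"
    using assms by (auto intro!: integral_mono)
qed

definition conv_in_dist ::
  "'s topology \<Rightarrow> 'a measure \<Rightarrow> (nat \<Rightarrow> 'a \<Rightarrow> 's) \<Rightarrow> 'b measure \<Rightarrow> ('b \<Rightarrow> 's) \<Rightarrow> bool" where
  "conv_in_dist T M Z N Z' \<longleftrightarrow>
     (\<forall>n. Z n \<in> space M \<rightarrow> topspace T) \<and> Z' \<in> space N \<rightarrow> topspace T \<and>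
     (\<forall>\<phi>. continuous_map T euclideanreal \<phi> \<and> bounded (\<phi> ` topspace T) \<longrightarrow>
        (\<lambda>\<omega>. \<phi> (Z' \<omega>)) \<in> borel_measurable N \<and>
        (\<lambda>n. outer_expectation M (\<lambda>\<omega>. \<phi> (Z n \<omega>)))
          \<longlonglongrightarrow> (\<integral>\<omega>. \<phi> (Z' \<omega>) \<partial>N))"

text \<open>The space of continuous functions from \<open>[0,1]\<close> to Euclidean space with the supremum metric.
  Its elements are extensional functions, i.e. \<open>undefined\<close> outside \<open>[0,1]\<close>.\<close>

definition C01 :: "(real \<Rightarrow> real ^ 'd) topology" where
  "C01 = mtopology_of (cfunspace (top_of_set {0..1}) euclidean_metric)"


section \<open>Processes\<close>

definition strictly_stationary :: "'a measure \<Rightarrow> (int \<Rightarrow> 'a \<Rightarrow> real ^ 'd) \<Rightarrow> bool" where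
  "strictly_stationary M X \<longleftrightarrow>
     (\<forall>t. X t \<in> borel_measurable M) \<and>
     (\<forall>J h. finite J \<longrightarrow>
        distr M (PiM J (\<lambda>_. borel)) (\<lambda>\<omega>. \<lambda>t\<in>J. X (t + h) \<omega>) =
        distr M (PiM J (\<lambda>_. borel)) (\<lambda>\<omega>. \<lambda>t\<in>J. X t \<omega>))"

definition cov_matrix :: "'a measure \<Rightarrow> ('a \<Rightarrow> real ^ 'd) \<Rightarrow> ('a \<Rightarrow> real ^ 'd) \<Rightarrow> real ^ 'd ^ 'd" where
  "cov_matrix M U V =
     (\<chi> a b. \<integral>\<omega>. (U \<omega> $ a - (\<integral>\<omega>'. U \<omega>' $ a \<partial>M)) * (V \<omega> $ b - (\<integral>\<omega>'. V \<omega>' $ b \<partial>M)) \<partial>M)"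

definition positive_definite :: "real ^ 'd ^ 'd \<Rightarrow> bool" where
  "positive_definite A \<longleftrightarrow> transpose A = A \<and> (\<forall>x. x \<noteq> 0 \<longrightarrow> 0 < x \<bullet> (A *v x))"

definition brownian_motion01 :: "'b measure \<Rightarrow> (real \<Rightarrow> 'b \<Rightarrow> real) \<Rightarrow> bool" where
  "brownian_motion01 N B \<longleftrightarrow>
     (\<forall>t\<in>{0..1}. B t \<in> borel_measurable N) \<and>
     (\<forall>\<omega>\<in>space N. B 0 \<omega> = 0 \<and> continuous_on {0..1} (\<lambda>t. B t \<omega>)) \<and>
     (\<forall>s t. 0 \<le> s \<and> s < t \<and> t \<le> 1 \<longrightarrow>
        distributed N lborel (\<lambda>\<omega>. B t \<omega> - B s \<omega>) (normal_density 0 (sqrt (t - s)))) \<and>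
     (\<forall>k (\<tau>::nat \<Rightarrow> real). 0 \<le> \<tau> 0 \<and> \<tau> k \<le> 1 \<and> (\<forall>i<k. \<tau> i < \<tau> (Suc i)) \<longrightarrow>
        prob_space.indep_vars N (\<lambda>_. borel) (\<lambda>i \<omega>. B (\<tau> (Suc i)) \<omega> - B (\<tau> i) \<omega>) {..<k})"

definition iid_brownian_motions01 :: "'b measure \<Rightarrow> (real \<Rightarrow> 'b \<Rightarrow> real ^ 'd) \<Rightarrow> bool" where
  "iid_brownian_motions01 N B \<longleftrightarrow>
     (\<forall>i. brownian_motion01 N (\<lambda>t \<omega>. B t \<omega> $ i)) \<and>
     prob_space.indep_vars N (\<lambda>_. PiM {0..1} (\<lambda>_. borel))
       (\<lambda>i \<omega>. \<lambda>t\<in>{0..1}. B t \<omega> $ i) UNIV"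

text \<open>In \<open>partial_sum_process\<close> the summand with \<open>Suc (nat \<lfloor>n t\<rfloor>)\<close> has weight \<open>0\<close> at the grid points
  \<open>t = i/n\<close>; in particular \<open>x (n + 1)\<close> is not used on \<open>[0,1]\<close>.\<close>

definition centred_sum :: "real ^ 'd \<Rightarrow> (int \<Rightarrow> real ^ 'd) \<Rightarrow> nat \<Rightarrow> real ^ 'd" where
  "centred_sum \<mu> x i = (\<Sum>j = 1..i. x (int j) - \<mu>)"

definition partial_sum_process ::
  "real ^ 'd \<Rightarrow> (int \<Rightarrow> real ^ 'd) \<Rightarrow> nat \<Rightarrow> real \<Rightarrow> real ^ 'd" where
  "partial_sum_process \<mu> x n t =
     (let k = nat \<lfloor>real n * t\<rfloor>; r = frac (real n * t)
      in (1 - r) *\<^sub>R centred_sum \<mu> x k + r *\<^sub>R centred_sum \<mu> x (Suc k))"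


section \<open>Expansive block empirical likelihood\<close>

definition block_sum ::
  "(real \<Rightarrow> real) \<Rightarrow> (int \<Rightarrow> real ^ 'd) \<Rightarrow> nat \<Rightarrow> real ^ 'd \<Rightarrow> nat \<Rightarrow> real ^ 'd" where
  "block_sum w x n \<mu> i = w (real i / real n) *\<^sub>R centred_sum \<mu> x i"

text \<open>Inserting \<open>0\<close> only affects the case of an empty constraint set, as all products are
  nonnegative; they are bounded by \<open>1\<close>.\<close>

definition EBEL_ratio ::
  "(real \<Rightarrow> real) \<Rightarrow> (real ^ 'd \<Rightarrow> real ^ 'p) \<Rightarrow> (int \<Rightarrow> real ^ 'd) \<Rightarrow> nat \<Rightarrow> real ^ 'p \<Rightarrow> real" where
  "EBEL_ratio w H x n \<theta> = real n ^ n *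
     Sup (insert 0 {(\<Prod>i = 1..n. q i) | q \<mu>.
       (\<forall>i\<in>{1..n}. 0 \<le> q i) \<and> (\<Sum>i = 1..n. q i) = 1 \<and>
       (\<Sum>i = 1..n. q i *\<^sub>R block_sum w x n \<mu> i) = 0 \<and> H \<mu> = \<theta>})"

definition elog :: "real \<Rightarrow> ereal" where
  "elog x = (if 0 < x then ereal (ln x) else - \<infinity>)"

text \<open>Integral of an extended-real function on \<open>[0,1]\<close> as the difference of the integrals of its
  positive and negative parts (\<open>e2ennreal\<close> truncates negative values to \<open>0\<close>). It is used for
  functions that are bounded above, so no \<open>\<infinity> - \<infinity>\<close> arises.\<close>

definition eintegral01 :: "(real \<Rightarrow> ereal) \<Rightarrow> ereal" where
  "eintegral01 h =
     enn2ereal (\<integral>\<^sup>+ t\<in>{0..1}. e2ennreal (h t) \<partial>lborel) -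
     enn2ereal (\<integral>\<^sup>+ t\<in>{0..1}. e2ennreal (- h t) \<partial>lborel)"

definition g_fun :: "(real \<Rightarrow> real ^ 'p) \<Rightarrow> real ^ 'p \<Rightarrow> ereal" where
  "g_fun f a = - eintegral01 (\<lambda>t. elog (1 + a \<bullet> f t))"

definition K_bar :: "(real \<Rightarrow> real ^ 'p) \<Rightarrow> (real ^ 'p) set" where
  "K_bar f = {y. \<forall>t\<in>{0..1}. 0 \<le> 1 + y \<bullet> f t}"

end

theory Submission
  imports Defs "HOL-Real_Asymp.Real_Asymp"
begin

text \<open>
  Given weights \<open>q\<close>, the constraint determines \<open>\<mu> - \<mu>\<^sub>0\<close> as \<open>n\<^bsup>-1/2\<^esup> m(q) / s(q)\<close> with
  \<open>m(q) = \<Sum> q\<^sub>i w(i/n) z(i/n)\<close>, \<open>s(q) = \<Sum> q\<^sub>i w(i/n) i/n\<close> and \<open>z = S\<^sub>n / n\<^bsup>1/2\<^esup>\<close>. So \<open>H(\<mu>) = H(\<mu>\<^sub>0)\<close> amounts, up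
  to \<open>o(1)\<close>, to the linear constraint \<open>\<nabla> m(q) = 0\<close>: the nuisance directions drop out and what remains
  is the problem for the \<open>p\<close>-dimensional path \<open>f = w \<nabla> z\<close>, whose value is
  \<open>sup {\<integral> ln (1 + a \<bullet> f) | 1 + a \<bullet> f > 0}\<close>.

  For a uniformly convergent sequence of paths whose limit takes values on both sides of every
  hyperplane through the origin, the likelihood ratio converges deterministically. The lower bound is Jensen's
  inequality. For the upper bound one needs a continuous positive density \<open>q\<close> with \<open>\<integral> q f = 0\<close> that
  is almost optimal; since the maximiser may lie on the boundary of the admissible set, \<open>q\<close> is
  obtained by continuing the logarithm by its tangent below \<open>e\<close> and letting \<open>e\<close> tend to \<open>0\<close>. The
  weights \<open>q + b \<bullet> f\<close> with small \<open>b\<close> are then corrected by Brouwer's theorem to satisfy the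
  nonlinear constraint exactly.

  An extended continuous mapping theorem transfers this to outer expectations. Brownian motion
  visits every open orthant before any positive time, so almost all limit paths qualify; finally the
  value depends only on the span of the functionals \<open>a \<bullet> f\<close>, so that \<open>\<nabla> \<Sigma>\<^bsup>1/2\<^esup> B\<close> may be replaced
  by an orthonormal projection of \<open>B\<close>, which has the law of \<open>W\<close>.
\<close>

section \<open>The limiting variational problem\<close>

text \<open>The obstacle is that \<open>H\<close> is controlled only near \<open>\<mu>0\<close>,
  while the supremum runs over every \<open>\<mu>\<close> with \<open>H \<mu> = H \<mu>0\<close>. A
  remote \<open>\<mu>\<close> is feasible only if s(q) is of order n^(-1/2), that is, if the weights
  avoid the times where w(t) t is large. Jensen's inequality against 1 + w(t) t / \<tau> with a
  small constant \<tau> shows that such weights have too small a likelihood to compete; all others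
  force \<open>\<mu>\<close> to within O(n^(-1/2)) of \<open>\<mu>0\<close>, where the derivative
  takes over. A boundary maximiser obstructs the other bound, since 1 / (1 + a \<bullet> f) may then
  be unbounded and fail to be orthogonal to f. The tangent continuation makes the problem
  unconstrained and concave, its stationarity condition is exactly the linear constraint, and its
  slope 1/e drives the maximisers into the admissible set as e tends to 0. A path visits both sides
  of every hyperplane exactly when 0 is interior to its convex hull; this makes the admissible set
  bounded and the Gram matrix of f definite.\<close>

abbreviation int01 :: "(real \<Rightarrow> 'a::euclidean_space) \<Rightarrow> 'a" where
  "int01 h \<equiv> integral {0..1} h"

lemma int01_mono:
  fixes g h :: "real \<Rightarrow> real"
  assumes "continuous_on {0..1} g" "continuous_on {0..1} h" "\<And>t. t \<in> {0..1} \<Longrightarrow> g t \<le> h t"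
  shows "int01 g \<le> int01 h"
  using assms by (intro integral_le integrable_continuous_interval) auto

lemma int01_pos:
  fixes h :: "real \<Rightarrow> real"
  assumes "continuous_on {0..1} h" "\<And>t. t \<in> {0..1} \<Longrightarrow> 0 \<le> h t" "t \<in> {0..1}" "h t \<noteq> 0"
  shows "0 < int01 h"
proof -
  have "int01 h \<noteq> 0" using integral_eq_0_iff[of 0 1 h] assms by auto
  moreover have "0 \<le> int01 h" using assms by (intro integral_nonneg integrable_continuous_interval)
  ultimately show ?thesis by simp
qed

lemma continuous_on_Icc_bounded:
  fixes q :: "real \<Rightarrow> real"
  assumes "continuous_on {0..1} q"
  obtains Q where "0 < Q" "\<And>t. t \<in> {0..1} \<Longrightarrow> q t \<le> Q"
proof -
  have "bounded (q ` {0..1})" by (intro compact_imp_bounded compact_continuous_image assms compact_Icc)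
  then obtain B where "\<forall>t\<in>{0..1}. \<bar>q t\<bar> \<le> B" by (auto simp: bounded_real)
  then have "\<And>t. t \<in> {0..1} \<Longrightarrow> q t \<le> \<bar>B\<bar> + 1" by (smt (verit))
  then show thesis using that[of "\<bar>B\<bar> + 1"] by auto
qed

lemma continuous_int01_param:
  fixes G :: "'a::euclidean_space \<Rightarrow> real \<Rightarrow> 'b::euclidean_space"
  assumes "continuous_on (UNIV \<times> {0..1}) (\<lambda>x. G (fst x) (snd x))"
  shows "continuous_on UNIV (\<lambda>a. int01 (G a))"
  using integral_continuous_on_param[of UNIV 0 1 G] assms by (simp add: case_prod_beta)

text \<open>The dual value, which for two-sided paths turns out to be minus the minimum of
  \<open>g_fun\<close>. Strict positivity keeps the integrand real and continuous; the closed set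
  gives the same value, since scaling \<open>a\<close> towards 0 makes it strictly admissible at a
  vanishing cost (\<open>shifted_le_V\<close>).\<close>

definition el_val :: "(real \<Rightarrow> 'a::euclidean_space) \<Rightarrow> ereal" where
  "el_val f = (SUP a\<in>{a. \<forall>t\<in>{0..1}. 0 < 1 + a \<bullet> f t}. ereal (int01 (\<lambda>t. ln (1 + a \<bullet> f t))))"

text \<open>The logarithm continued below \<open>e\<close> by its tangent, hence concave on the whole line.\<close>

definition tangent_ln :: "real \<Rightarrow> real \<Rightarrow> real" where
  "tangent_ln e x = ln (max x e) + min 0 (x - e) / e"

lemma continuous_tangent_ln [continuous_intros]:
  assumes "0 < e" "continuous_on S g"
  shows "continuous_on S (\<lambda>x. tangent_ln e (g x))"
  unfolding tangent_ln_def using assms by (intro continuous_intros) auto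

lemma ln_diff_le:
  fixes x y :: real
  assumes "0 < x" "0 < y"
  shows "ln y - ln x \<le> (y - x) / x"
proof -
  have "ln (y / x) \<le> y / x - 1" using assms by (intro ln_le_minus_one) auto
  then show ?thesis using assms by (simp add: ln_div diff_divide_distrib)
qed

text \<open>The supergradient inequality of a concave function with derivative 1 /
  \<open>max x e\<close>. The summands with \<open>max\<close> and \<open>min\<close> carry the
  parts of the increment above and below \<open>e\<close>; each is bounded with this same
  slope.\<close>

lemma tangent_ln_diff_le:
  assumes "0 < e"
  shows "tangent_ln e y - tangent_ln e x \<le> (y - x) / max x e"
proof -
  have 1: "ln (max y e) - ln (max x e) \<le> (max y e - max x e) / max x e"
    using assms by (intro ln_diff_le) auto
  have 2: "min 0 (y - e) / e - min 0 (x - e) / e \<le> (min 0 (y - e) - min 0 (x - e)) / max x e"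
  proof (cases "x < e")
    case False
    then have "min 0 (y - e) / e \<le> min 0 (y - e) / max x e"
      using assms by (intro divide_left_mono_neg) auto
    then show ?thesis using False by simp
  qed (use assms in \<open>simp add: diff_divide_distrib\<close>)
  have "y - x = (max y e - max x e) + (min 0 (y - e) - min 0 (x - e))" by (simp add: max_def min_def)
  then have "(y - x) / max x e = (max y e - max x e) / max x e + (min 0 (y - e) - min 0 (x - e)) / max x e"
    by (simp only: add_divide_distrib)
  then show ?thesis using 1 2 unfolding tangent_ln_def by linarith
qed

lemma tangent_ln_le_ln_max:
  assumes "0 < e" shows "tangent_ln e x \<le> ln (max x e)"
  unfolding tangent_ln_def using assms by (simp add: divide_nonpos_pos)

text \<open>Growth is logarithmic above 1, while the part below 0 is penalised at rate 1 /
  \<open>e\<close>; this penalty is what makes limits of the maximisers admissible.\<close>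

lemma tangent_ln_le:
  assumes "0 < e" "e \<le> 1"
  shows "tangent_ln e x \<le> ln (max x 1) - max 0 (- x) / e"
proof (cases "x < 0")
  case True
  have "ln e \<le> 0" using assms by simp
  moreover have "tangent_ln e x = ln e + x / e - 1" "max x 1 = 1" "max 0 (- x) = - x"
    using True assms by (simp_all add: tangent_ln_def max_def min_def diff_divide_distrib)
  ultimately show ?thesis by simp
next
  case False
  have "ln (max x e) \<le> ln (max x 1)" using assms False by (intro ln_mono) auto
  then show ?thesis using tangent_ln_le_ln_max[OF assms(1), of x] False by simp
qed

text \<open>One sign suffices in \<open>two_sided\<close>, because \<open>u\<close> ranges over all
  nonzero vectors and \<open>- u\<close> gives the other side.\<close>

locale two_sided_path =
  fixes f :: "real \<Rightarrow> 'a::euclidean_space"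
  assumes f_cont: "continuous_on {0..1} f"
    and two_sided: "\<And>u. u \<noteq> 0 \<Longrightarrow> \<exists>t\<in>{0..1}. u \<bullet> f t < 0"
begin

lemma f_cont_snd: "continuous_on (S \<times> {0..1}) (\<lambda>x. f (snd x))"
  by (rule continuous_on_compose2[OF f_cont]) (auto intro: continuous_intros)

declare f_cont [continuous_intros] f_cont_snd [continuous_intros]

lemma f_bound: obtains M where "0 < M" "\<And>t. t \<in> {0..1} \<Longrightarrow> norm (f t) \<le> M"
proof -
  have "bounded (f ` {0..1})"
    by (intro compact_imp_bounded compact_continuous_image f_cont compact_Icc)
  then show ?thesis using that by (auto simp: bounded_pos)
qed

text \<open>The integral is positively homogeneous and continuous in \<open>u\<close>, and positive
  on the unit sphere by \<open>two_sided\<close>, so its minimum on the sphere serves as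
  \<open>c\<close>.\<close>

lemma negative_part_lower_bound:
  obtains c where "0 < c" "\<And>u. c * norm u \<le> int01 (\<lambda>t. max 0 (- (u \<bullet> f t)))"
proof -
  define \<nu> where "\<nu> u = int01 (\<lambda>t. max 0 (- (u \<bullet> f t)))" for u
  have cont: "continuous_on UNIV \<nu>"
    unfolding \<nu>_def by (rule continuous_int01_param) (intro continuous_intros)
  obtain b :: 'a where "b \<in> Basis" using nonempty_Basis by blast
  then have "sphere (0::'a) 1 \<noteq> {}" by (auto simp: set_eq_iff intro!: exI[of _ b])
  then obtain u0 where u0: "u0 \<in> sphere 0 1" "\<And>u. u \<in> sphere 0 1 \<Longrightarrow> \<nu> u0 \<le> \<nu> u"
    using continuous_attains_inf[OF compact_sphere _ continuous_on_subset[OF cont subset_UNIV]] by blast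
  have "u0 \<noteq> 0" using u0 by auto
  then obtain t where "t \<in> {0..1}" "u0 \<bullet> f t < 0" using two_sided by blast
  then have pos: "0 < \<nu> u0"
    unfolding \<nu>_def by (intro int01_pos[of _ t] continuous_intros) auto
  have "\<nu> u0 * norm u \<le> \<nu> u" for u
  proof (cases "u = 0")
    case True
    then show ?thesis by (simp add: \<nu>_def)
  next
    case False
    have "\<nu> u = norm u * \<nu> (u /\<^sub>R norm u)"
      unfolding \<nu>_def integral_mult_right[symmetric]
      using False by (intro integral_cong) (auto simp: max_mult_distrib_left divide_simps max_def zero_less_mult_iff)
    moreover have "\<nu> u0 \<le> \<nu> (u /\<^sub>R norm u)" using False by (intro u0) simp
    ultimately show ?thesis by (simp add: mult.commute mult_left_mono)
  qed
  then show thesis using that pos unfolding \<nu>_def by blast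
qed

text \<open>Admissibility caps the negative part of \<open>a \<bullet> f t\<close> at 1, whereas its
  integral grows at least like \<open>c * norm a\<close>.\<close>

lemma bounded_admissible:
  obtains R where "0 < R" "\<And>a. (\<And>t. t \<in> {0..1} \<Longrightarrow> 0 \<le> 1 + a \<bullet> f t) \<Longrightarrow> norm a \<le> R"
proof -
  obtain c where c: "0 < c" "\<And>u. c * norm u \<le> int01 (\<lambda>t. max 0 (- (u \<bullet> f t)))"
    using negative_part_lower_bound by blast
  have "norm a \<le> 1 / c" if a: "\<And>t. t \<in> {0..1} \<Longrightarrow> 0 \<le> 1 + a \<bullet> f t" for a
  proof -
    have "int01 (\<lambda>t. max 0 (- (a \<bullet> f t))) \<le> int01 (\<lambda>t. 1)"
      using a by (intro int01_mono continuous_intros) (fastforce simp: max_def)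
    then have "c * norm a \<le> 1" using c(2)[of a] by simp
    then show ?thesis using c(1) by (simp add: field_simps)
  qed
  then show thesis using that[of "1 / c"] c(1) by simp
qed

definition V :: real where "V = real_of_ereal (el_val f)"

text \<open>At \<open>a = 0\<close> the objective is 0, and the inequality ln (1 + x) \<le> x bounds
  it on the bounded admissible set.\<close>

lemma el_val_eq: "el_val f = ereal V"
proof -
  obtain R where R: "0 < R" "\<And>a. (\<And>t. t \<in> {0..1} \<Longrightarrow> 0 \<le> 1 + a \<bullet> f t) \<Longrightarrow> norm a \<le> R"
    using bounded_admissible by blast
  obtain M where M: "0 < M" "\<And>t. t \<in> {0..1} \<Longrightarrow> norm (f t) \<le> M" using f_bound by blast
  have "int01 (\<lambda>t. ln (1 + a \<bullet> f t)) \<le> R * M" if a: "\<forall>t\<in>{0..1}. 0 < 1 + a \<bullet> f t" for a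
  proof -
    have "int01 (\<lambda>t. ln (1 + a \<bullet> f t)) \<le> int01 (\<lambda>t. R * M)"
    proof (intro int01_mono continuous_intros)
      fix t :: real assume t: "t \<in> {0..1}"
      have "ln (1 + a \<bullet> f t) \<le> a \<bullet> f t" using a t ln_le_minus_one[of "1 + a \<bullet> f t"] by auto
      also have "\<dots> \<le> norm a * norm (f t)" by (rule norm_cauchy_schwarz)
      also have "\<dots> \<le> R * M" using a t R(1) M by (intro mult_mono R) (auto intro: less_imp_le)
      finally show "ln (1 + a \<bullet> f t) \<le> R * M" .
    qed (use a in force)
    then show ?thesis by simp
  qed
  then have "el_val f \<le> ereal (R * M)" unfolding el_val_def by (intro SUP_least) auto
  moreover have "ereal 0 \<le> el_val f"
    unfolding el_val_def by (rule SUP_upper2[of 0]) auto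
  ultimately show ?thesis unfolding V_def by (cases "el_val f") auto
qed

lemma le_V:
  assumes "\<And>t. t \<in> {0..1} \<Longrightarrow> 0 < 1 + a \<bullet> f t"
  shows "int01 (\<lambda>t. ln (1 + a \<bullet> f t)) \<le> V"
proof -
  have "ereal (int01 (\<lambda>t. ln (1 + a \<bullet> f t))) \<le> el_val f"
    unfolding el_val_def using assms by (intro SUP_upper) auto
  then show ?thesis by (simp add: el_val_eq)
qed

lemma V_approx:
  assumes "0 < e"
  obtains a where "\<And>t. t \<in> {0..1} \<Longrightarrow> 0 < 1 + a \<bullet> f t" "V - e < int01 (\<lambda>t. ln (1 + a \<bullet> f t))"
proof -
  have "ereal (V - e) < el_val f" using assms by (simp add: el_val_eq)
  then obtain a where "\<forall>t\<in>{0..1}. 0 < 1 + a \<bullet> f t" "V - e < int01 (\<lambda>t. ln (1 + a \<bullet> f t))"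
    unfolding el_val_def less_SUP_iff by auto
  then show thesis using that by blast
qed

text \<open>Shrinking \<open>a\<close> by \<open>1 - k\<close> moves it into the interior of the admissible set.\<close>

lemma shifted_le_V:
  assumes a: "\<And>t. t \<in> {0..1} \<Longrightarrow> 0 \<le> 1 + a \<bullet> f t" and k: "0 < k" "k < 1"
  shows "int01 (\<lambda>t. ln (1 + a \<bullet> f t + k)) \<le> V - ln (1 - k)"
proof -
  have nz: "1 + a \<bullet> f t + k \<noteq> 0" if "t \<in> {0..1}" for t
    using a[OF that] k by linarith
  have ge: "(1 - k) * (1 + a \<bullet> f t + k) \<le> 1 + ((1 - k) *\<^sub>R a) \<bullet> f t" for t
    using k by (simp add: algebra_simps)
  have pos: "0 < (1 - k) * (1 + a \<bullet> f t + k)" if "t \<in> {0..1}" for t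
    using a[OF that] k by (intro mult_pos_pos) auto
  have "ln (1 - k) + int01 (\<lambda>t. ln (1 + a \<bullet> f t + k)) = int01 (\<lambda>t. ln (1 - k) + ln (1 + a \<bullet> f t + k))"
    using nz by (subst integral_add) (auto intro!: integrable_continuous_interval continuous_intros)
  also have "\<dots> \<le> int01 (\<lambda>t. ln (1 + ((1 - k) *\<^sub>R a) \<bullet> f t))"
  proof (intro int01_mono)
    fix t :: real assume t: "t \<in> {0..1}"
    have "ln (1 - k) + ln (1 + a \<bullet> f t + k) = ln ((1 - k) * (1 + a \<bullet> f t + k))"
      using a[OF t] k by (intro ln_mult_pos[symmetric]) auto
    also have "\<dots> \<le> ln (1 + ((1 - k) *\<^sub>R a) \<bullet> f t)"
      using pos[OF t] ge[of t] by (intro ln_mono) auto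
    finally show "ln (1 - k) + ln (1 + a \<bullet> f t + k) \<le> ln (1 + ((1 - k) *\<^sub>R a) \<bullet> f t)" .
  next
    show "continuous_on {0..1} (\<lambda>t. ln (1 - k) + ln (1 + a \<bullet> f t + k))"
      using nz by (intro continuous_intros) auto
    show "continuous_on {0..1} (\<lambda>t. ln (1 + ((1 - k) *\<^sub>R a) \<bullet> f t))"
    proof (intro continuous_intros ballI)
      fix t :: real assume "t \<in> {0..1}"
      then show "1 + (1 - k) *\<^sub>R a \<bullet> f t \<noteq> 0" using pos[of t] ge[of t] by linarith
    qed
  qed
  also have "\<dots> \<le> V" by (rule le_V) (rule less_le_trans[OF pos ge])
  finally show ?thesis by simp
qed

text \<open>The value at 0 is 0, so the hypothesis \<open>bd\<close> makes the maximum over the ball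
  a global one. The last conclusion is the stationarity condition: the gradient integrates
  \<open>f t\<close> against the derivative 1 / \<open>max (1 + a \<bullet> f t) e\<close>.\<close>

lemma tangent_ln_maximiser:
  assumes "0 < R" and bd: "\<And>a. 0 \<le> int01 (\<lambda>t. tangent_ln e (1 + a \<bullet> f t)) \<Longrightarrow> norm a \<le> R"
    and e: "0 < e" "e \<le> 1"
  obtains a where "norm a \<le> R" "0 \<le> int01 (\<lambda>t. tangent_ln e (1 + a \<bullet> f t))"
    "int01 (\<lambda>t. inverse (max (1 + a \<bullet> f t) e) *\<^sub>R f t) = 0"
proof -
  define \<Phi> where "\<Phi> a = int01 (\<lambda>t. tangent_ln e (1 + a \<bullet> f t))" for a
  have cont: "continuous_on UNIV \<Phi>"
    unfolding \<Phi>_def using e by (intro continuous_int01_param) (auto intro!: continuous_intros)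
  have "cball (0::'a) R \<noteq> {}" using assms(1) by simp
  then obtain a where a: "a \<in> cball 0 R" "\<And>b. b \<in> cball 0 R \<Longrightarrow> \<Phi> b \<le> \<Phi> a"
    using continuous_attains_sup[OF compact_cball _ continuous_on_subset[OF cont subset_UNIV]] by blast
  have \<Phi>0: "\<Phi> 0 = 0" using e by (simp add: \<Phi>_def tangent_ln_def max_def)
  have ge0: "0 \<le> \<Phi> a" using a(2)[of 0] assms(1) \<Phi>0 by simp
  have max: "\<Phi> b \<le> \<Phi> a" for b
    using a(2)[of b] bd[of b] ge0 unfolding \<Phi>_def by fastforce
  have le0: "int01 (\<lambda>t. (b \<bullet> f t) / max (1 + a \<bullet> f t) e) \<le> 0" for b
  proof -
    \<comment> \<open>\<open>D s\<close> is the derivative in direction \<open>b\<close> at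
      \<open>a + s *\<^sub>R b\<close>. By concavity \<open>s * D s\<close> is at most the increment
      of \<open>\<Phi>\<close>, hence at most 0; then \<open>s\<close> tends to 0.\<close>
    define D where "D s = int01 (\<lambda>t. (b \<bullet> f t) / max (1 + (a + s *\<^sub>R b) \<bullet> f t) e)" for s :: real
    have ci: "continuous_on {0..1} (\<lambda>t. (b \<bullet> f t) / max (1 + c \<bullet> f t) e)" for c
      using e by (intro continuous_intros) auto
    have D_le: "D s \<le> 0" if s: "0 < s" for s
    proof -
      have "s * D s = int01 (\<lambda>t. s * ((b \<bullet> f t) / max (1 + (a + s *\<^sub>R b) \<bullet> f t) e))"
        unfolding D_def by (rule integral_mult_right[symmetric])
      also have "\<dots> \<le> int01 (\<lambda>t. tangent_ln e (1 + (a + s *\<^sub>R b) \<bullet> f t) - tangent_ln e (1 + a \<bullet> f t))"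
      proof (intro int01_mono)
        fix t
        have "tangent_ln e (1 + a \<bullet> f t) - tangent_ln e (1 + (a + s *\<^sub>R b) \<bullet> f t)
          \<le> - (s * ((b \<bullet> f t) / max (1 + (a + s *\<^sub>R b) \<bullet> f t) e))"
          using tangent_ln_diff_le[OF e(1), of "1 + a \<bullet> f t" "1 + (a + s *\<^sub>R b) \<bullet> f t"]
          by (simp add: inner_add_left)
        then show "s * ((b \<bullet> f t) / max (1 + (a + s *\<^sub>R b) \<bullet> f t) e)
          \<le> tangent_ln e (1 + (a + s *\<^sub>R b) \<bullet> f t) - tangent_ln e (1 + a \<bullet> f t)" by linarith
      qed (use e in \<open>auto intro!: continuous_intros ci\<close>)
      also have "\<dots> = \<Phi> (a + s *\<^sub>R b) - \<Phi> a"
        unfolding \<Phi>_def using e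
        by (intro integral_diff integrable_continuous_interval) (auto intro!: continuous_intros)
      also have "\<dots> \<le> 0" using max by simp
      finally show ?thesis using s by (simp add: mult_le_0_iff)
    qed
    have "continuous_on UNIV D"
      unfolding D_def using e
      by (intro continuous_int01_param) (auto intro!: continuous_intros)
    then have "(D \<longlongrightarrow> D 0) (at_right 0)"
      by (auto simp: continuous_on_def intro: tendsto_within_subset)
    then have "D 0 \<le> 0"
      by (rule tendsto_upperbound) (auto simp: eventually_at_filter D_le)
    then show ?thesis by (simp add: D_def)
  qed
  define G where "G = int01 (\<lambda>t. inverse (max (1 + a \<bullet> f t) e) *\<^sub>R f t)"
  have cG: "continuous_on {0..1} (\<lambda>t. inverse (max (1 + a \<bullet> f t) e) *\<^sub>R f t)"
    using e f_cont by (intro continuous_intros) auto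
  \<comment> \<open>The inequality \<open>le0\<close> with \<open>b = G\<close> bounds the squared
    norm of \<open>G\<close> by 0.\<close>
  have "G \<bullet> G = int01 (\<lambda>t. (inverse (max (1 + a \<bullet> f t) e) *\<^sub>R f t) \<bullet> G)"
    unfolding G_def by (rule integral_component_eq[symmetric], rule integrable_continuous_interval, rule cG)
  also have "\<dots> = int01 (\<lambda>t. (G \<bullet> f t) / max (1 + a \<bullet> f t) e)"
    by (intro integral_cong) (simp add: inner_commute divide_inverse)
  also have "\<dots> \<le> 0" by (rule le0)
  finally have "G = 0" by (metis antisym inner_eq_zero_iff inner_ge_zero)
  then show thesis using that[of a] a ge0 unfolding \<Phi>_def G_def by auto
qed

end


section \<open>Near-optimal dual densities\<close>

context two_sided_path
begin

lemma tendsto_int01: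
  assumes "(\<lambda>k. a (k::nat)) \<longlonglongrightarrow> l" "continuous_on UNIV (\<Theta> :: real \<Rightarrow> real)"
  shows "(\<lambda>k. int01 (\<lambda>t. \<Theta> (1 + a k \<bullet> f t))) \<longlonglongrightarrow> int01 (\<lambda>t. \<Theta> (1 + l \<bullet> f t))"
proof -
  have "continuous_on UNIV (\<lambda>a. int01 (\<lambda>t. \<Theta> (1 + a \<bullet> f t)))"
    by (rule continuous_int01_param, rule continuous_on_compose2[OF assms(2)]) (auto intro!: continuous_intros)
  then show ?thesis
    using assms(1) by (auto simp: continuous_on_eq_continuous_at intro: isCont_tendsto_compose)
qed

text \<open>The bound is uniform in \<open>e\<close>: for \<open>e \<le> 1\<close> the penalty is at
  least the negative part of \<open>a \<bullet> f t\<close> minus 1, whose integral grows linearly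
  in \<open>norm a\<close>, while the gain is only logarithmic.\<close>

lemma tangent_ln_bound:
  obtains R where "0 < R"
    "\<And>e a. 0 < e \<Longrightarrow> e \<le> 1 \<Longrightarrow> 0 \<le> int01 (\<lambda>t. tangent_ln e (1 + a \<bullet> f t)) \<Longrightarrow> norm a \<le> R"
proof -
  obtain c where c: "0 < c" "\<And>u. c * norm u \<le> int01 (\<lambda>t. max 0 (- (u \<bullet> f t)))"
    using negative_part_lower_bound by blast
  obtain M where M: "0 < M" "\<And>t. t \<in> {0..1} \<Longrightarrow> norm (f t) \<le> M" using f_bound by blast
  define R where "R = (2 / c) * \<bar>c / (2 * M) + ln (2 * M / c)\<bar> + 1"
  have "norm a \<le> R" if e: "0 < e" "e \<le> 1" and a: "0 \<le> int01 (\<lambda>t. tangent_ln e (1 + a \<bullet> f t))" for e a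
  proof -
    have "int01 (\<lambda>t. tangent_ln e (1 + a \<bullet> f t))
        \<le> int01 (\<lambda>t. (ln (1 + norm a * M) + 1) - max 0 (- (a \<bullet> f t)))"
    proof (intro int01_mono)
      fix t :: real assume t: "t \<in> {0..1}"
      have "a \<bullet> f t \<le> norm a * norm (f t)" by (rule norm_cauchy_schwarz)
      also have "\<dots> \<le> norm a * M" using M t by (intro mult_left_mono) auto
      finally have "max (1 + a \<bullet> f t) 1 \<le> 1 + norm a * M" using M(1) by simp
      then have 1: "ln (max (1 + a \<bullet> f t) 1) \<le> ln (1 + norm a * M)" by (intro ln_mono) auto
      have "max 0 (- (1 + a \<bullet> f t)) * e \<le> max 0 (- (1 + a \<bullet> f t))"
        using e by (intro mult_left_le) auto
      then have "max 0 (- (1 + a \<bullet> f t)) \<le> max 0 (- (1 + a \<bullet> f t)) / e"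
        using e(1) by (simp only: pos_le_divide_eq)
      then show "tangent_ln e (1 + a \<bullet> f t) \<le> (ln (1 + norm a * M) + 1) - max 0 (- (a \<bullet> f t))"
        using tangent_ln_le[OF e, of "1 + a \<bullet> f t"] 1 by linarith
    qed (use e in \<open>auto intro!: continuous_intros\<close>)
    also have "\<dots> = int01 (\<lambda>t. ln (1 + norm a * M) + 1) - int01 (\<lambda>t. max 0 (- (a \<bullet> f t)))"
      by (intro integral_diff integrable_continuous_interval continuous_intros)
    also have "\<dots> \<le> ln (1 + norm a * M) + 1 - c * norm a" using c(2)[of a] by simp
    finally have 2: "0 \<le> ln (1 + norm a * M) + 1 - c * norm a" using a by linarith
    \<comment> \<open>The tangent of \<open>ln\<close> at \<open>2 * M / c\<close> has slope
      \<open>c / (2 * M)\<close>, so the logarithm absorbs only half of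
      \<open>c * norm a\<close>.\<close>
    have "ln (1 + norm a * M) - ln (2 * M / c) \<le> (1 + norm a * M - 2 * M / c) / (2 * M / c)"
      using c(1) M(1) by (intro ln_diff_le) (auto intro: add_pos_nonneg)
    also have "\<dots> = c / (2 * M) + c * norm a / 2 - 1" using c(1) M(1) by (simp add: field_simps)
    finally have "c * norm a / 2 \<le> c / (2 * M) + ln (2 * M / c)" using 2 by linarith
    then have "norm a \<le> (2 / c) * (c / (2 * M) + ln (2 * M / c))" using c(1) by (simp add: field_simps)
    also have "\<dots> \<le> (2 / c) * \<bar>c / (2 * M) + ln (2 * M / c)\<bar>" using c(1) by (intro mult_left_mono) auto
    finally show ?thesis unfolding R_def by simp
  qed
  moreover have "0 < R" unfolding R_def using c(1) by (intro add_nonneg_pos mult_nonneg_nonneg) auto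
  ultimately show thesis using that by blast
qed

text \<open>The candidate is the normalised reciprocal of
  \<open>max (1 + b \<bullet> f t) \<epsilon>\<close>, where \<open>b\<close> maximises the problem
  with the tangent continued below \<open>\<epsilon>\<close>. Stationarity gives orthogonality to
  \<open>f\<close>. Minus its logarithm integrates to almost \<open>V\<close> at most, because the
  maximisers accumulate at an admissible point as \<open>\<epsilon>\<close> decreases.\<close>

lemma dual_density:
  assumes "0 < \<delta>"
  obtains q where "continuous_on {0..1} q" "\<And>t. t \<in> {0..1} \<Longrightarrow> 0 < q t" "int01 q = 1"
    "int01 (\<lambda>t. q t *\<^sub>R f t) = 0" "int01 (\<lambda>t. - ln (q t)) \<le> V + \<delta>"
proof -
  obtain R where R: "0 < R"
    "\<And>e a. 0 < e \<Longrightarrow> e \<le> 1 \<Longrightarrow> 0 \<le> int01 (\<lambda>t. tangent_ln e (1 + a \<bullet> f t)) \<Longrightarrow> norm a \<le> R"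
    using tangent_ln_bound by blast
  obtain M where M: "0 < M" "\<And>t. t \<in> {0..1} \<Longrightarrow> norm (f t) \<le> M" using f_bound by blast
  define e where "e k = inverse (real (Suc k))" for k
  have e: "0 < e k" "e k \<le> 1" for k by (auto simp: e_def field_simps)
  have e0: "e \<longlonglongrightarrow> 0" unfolding e_def by (rule LIMSEQ_inverse_real_of_nat)
  define P where "P k a \<longleftrightarrow> norm a \<le> R \<and> 0 \<le> int01 (\<lambda>t. tangent_ln (e k) (1 + a \<bullet> f t)) \<and>
    int01 (\<lambda>t. inverse (max (1 + a \<bullet> f t) (e k)) *\<^sub>R f t) = 0" for k a
  have "\<exists>a. P k a" for k
    by (rule tangent_ln_maximiser[OF R(1) _ e(1)[of k] e(2)[of k]], rule R(2)[OF e(1)[of k] e(2)[of k]])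
      (auto simp: P_def)
  then obtain a where aP: "\<And>k. P k (a k)" by metis
  have a: "\<And>k. norm (a k) \<le> R"
    "\<And>k. 0 \<le> int01 (\<lambda>t. tangent_ln (e k) (1 + a k \<bullet> f t))"
    "\<And>k. int01 (\<lambda>t. inverse (max (1 + a k \<bullet> f t) (e k)) *\<^sub>R f t) = 0"
    using aP by (auto simp: P_def)
  have "\<forall>k. a k \<in> cball 0 R" using a(1) by simp
  then obtain l r where r: "strict_mono r" "(a \<circ> r) \<longlonglongrightarrow> l"
    using compact_cball[of 0 R] unfolding compact_def by metis
  have lim: "(\<lambda>k. a (r k)) \<longlonglongrightarrow> l" using r(2) by (simp add: o_def)
  have er0: "(\<lambda>k. e (r k)) \<longlonglongrightarrow> 0" using LIMSEQ_subseq_LIMSEQ[OF e0 r(1)] by (simp add: o_def)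
  \<comment> \<open>The maximal value is at least 0, so 1 / \<open>e k\<close> times the integrated
    violation \<open>h (a k)\<close> stays below \<open>ln (1 + R * M)\<close>; hence the violation
    vanishes in the limit.\<close>
  have adm: "0 \<le> 1 + l \<bullet> f t" if t: "t \<in> {0..1}" for t
  proof -
    define h where "h b = int01 (\<lambda>t. max 0 (- (1 + b \<bullet> f t)))" for b
    have h_le: "h (a k) \<le> ln (1 + R * M) * e k" for k
    proof -
      have "int01 (\<lambda>t. tangent_ln (e k) (1 + a k \<bullet> f t))
        \<le> int01 (\<lambda>t. ln (1 + R * M) - inverse (e k) * max 0 (- (1 + a k \<bullet> f t)))"
      proof (intro int01_mono)
        fix t :: real assume t: "t \<in> {0..1}"
        have "a k \<bullet> f t \<le> norm (a k) * norm (f t)" by (rule norm_cauchy_schwarz)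
        also have "\<dots> \<le> R * M" using M t a(1)[of k] R(1) by (intro mult_mono) auto
        finally have "max (1 + a k \<bullet> f t) 1 \<le> 1 + R * M" using M(1) R(1) by simp
        then have 1: "ln (max (1 + a k \<bullet> f t) 1) \<le> ln (1 + R * M)" by (intro ln_mono) auto
        then show "tangent_ln (e k) (1 + a k \<bullet> f t)
            \<le> ln (1 + R * M) - inverse (e k) * max 0 (- (1 + a k \<bullet> f t))"
          using tangent_ln_le[OF e, of k "1 + a k \<bullet> f t"] by (simp add: divide_inverse mult.commute)
      qed (use e[of k] in \<open>auto intro!: continuous_intros\<close>)
      also have "\<dots> = int01 (\<lambda>t. ln (1 + R * M)) - int01 (\<lambda>t. inverse (e k) * max 0 (- (1 + a k \<bullet> f t)))"
        by (intro integral_diff integrable_continuous_interval continuous_intros)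
      also have "int01 (\<lambda>t. inverse (e k) * max 0 (- (1 + a k \<bullet> f t))) = inverse (e k) * h (a k)"
        unfolding h_def by (rule integral_mult_right)
      finally have "inverse (e k) * h (a k) \<le> ln (1 + R * M)" using a(2)[of k] by simp
      then show ?thesis using e[of k] by (simp add: field_simps)
    qed
    have "(\<lambda>k. h (a (r k))) \<longlonglongrightarrow> h l"
      unfolding h_def by (rule tendsto_int01[OF lim]) (intro continuous_intros)
    moreover have "(\<lambda>k. ln (1 + R * M) * e (r k)) \<longlonglongrightarrow> ln (1 + R * M) * 0"
      by (intro tendsto_intros er0)
    ultimately have "h l \<le> 0" using h_le LIMSEQ_le by fastforce
    then have "max 0 (- (1 + l \<bullet> f t)) = 0"
      using int01_pos[of "\<lambda>t. max 0 (- (1 + l \<bullet> f t))" t] t unfolding h_def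
      by (force intro!: continuous_intros)
    then show ?thesis by simp
  qed
  \<comment> \<open>This shift makes the loss \<open>- ln (1 - k)\<close> in
    \<open>shifted_le_V\<close> equal to \<open>\<delta> / 2\<close>.\<close>
  define k where "k = 1 - exp (- (\<delta> / 2))"
  have k: "0 < k" "k < 1" "ln (1 - k) = - (\<delta> / 2)" using assms by (auto simp: k_def)
  have "int01 (\<lambda>t. ln (max (1 + l \<bullet> f t) k)) \<le> int01 (\<lambda>t. ln (1 + l \<bullet> f t + k))"
  proof (intro int01_mono)
    fix t :: real assume t: "t \<in> {0..1}"
    show "ln (max (1 + l \<bullet> f t) k) \<le> ln (1 + l \<bullet> f t + k)"
      using adm[OF t] k by (intro ln_mono) auto
  next
    have "\<And>t. t \<in> {0..1} \<Longrightarrow> 1 + l \<bullet> f t + k \<noteq> 0" using adm k(1) by fastforce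
    then show "continuous_on {0..1} (\<lambda>t. ln (1 + l \<bullet> f t + k))" by (intro continuous_intros) auto
    show "continuous_on {0..1} (\<lambda>t. ln (max (1 + l \<bullet> f t) k))" using k(1) by (intro continuous_intros) auto
  qed
  also have "\<dots> \<le> V + \<delta> / 2" using shifted_le_V[OF adm k(1,2)] k(3) by simp
  also have "\<dots> < V + \<delta>" using assms by simp
  finally have "int01 (\<lambda>t. ln (max (1 + l \<bullet> f t) k)) < V + \<delta>" .
  \<comment> \<open>The truncation level \<open>k\<close> stays fixed while \<open>e (r j)\<close>
    tends to 0. The integral is then continuous in the parameter, and \<open>e (r j) < k\<close>
    later lets truncation at \<open>e (r j)\<close> be bounded by truncation at
    \<open>k\<close>.\<close>
  moreover have "(\<lambda>j. int01 (\<lambda>t. ln (max (1 + a (r j) \<bullet> f t) k))) \<longlonglongrightarrow> int01 (\<lambda>t. ln (max (1 + l \<bullet> f t) k))"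
    using k(1) by (intro tendsto_int01[OF lim, of "\<lambda>x. ln (max x k)"] continuous_intros) auto
  ultimately have "eventually (\<lambda>j. int01 (\<lambda>t. ln (max (1 + a (r j) \<bullet> f t) k)) < V + \<delta>) sequentially"
    by (rule order_tendstoD(2)[rotated])
  moreover have "eventually (\<lambda>j. e (r j) < k) sequentially" using er0 k(1) by (rule order_tendstoD)
  ultimately have "eventually (\<lambda>j. int01 (\<lambda>t. ln (max (1 + a (r j) \<bullet> f t) k)) < V + \<delta> \<and> e (r j) < k) sequentially"
    by eventually_elim simp
  then obtain j where j: "int01 (\<lambda>t. ln (max (1 + a (r j) \<bullet> f t) k)) < V + \<delta>" "e (r j) < k"
    by (auto simp: eventually_sequentially)
  define b \<epsilon> where "b = a (r j)" and "\<epsilon> = e (r j)"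
  have \<epsilon>: "0 < \<epsilon>" "\<epsilon> < k" using e j by (auto simp: \<epsilon>_def)
  define q0 where "q0 t = inverse (max (1 + b \<bullet> f t) \<epsilon>)" for t
  have q0: "continuous_on {0..1} q0" "\<And>t. 0 < q0 t"
    using \<epsilon> unfolding q0_def by (auto intro!: continuous_intros)
  have q0f: "int01 (\<lambda>t. q0 t *\<^sub>R f t) = 0" using a(3)[of "r j"] by (simp add: q0_def b_def \<epsilon>_def)
  define C where "C = int01 q0"
  have C: "0 < C" unfolding C_def by (intro int01_pos[of _ 0]) (simp_all add: q0 less_imp_le less_imp_neq[OF q0(2), symmetric])
  \<comment> \<open>Orthogonality to \<open>f\<close> permits adding
    \<open>q0 t * (b \<bullet> f t)\<close> under the integral for \<open>C\<close>, and
    \<open>q0 t * (1 + b \<bullet> f t)\<close> is at most 1. So the mass \<open>C\<close> is at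
    most 1, and dividing by it can only lower \<open>- ln\<close>.\<close>
  have "0 = int01 (\<lambda>t. q0 t *\<^sub>R f t) \<bullet> b" using q0f by simp
  also have "\<dots> = int01 (\<lambda>t. (q0 t *\<^sub>R f t) \<bullet> b)"
    using q0 by (intro integral_component_eq[symmetric] integrable_continuous_interval continuous_intros)
  finally have "C = int01 q0 + int01 (\<lambda>t. (q0 t *\<^sub>R f t) \<bullet> b)" by (simp add: C_def)
  also have "\<dots> = int01 (\<lambda>t. q0 t + (q0 t *\<^sub>R f t) \<bullet> b)"
    using q0 by (intro integral_add[symmetric] integrable_continuous_interval continuous_intros)
  also have "\<dots> \<le> int01 (\<lambda>t. 1)"
  proof (intro int01_mono continuous_intros q0)
    fix t
    have "q0 t + (q0 t *\<^sub>R f t) \<bullet> b = (1 + b \<bullet> f t) * q0 t" by (simp add: algebra_simps inner_commute)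
    also have "\<dots> \<le> max (1 + b \<bullet> f t) \<epsilon> * q0 t" using q0(2)[of t] by (intro mult_right_mono) auto
    also have "\<dots> = 1" using \<epsilon> by (simp add: q0_def)
    finally show "q0 t + (q0 t *\<^sub>R f t) \<bullet> b \<le> 1" .
  qed
  finally have C1: "C \<le> 1" by simp
  show thesis
  proof (rule that[of "\<lambda>t. q0 t / C"])
    show "continuous_on {0..1} (\<lambda>t. q0 t / C)" using q0 C by (intro continuous_intros) auto
    show "0 < q0 t / C" for t using q0 C by simp
    have "int01 (\<lambda>t. q0 t / C) = int01 (\<lambda>t. q0 t * inverse C)" by (simp add: divide_inverse)
    also have "\<dots> = C * inverse C" unfolding C_def by (rule integral_mult_left)
    finally show "int01 (\<lambda>t. q0 t / C) = 1" using C by simp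
    have "int01 (\<lambda>t. (q0 t / C) *\<^sub>R f t) = int01 (\<lambda>t. inverse C *\<^sub>R (q0 t *\<^sub>R f t))"
      by (simp add: divide_inverse mult.commute)
    also have "\<dots> = inverse C *\<^sub>R 0" unfolding q0f[symmetric] by (rule integral_cmul)
    finally show "int01 (\<lambda>t. (q0 t / C) *\<^sub>R f t) = 0" by simp
    have "int01 (\<lambda>t. - ln (q0 t / C)) \<le> int01 (\<lambda>t. ln (max (1 + b \<bullet> f t) k))"
    proof (intro int01_mono)
      fix t
      have "- ln (q0 t / C) = ln (max (1 + b \<bullet> f t) \<epsilon>) + ln C"
        using C \<epsilon> q0(2)[of t] by (simp add: ln_div q0_def ln_inverse)
      also have "\<dots> \<le> ln (max (1 + b \<bullet> f t) \<epsilon>)" using C C1 by simp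
      also have "\<dots> \<le> ln (max (1 + b \<bullet> f t) k)" using \<epsilon> by (intro ln_mono) auto
      finally show "- ln (q0 t / C) \<le> ln (max (1 + b \<bullet> f t) k)" .
    next
      have "q0 t / C \<noteq> 0" for t using q0(2)[of t] C by simp
      then show "continuous_on {0..1} (\<lambda>t. - ln (q0 t / C))" using q0 C by (intro continuous_intros) auto
      show "continuous_on {0..1} (\<lambda>t. ln (max (1 + b \<bullet> f t) k))" using k(1) by (intro continuous_intros) auto
    qed
    then show "int01 (\<lambda>t. - ln (q0 t / C)) \<le> V + \<delta>" using j(1) by (simp add: b_def)
  qed
qed

end

text \<open>Monotone convergence: subtracting the shifted logarithms from an upper bound
  \<open>C\<close> gives nonnegative functions increasing to \<open>C\<close> minus
  \<open>elog (x t)\<close>, also where \<open>x t = 0\<close>. The formula trades the extended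
  integral for real integrals of continuous functions.\<close>

lemma eintegral01_elog:
  fixes x :: "real \<Rightarrow> real"
  assumes cont: "continuous_on {0..1} x" and nonneg: "\<And>t. t \<in> {0..1} \<Longrightarrow> 0 \<le> x t"
  shows "eintegral01 (\<lambda>t. elog (x t)) = (INF k. ereal (int01 (\<lambda>t. ln (x t + inverse (Suc k)))))"
proof -
  \<comment> \<open>Clamping the argument extends \<open>x\<close> continuously to the whole line,
    which gives Borel measurability there.\<close>
  define y where "y t = x (max 0 (min 1 t))" for t
  have y_eq: "y t = x t" if "t \<in> {0..1}" for t using that by (simp add: y_def)
  have y_cont: "continuous_on UNIV y"
    unfolding y_def by (intro continuous_on_compose2[OF cont] continuous_intros) auto
  have y0: "0 \<le> y t" for t unfolding y_def by (intro nonneg) auto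
  have ym [measurable]: "y \<in> borel_measurable borel"
    using y_cont by (rule borel_measurable_continuous_onI)
  have elm [measurable]: "(\<lambda>t. elog (y t)) \<in> borel_measurable borel" unfolding elog_def by measurable
  obtain M where "0 < M" "\<And>t. t \<in> {0..1} \<Longrightarrow> x t \<le> M" using continuous_on_Icc_bounded[OF cont] by blast
  then have M: "0 < M" "\<And>t. y t \<le> M" by (auto simp: y_def)
  define C where "C = ln (M + 1)"
  have C0: "0 \<le> C" using M by (simp add: C_def)
  define s where "s k = inverse (real (Suc k))" for k
  have s: "0 < s k" "s k \<le> 1" for k by (auto simp: s_def field_simps)
  have le_C: "ln (y t + s k) \<le> C" for t k
    unfolding C_def using M(2)[of t] s[of k] y0[of t] by (intro ln_mono) (auto intro: add_nonneg_pos)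
  have elog_le: "elog (y t) \<le> ereal C" for t
    using M(2)[of t] by (auto simp: elog_def C_def)
  define J where "J k = int01 (\<lambda>t. ln (y t + s k))" for k
  have cJ: "continuous_on {0..1} (\<lambda>t. ln (y t + s k))" for k
  proof -
    have "y t + s k \<noteq> 0" for t using y0[of t] s[of k] by linarith
    then show ?thesis using continuous_on_subset[OF y_cont] by (intro continuous_intros) auto
  qed
  define u where "u k t = ennreal (C - ln (y t + s k)) * indicator {0..1} t" for k t
  have um [measurable]: "u k \<in> borel_measurable lborel" for k unfolding u_def by measurable
  have int_u: "(\<integral>\<^sup>+ t. u k t \<partial>lborel) = ennreal (C - J k)" for k
  proof -
    have "((\<lambda>t. C - ln (y t + s k)) has_integral (C - J k)) {0..1}"
      unfolding J_def using has_integral_const_real[of C 0 1]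
      by (intro has_integral_diff integrable_integral integrable_continuous_interval cJ) simp
    then have "((\<lambda>t. (C - ln (y t + s k)) * indicator {0..1} t) has_integral (C - J k)) UNIV"
      by (subst (asm) has_integral_restrict_UNIV[symmetric]) (simp add: indicator_def of_bool_def if_distrib cong: if_cong)
    then have "(\<integral>\<^sup>+ t. ennreal ((C - ln (y t + s k)) * indicator {0..1} t) \<partial>lborel) = ennreal (C - J k)"
      using le_C by (intro nn_integral_has_integral_lborel) (auto simp: indicator_def)
    then show ?thesis unfolding u_def using le_C
      by (simp add: ennreal_mult'' ennreal_indicator)
  qed
  have s_antimono: "s m \<le> s k" if "k \<le> m" for k m using that by (auto simp: s_def field_simps)
  have "incseq u"
  proof (rule incseq_SucI, rule le_funI)
    fix k t
    have "ln (y t + s (Suc k)) \<le> ln (y t + s k)"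
      using y0[of t] s[of "Suc k"] s_antimono[of k "Suc k"] by (intro ln_mono) auto
    then show "u k t \<le> u (Suc k) t" unfolding u_def by (intro mult_right_mono ennreal_leI) auto
  qed
  then have mono_conv: "(\<integral>\<^sup>+ t. (SUP k. u k t) \<partial>lborel) = (SUP k. ennreal (C - J k))"
    by (subst nn_integral_monotone_convergence_SUP) (auto simp: int_u)
  have s0: "s \<longlonglongrightarrow> 0" unfolding s_def by (rule LIMSEQ_inverse_real_of_nat)
  have sup_u: "(SUP k. u k t) = e2ennreal (ereal C - elog (y t)) * indicator {0..1} t" for t
  proof -
    have "(\<lambda>k. u k t) \<longlonglongrightarrow> (SUP k. u k t)"
      using \<open>incseq u\<close> by (intro LIMSEQ_SUP) (auto simp: incseq_def le_fun_def)
    moreover have "(\<lambda>k. u k t) \<longlonglongrightarrow> e2ennreal (ereal C - elog (y t)) * indicator {0..1} t"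
    proof (cases "t \<in> {0..1} \<and> y t = 0")
      case True
      have "filterlim (\<lambda>k. ln (s k)) at_bot sequentially"
        by (rule filterlim_compose[OF ln_at_0]) (simp add: filterlim_at s0 s less_imp_neq[OF s(1), symmetric])
      then have "filterlim (\<lambda>k. C + - ln (s k)) at_top sequentially"
        by (intro filterlim_tendsto_add_at_top[OF tendsto_const]) (simp add: filterlim_uminus_at_top)
      then have "(\<lambda>k. ennreal (C + - ln (s k))) \<longlonglongrightarrow> top"
        by (simp add: ennreal_tendsto_top_eq_at_top)
      then show ?thesis using True by (simp add: u_def elog_def e2ennreal_infty)
    next
      case False
      then consider "t \<notin> {0..1}" | "t \<in> {0..1}" "0 < y t" using y0[of t] by fastforce
      then show ?thesis
      proof cases
        case 2
        have "(\<lambda>k. ennreal (C - ln (y t + s k))) \<longlonglongrightarrow> ennreal (C - ln (y t + 0))"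
          using 2 by (intro tendsto_intros s0) auto
        then show ?thesis using 2 by (simp add: u_def elog_def e2ennreal_ereal)
      qed (simp add: u_def)
    qed
    ultimately show ?thesis by (rule LIMSEQ_unique)
  qed
  define P where "P = (\<integral>\<^sup>+ t\<in>{0..1}. e2ennreal (elog (y t)) \<partial>lborel)"
  define Nn where "Nn = (\<integral>\<^sup>+ t\<in>{0..1}. e2ennreal (- elog (y t)) \<partial>lborel)"
  define T where "T = (\<integral>\<^sup>+ t\<in>{0..1}. e2ennreal (ereal C - elog (y t)) \<partial>lborel)"
  have T_eq: "T = (SUP k. ennreal (C - J k))" unfolding T_def using mono_conv by (simp add: sup_u)
  have real_case: "ennreal (C - r) + ennreal r = ennreal C + ennreal (- r)" if "r \<le> C" for r
  proof (cases "0 \<le> r")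
    case True
    then show ?thesis using that by (simp add: ennreal_neg flip: ennreal_plus)
  next
    case False
    then show ?thesis using C0 by (simp add: ennreal_neg flip: ennreal_plus)
  qed
  \<comment> \<open>An additive form of the splitting into positive and negative parts, because
    subtraction in \<open>ennreal\<close> truncates.\<close>
  have "e2ennreal (ereal C - L) + e2ennreal L = ennreal C + e2ennreal (- L)" if "L \<le> ereal C" for L
    using that by (cases L) (auto simp: e2ennreal_ereal e2ennreal_infty e2ennreal_neg real_case)
  then have pw: "e2ennreal (ereal C - elog (y t)) + e2ennreal (elog (y t)) = ennreal C + e2ennreal (- elog (y t))" for t
    using elog_le by blast
  have "T + P = (\<integral>\<^sup>+ t\<in>{0..1}. (e2ennreal (ereal C - elog (y t)) + e2ennreal (elog (y t))) \<partial>lborel)"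
    unfolding T_def P_def by (simp add: nn_integral_add distrib_right)
  also have "\<dots> = ennreal C + Nn"
    unfolding pw Nn_def by (simp add: nn_integral_add distrib_right nn_integral_cmult)
  finally have TP: "T + P = ennreal C + Nn" .
  \<comment> \<open>\<open>elog (y t)\<close> is bounded above, so the positive part
    \<open>P\<close> is finite and may be moved across the equation \<open>TP\<close> in
    \<open>ereal\<close>.\<close>
  have "P \<le> (\<integral>\<^sup>+ (t::real)\<in>{0..1}. ennreal C \<partial>lborel)"
    unfolding P_def
  proof (intro nn_integral_mono mult_right_mono)
    show "e2ennreal (elog (y t)) \<le> ennreal C" for t
      using e2ennreal_mono[OF elog_le[of t]] by (simp add: e2ennreal_ereal)
  qed simp
  also have "\<dots> = ennreal C" by (simp add: nn_integral_cmult)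
  finally obtain p where p: "P = ennreal p" "0 \<le> p"
    by (metis ennreal_cases infinity_ennreal_def neq_top_trans ennreal_neq_top)
  have J_le: "J k \<le> C" for k
  proof -
    have "J k \<le> int01 (\<lambda>t. C)" unfolding J_def by (intro int01_mono cJ le_C continuous_intros)
    then show ?thesis by simp
  qed
  have T_e: "enn2ereal T = (SUP k. ereal (C - J k))"
  proof -
    have "0 \<le> ereal (C - J 0)" using J_le by simp
    also have "\<dots> \<le> (SUP k. ereal (C - J k))" by (rule SUP_upper) simp
    finally show ?thesis using J_le
      by (simp add: T_eq Sup_ennreal.rep_eq image_image enn2ereal_ennreal max_def)
  qed
  have "enn2ereal T + ereal p = ereal C + enn2ereal Nn"
    using arg_cong[OF TP, of enn2ereal] p C0 by (simp add: plus_ennreal.rep_eq enn2ereal_ennreal)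
  then have "ereal p - enn2ereal Nn = ereal C - enn2ereal T"
    by (cases "enn2ereal T"; cases "enn2ereal Nn") auto
  also have "\<dots> = (INF k. ereal C - ereal (C - J k))"
    unfolding T_e by (subst INF_ereal_minus_right) auto
  also have "\<dots> = (INF k. ereal (J k))" by simp
  finally have "eintegral01 (\<lambda>t. elog (y t)) = (INF k. ereal (J k))"
    unfolding eintegral01_def P_def[symmetric] Nn_def[symmetric] using p by (simp add: enn2ereal_ennreal)
  moreover have "J k = int01 (\<lambda>t. ln (x t + inverse (Suc k)))" for k
    unfolding J_def s_def by (intro integral_cong) (simp add: y_eq)
  moreover have "eintegral01 (\<lambda>t. elog (y t)) = eintegral01 (\<lambda>t. elog (x t))"
    unfolding eintegral01_def
    by (intro arg_cong2[where f = "(-)"] arg_cong[where f = enn2ereal] nn_integral_cong)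
      (auto simp: y_eq indicator_def)
  ultimately show ?thesis by simp
qed

section \<open>Attainment and uniqueness on the closed admissible set\<close>

context two_sided_path
begin

definition shifted_int :: "nat \<Rightarrow> 'a \<Rightarrow> real" where
  "shifted_int k a = int01 (\<lambda>t. ln (1 + a \<bullet> f t + inverse (Suc k)))"

lemma eintegral01_admissible:
  assumes "\<And>t. t \<in> {0..1} \<Longrightarrow> 0 \<le> 1 + a \<bullet> f t"
  shows "eintegral01 (\<lambda>t. elog (1 + a \<bullet> f t)) = (INF k. ereal (shifted_int k a))"
  unfolding shifted_int_def by (intro eintegral01_elog assms continuous_intros)

text \<open>The extended integral lies below every shifted one, and the loss in
  \<open>shifted_le_V\<close> tends to 0 with the shift.\<close>

lemma eintegral01_le_V:
  assumes "\<And>t. t \<in> {0..1} \<Longrightarrow> 0 \<le> 1 + a \<bullet> f t"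
  shows "eintegral01 (\<lambda>t. elog (1 + a \<bullet> f t)) \<le> ereal V"
proof (rule LIMSEQ_le_const)
  have "(\<lambda>k. V - ln (1 - inverse (real (Suc k)))) \<longlonglongrightarrow> V - ln (1 - 0)"
    by (intro tendsto_intros LIMSEQ_inverse_real_of_nat) auto
  then show "(\<lambda>k. ereal (V - ln (1 - inverse (real (Suc k))))) \<longlonglongrightarrow> ereal V" by simp
  \<comment> \<open>For \<open>k = 0\<close> the shift would be 1, which \<open>shifted_le_V\<close>
    excludes.\<close>
  have "eintegral01 (\<lambda>t. elog (1 + a \<bullet> f t)) \<le> ereal (V - ln (1 - inverse (real (Suc k))))" if "1 \<le> k" for k
  proof -
    have "eintegral01 (\<lambda>t. elog (1 + a \<bullet> f t)) \<le> ereal (shifted_int k a)"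
      by (subst eintegral01_admissible[OF assms]) (auto intro: INF_lower)
    also have "shifted_int k a \<le> V - ln (1 - inverse (real (Suc k)))"
      unfolding shifted_int_def using that by (intro shifted_le_V assms) (auto simp: field_simps)
    finally show ?thesis by simp
  qed
  then show "\<exists>N. \<forall>n\<ge>N. eintegral01 (\<lambda>t. elog (1 + a \<bullet> f t)) \<le> ereal (V - ln (1 - inverse (real (Suc n))))"
    by blast
qed

text \<open>A maximising sequence has an admissible limit point \<open>l\<close>. The unshifted
  integral need not be continuous there, but each shifted one is, and it dominates the unshifted
  one; this gives \<open>V \<le> shifted_int k l\<close> for every \<open>k\<close>.\<close>

lemma V_attained:
  obtains a where "\<And>t. t \<in> {0..1} \<Longrightarrow> 0 \<le> 1 + a \<bullet> f t" "eintegral01 (\<lambda>t. elog (1 + a \<bullet> f t)) = ereal V"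
proof -
  obtain R where R: "0 < R" "\<And>a. (\<And>t. t \<in> {0..1} \<Longrightarrow> 0 \<le> 1 + a \<bullet> f t) \<Longrightarrow> norm a \<le> R"
    using bounded_admissible by blast
  define s where "s k = inverse (real (Suc k))" for k
  have s: "0 < s k" for k by (simp add: s_def)
  have s0: "s \<longlonglongrightarrow> 0" unfolding s_def by (rule LIMSEQ_inverse_real_of_nat)
  define P where "P k a \<longleftrightarrow> (\<forall>t\<in>{0..1}. 0 < 1 + a \<bullet> f t) \<and> V - s k < int01 (\<lambda>t. ln (1 + a \<bullet> f t))" for k a
  have "\<exists>a. P k a" for k unfolding P_def by (rule V_approx[OF s[of k]]) blast
  then obtain a where aP: "\<And>k. P k (a k)" by metis
  have a: "0 < 1 + a k \<bullet> f t" if "t \<in> {0..1}" for k t using aP[of k] that by (auto simp: P_def)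
  have aV: "V - s k < int01 (\<lambda>t. ln (1 + a k \<bullet> f t))" for k using aP by (auto simp: P_def)
  have "\<forall>k. a k \<in> cball 0 R" using R(2) a by (simp add: less_imp_le)
  then obtain l r where r: "strict_mono r" "(a \<circ> r) \<longlonglongrightarrow> l"
    using compact_cball[of 0 R] unfolding compact_def by metis
  have lim: "(\<lambda>k. a (r k)) \<longlonglongrightarrow> l" using r(2) by (simp add: o_def)
  have sr0: "(\<lambda>k. s (r k)) \<longlonglongrightarrow> 0" using LIMSEQ_subseq_LIMSEQ[OF s0 r(1)] by (simp add: o_def)
  have adm: "0 \<le> 1 + l \<bullet> f t" if t: "t \<in> {0..1}" for t
  proof (rule LIMSEQ_le_const)
    show "(\<lambda>k. 1 + a (r k) \<bullet> f t) \<longlonglongrightarrow> 1 + l \<bullet> f t" by (intro tendsto_intros lim)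
    show "\<exists>N. \<forall>n\<ge>N. 0 \<le> 1 + a (r n) \<bullet> f t" using a[OF t] less_imp_le by blast
  qed
  have V_le: "V \<le> shifted_int k l" for k
  proof (rule LIMSEQ_le)
    \<comment> \<open>Replacing \<open>x\<close> by \<open>max x 0\<close> makes the shifted
      logarithm continuous on the whole line and leaves it unchanged on admissible values.\<close>
    have nz: "max x 0 + s k \<noteq> 0" for x using s[of k] by (smt (verit))
    have "(\<lambda>j. int01 (\<lambda>t. ln (max (1 + a (r j) \<bullet> f t) 0 + s k)))
      \<longlonglongrightarrow> int01 (\<lambda>t. ln (max (1 + l \<bullet> f t) 0 + s k))"
      using nz by (intro tendsto_int01[OF lim, of "\<lambda>x. ln (max x 0 + s k)"] continuous_intros) auto
    also have "int01 (\<lambda>t. ln (max (1 + l \<bullet> f t) 0 + s k)) = shifted_int k l"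
      unfolding shifted_int_def s_def by (intro integral_cong) (simp add: adm)
    finally show "(\<lambda>j. int01 (\<lambda>t. ln (max (1 + a (r j) \<bullet> f t) 0 + s k))) \<longlonglongrightarrow> shifted_int k l" .
    have "(\<lambda>j. V - s (r j)) \<longlonglongrightarrow> V - 0" by (intro tendsto_intros sr0)
    then show "(\<lambda>j. V - s (r j)) \<longlonglongrightarrow> V" by simp
    have "V - s (r j) \<le> int01 (\<lambda>t. ln (max (1 + a (r j) \<bullet> f t) 0 + s k))" for j
    proof -
      have "V - s (r j) \<le> int01 (\<lambda>t. ln (1 + a (r j) \<bullet> f t))" using aV[of "r j"] by simp
      also have "\<dots> \<le> int01 (\<lambda>t. ln (max (1 + a (r j) \<bullet> f t) 0 + s k))"
      proof (intro int01_mono)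
        fix t :: real assume t: "t \<in> {0..1}"
        show "ln (1 + a (r j) \<bullet> f t) \<le> ln (max (1 + a (r j) \<bullet> f t) 0 + s k)"
          using a[OF t, of "r j"] s[of k] by (intro ln_mono) auto
      next
        have "\<And>t. t \<in> {0..1} \<Longrightarrow> 1 + a (r j) \<bullet> f t \<noteq> 0" using a by (metis less_irrefl)
        then show "continuous_on {0..1} (\<lambda>t. ln (1 + a (r j) \<bullet> f t))" by (intro continuous_intros) auto
        show "continuous_on {0..1} (\<lambda>t. ln (max (1 + a (r j) \<bullet> f t) 0 + s k))"
          using nz by (intro continuous_intros) auto
      qed
      finally show ?thesis .
    qed
    then show "\<exists>N. \<forall>n\<ge>N. V - s (r n) \<le> int01 (\<lambda>t. ln (max (1 + a (r n) \<bullet> f t) 0 + s k))" by blast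
  qed
  have "ereal V \<le> eintegral01 (\<lambda>t. elog (1 + l \<bullet> f t))"
    by (subst eintegral01_admissible[OF adm]) (auto intro: INF_greatest simp: V_le)
  then show thesis using that[of l] adm eintegral01_le_V[OF adm] by (meson antisym)
qed

text \<open>Strict concavity, made quantitative: the midpoint would exceed \<open>V\<close> by a
  fixed \<open>\<gamma>\<close> for every shift, hence also in the infimum over the shifts.\<close>

lemma V_attained_unique:
  assumes a: "\<And>t. t \<in> {0..1} \<Longrightarrow> 0 \<le> 1 + a \<bullet> f t" "eintegral01 (\<lambda>t. elog (1 + a \<bullet> f t)) = ereal V"
    and b: "\<And>t. t \<in> {0..1} \<Longrightarrow> 0 \<le> 1 + b \<bullet> f t" "eintegral01 (\<lambda>t. elog (1 + b \<bullet> f t)) = ereal V"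
  shows "a = b"
proof (rule ccontr)
  assume "a \<noteq> b"
  then obtain t0 where t0: "t0 \<in> {0..1}" "(a - b) \<bullet> f t0 < 0" using two_sided[of "a - b"] by auto
  obtain M where M: "0 < M" "\<And>t. t \<in> {0..1} \<Longrightarrow> norm (f t) \<le> M" using f_bound by blast
  define m where "m = (1 / 2) *\<^sub>R (a + b)"
  have m_eq: "1 + m \<bullet> f t = ((1 + a \<bullet> f t) + (1 + b \<bullet> f t)) / 2" for t
    by (simp add: m_def inner_add_left)
  have m: "0 \<le> 1 + m \<bullet> f t" if "t \<in> {0..1}" for t unfolding m_eq using a(1)[OF that] b(1)[OF that] by simp
  define K where "K = 2 + (norm a + norm b) * M"
  have K: "1 + a \<bullet> f t + s \<le> K" "1 + b \<bullet> f t + s \<le> K" if "t \<in> {0..1}" "s \<le> 1" for t s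
  proof -
    have "c \<bullet> f t \<le> norm c * M" for c
      using norm_cauchy_schwarz[of c "f t"] M(2)[OF that(1)] mult_left_mono[of "norm (f t)" M "norm c"] by simp
    note c = this
    have "0 \<le> norm a * M" "0 \<le> norm b * M" using M(1) by simp_all
    with c[of a] c[of b] show "1 + a \<bullet> f t + s \<le> K" "1 + b \<bullet> f t + s \<le> K"
      using that(2) \<open>0 \<le> norm a * M\<close> \<open>0 \<le> norm b * M\<close> unfolding K_def distrib_right by linarith+
  qed
  have K0: "0 < K" using M(1) by (auto simp: K_def intro!: add_pos_nonneg)
  \<comment> \<open>From ((x + y) / 2)^2 = x y + (x - y)^2 / 4 and x y \<le> K^2, the squared
    midpoint is at least x y times \<open>G t\<close>; the shift cancels in x - y.\<close>
  define G where "G t = 1 + ((a - b) \<bullet> f t)\<^sup>2 / (4 * K\<^sup>2)" for t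
  have G1: "1 \<le> G t" for t by (simp add: G_def)
  have Gc: "continuous_on {0..1} G" unfolding G_def using K0 by (intro continuous_intros) auto
  define \<gamma> where "\<gamma> = int01 (\<lambda>t. ln (G t) / 2)"
  have cG: "continuous_on {0..1} (\<lambda>t. ln (G t) / 2)"
    using G1 by (intro continuous_intros Gc) (auto, smt (verit))
  have \<gamma>: "0 < \<gamma>" unfolding \<gamma>_def
  proof (rule int01_pos[OF cG _ t0(1)])
    show "0 \<le> ln (G t) / 2" for t using G1[of t] by simp
    have "1 < G t0" using t0(2) K0 by (simp add: G_def)
    then show "ln (G t0) / 2 \<noteq> 0" by simp
  qed
  have "V + \<gamma> \<le> shifted_int k m" for k
  proof -
    define s where "s = inverse (real (Suc k))"
    have s: "0 < s" "s \<le> 1" by (auto simp: s_def field_simps)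
    have c: "continuous_on {0..1} (\<lambda>t. ln (1 + c \<bullet> f t + s))" if "\<And>t. t \<in> {0..1} \<Longrightarrow> 0 \<le> 1 + c \<bullet> f t" for c
    proof -
      have "\<And>t. t \<in> {0..1} \<Longrightarrow> 1 + c \<bullet> f t + s \<noteq> 0" using that s by (smt (verit))
      then show ?thesis by (intro continuous_intros) auto
    qed
    note ca = c[OF a(1)] and cb = c[OF b(1)] and cm = c[OF m]
    have "ereal V \<le> ereal (shifted_int k a)" unfolding a(2)[symmetric] by (subst eintegral01_admissible[OF a(1)]) (auto intro: INF_lower)
    moreover have "ereal V \<le> ereal (shifted_int k b)" unfolding b(2)[symmetric] by (subst eintegral01_admissible[OF b(1)]) (auto intro: INF_lower)
    ultimately have "V \<le> int01 (\<lambda>t. ln (1 + a \<bullet> f t + s)) / 2 + int01 (\<lambda>t. ln (1 + b \<bullet> f t + s)) / 2"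
      by (simp add: shifted_int_def s_def)
    then have "V + \<gamma> \<le> int01 (\<lambda>t. ln (1 + a \<bullet> f t + s)) / 2 + int01 (\<lambda>t. ln (1 + b \<bullet> f t + s)) / 2 + \<gamma>" by simp
    also have "\<dots> = int01 (\<lambda>t. ln (1 + a \<bullet> f t + s) / 2 + ln (1 + b \<bullet> f t + s) / 2 + ln (G t) / 2)"
      unfolding \<gamma>_def integral_divide[symmetric]
      by (subst integral_add; (subst integral_add)?;
          (intro integrable_continuous_interval continuous_intros ca cb cG)?) auto
    also have "\<dots> \<le> int01 (\<lambda>t. ln (1 + m \<bullet> f t + s))"
    proof (intro int01_mono)
      fix t :: real assume t: "t \<in> {0..1}"
      define x y where "x = 1 + a \<bullet> f t + s" and "y = 1 + b \<bullet> f t + s"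
      have x: "0 < x" "x \<le> K" and y: "0 < y" "y \<le> K"
        using a(1)[OF t] b(1)[OF t] s K[OF t s(2)] by (auto simp: x_def y_def)
      have xy: "x - y = (a - b) \<bullet> f t" by (simp add: x_def y_def inner_diff_left)
      have "x * y * (G t - 1) \<le> K * K * (G t - 1)"
        using x y G1[of t] by (intro mult_right_mono mult_mono) auto
      also have "\<dots> = (x - y)\<^sup>2 / 4" using K0 unfolding xy G_def by (simp add: power2_eq_square)
      finally have "x * y * G t \<le> ((x + y) / 2)\<^sup>2" by (simp add: algebra_simps power2_eq_square)
      then have "ln (x * y * G t) \<le> ln (((x + y) / 2)\<^sup>2)"
        using x y G1[of t] by (intro ln_mono) auto
      then have le: "ln x + ln y + ln (G t) \<le> 2 * ln ((x + y) / 2)"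
        using x y G1[of t] by (simp add: ln_mult ln_realpow)
      have mid: "(x + y) / 2 = 1 + m \<bullet> f t + s" unfolding m_eq by (simp add: x_def y_def field_simps)
      from le[unfolded mid] show "ln (1 + a \<bullet> f t + s) / 2 + ln (1 + b \<bullet> f t + s) / 2 + ln (G t) / 2 \<le> ln (1 + m \<bullet> f t + s)"
        unfolding x_def y_def by linarith
    next
      show "continuous_on {0..1} (\<lambda>t. ln (1 + a \<bullet> f t + s) / 2 + ln (1 + b \<bullet> f t + s) / 2 + ln (G t) / 2)"
        by (rule continuous_on_add[OF continuous_on_add[OF continuous_on_divide[OF ca continuous_on_const]
                continuous_on_divide[OF cb continuous_on_const]] cG]) auto
    qed (rule cm)
    finally show ?thesis by (simp add: shifted_int_def s_def)
  qed
  then have "ereal (V + \<gamma>) \<le> eintegral01 (\<lambda>t. elog (1 + m \<bullet> f t))"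
    by (subst eintegral01_admissible[OF m]) (auto intro: INF_greatest)
  also have "\<dots> \<le> ereal V" by (rule eintegral01_le_V[OF m])
  finally show False using \<gamma> by simp
qed

end

text \<open>On \<open>K_bar f\<close> the integral is at most \<open>V\<close>, with equality at
  exactly one point. So the minimisers are the points of equality, and \<open>arg_min_on\<close>,
  which is a choice operator, returns one of them.\<close>

lemma g_fun_minimum:
  fixes f :: "real \<Rightarrow> real ^ 'p"
  assumes "two_sided_path f"
  shows "\<exists>!y. is_arg_min (g_fun f) (\<lambda>y. y \<in> K_bar f) y"
    and "- g_fun f (arg_min_on (g_fun f) (K_bar f)) = el_val f"
proof -
  interpret two_sided_path f by fact
  have K: "0 \<le> 1 + y \<bullet> f t" if "y \<in> K_bar f" "t \<in> {0..1}" for y t using that by (auto simp: K_bar_def)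
  obtain a where a: "\<And>t. t \<in> {0..1} \<Longrightarrow> 0 \<le> 1 + a \<bullet> f t" "eintegral01 (\<lambda>t. elog (1 + a \<bullet> f t)) = ereal V"
    using V_attained by blast
  have iff: "is_arg_min (g_fun f) (\<lambda>y. y \<in> K_bar f) y \<longleftrightarrow>
      y \<in> K_bar f \<and> eintegral01 (\<lambda>t. elog (1 + y \<bullet> f t)) = ereal V" for y
  proof
    assume y: "is_arg_min (g_fun f) (\<lambda>y. y \<in> K_bar f) y"
    then have yK: "y \<in> K_bar f" by (simp add: is_arg_min_def)
    have "a \<in> K_bar f" using a(1) by (simp add: K_bar_def)
    then have "\<not> g_fun f a < g_fun f y" using y by (simp add: is_arg_min_def)
    then have "ereal V \<le> eintegral01 (\<lambda>t. elog (1 + y \<bullet> f t))" by (simp add: g_fun_def a(2) not_less ereal_minus_le_minus flip: uminus_ereal.simps)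
    then show "y \<in> K_bar f \<and> eintegral01 (\<lambda>t. elog (1 + y \<bullet> f t)) = ereal V"
      using yK eintegral01_le_V[of y] K[OF yK] by (auto intro: antisym)
  next
    assume y: "y \<in> K_bar f \<and> eintegral01 (\<lambda>t. elog (1 + y \<bullet> f t)) = ereal V"
    show "is_arg_min (g_fun f) (\<lambda>y. y \<in> K_bar f) y"
      using y eintegral01_le_V K
      by (simp add: is_arg_min_def g_fun_def not_less ereal_minus_le_minus flip: uminus_ereal.simps)
  qed
  show ex1: "\<exists>!y. is_arg_min (g_fun f) (\<lambda>y. y \<in> K_bar f) y"
    unfolding iff
  proof (rule ex1I[of _ a])
    show "a \<in> K_bar f \<and> eintegral01 (\<lambda>t. elog (1 + a \<bullet> f t)) = ereal V" using a by (simp add: K_bar_def)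
    show "y = a" if "y \<in> K_bar f \<and> eintegral01 (\<lambda>t. elog (1 + y \<bullet> f t)) = ereal V" for y
      using that a K by (intro V_attained_unique) auto
  qed
  have "is_arg_min (g_fun f) (\<lambda>y. y \<in> K_bar f) (arg_min_on (g_fun f) (K_bar f))"
    unfolding arg_min_on_def arg_min_def using ex1 by (metis someI_ex)
  then show "- g_fun f (arg_min_on (g_fun f) (K_bar f)) = el_val f"
    unfolding iff by (simp add: g_fun_def el_val_eq)
qed


section \<open>Riemann sums and discrete likelihoods\<close>

text \<open>Each cell contributes an error of at most \<open>e / real n\<close>. The bound up to
  cell \<open>m\<close> is the form that the induction over cells needs; it is applied with
  \<open>m = n\<close>.\<close>

lemma riemann_cell_bound:
  fixes \<phi> :: "real \<Rightarrow> 'c::euclidean_space"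
  assumes cont: "continuous_on {0..1} \<phi>" and n: "0 < n" and "m \<le> n"
    and close: "\<And>s t. s \<in> {0..1} \<Longrightarrow> t \<in> {0..1} \<Longrightarrow> \<bar>s - t\<bar> \<le> 1 / real n \<Longrightarrow> norm (\<phi> s - \<phi> t) \<le> e"
  shows "norm ((1 / real n) *\<^sub>R (\<Sum>i = 1..m. \<phi> (real i / real n)) - integral {0..real m / real n} \<phi>)
    \<le> real m / real n * e"
  using \<open>m \<le> n\<close>
proof (induction m)
  case 0
  then show ?case by simp
next
  case (Suc m)
  let ?a = "real m / real n" and ?b = "real (Suc m) / real n"
  have ab: "0 \<le> ?a" "?a \<le> ?b" "?b \<le> 1" "?b - ?a = 1 / real n"
    using Suc.prems n by (auto simp: field_simps)
  have int: "\<phi> integrable_on {u..v}" if "0 \<le> u" "v \<le> 1" for u v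
    using that by (intro integrable_continuous_interval continuous_on_subset[OF cont]) auto
  have split: "integral {0..?b} \<phi> = integral {0..?a} \<phi> + integral {?a..?b} \<phi>"
    using ab int by (intro Henstock_Kurzweil_Integration.integral_combine[symmetric]) auto
  have "(1 / real n) *\<^sub>R \<phi> ?b - integral {?a..?b} \<phi> = integral {?a..?b} (\<lambda>t. \<phi> ?b) - integral {?a..?b} \<phi>"
    using ab by simp
  also have "\<dots> = integral {?a..?b} (\<lambda>t. \<phi> ?b - \<phi> t)"
    using ab int by (intro integral_diff[symmetric]) auto
  also have "norm \<dots> \<le> integral {?a..?b} (\<lambda>t. e)"
  proof (intro integral_norm_bound_integral)
    show "(\<lambda>t. \<phi> ?b - \<phi> t) integrable_on {?a..?b}" using ab int by (intro integrable_diff) auto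
    show "norm (\<phi> ?b - \<phi> t) \<le> e" if t: "t \<in> {?a..?b}" for t
    proof -
      have "0 \<le> t" "t \<le> 1" "0 \<le> ?b" "\<bar>?b - t\<bar> \<le> 1 / real n"
        using t ab unfolding atLeastAtMost_iff by linarith+
      then show ?thesis using ab(3) by (intro close) auto
    qed
  qed auto
  also have "\<dots> = 1 / real n * e" using ab by simp
  finally have cell: "norm ((1 / real n) *\<^sub>R \<phi> ?b - integral {?a..?b} \<phi>) \<le> 1 / real n * e" .
  have "(1 / real n) *\<^sub>R (\<Sum>i = 1..Suc m. \<phi> (real i / real n)) - integral {0..?b} \<phi>
    = ((1 / real n) *\<^sub>R (\<Sum>i = 1..m. \<phi> (real i / real n)) - integral {0..?a} \<phi>)
      + ((1 / real n) *\<^sub>R \<phi> ?b - integral {?a..?b} \<phi>)"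
    unfolding split by (simp add: scaleR_right_distrib)
  also have "norm \<dots> \<le> ?a * e + 1 / real n * e"
    using Suc cell by (intro order_trans[OF norm_triangle_ineq] add_mono) auto
  also have "\<dots> = ?b * e" by (simp add: add_divide_distrib distrib_right)
  finally show ?case .
qed

text \<open>Joint uniform continuity on the compact product gives one mesh for all parameters.
  Uniformity matters for the Gram form, which has to be bounded below on a whole sphere of
  directions at once.\<close>

lemma riemann_sums_uniform:
  fixes \<phi> :: "'b::metric_space \<Rightarrow> real \<Rightarrow> 'c::euclidean_space"
  assumes "compact K" "continuous_on (K \<times> {0..1}) (\<lambda>x. \<phi> (fst x) (snd x))"
  shows "uniform_limit K (\<lambda>n b. (1 / real n) *\<^sub>R (\<Sum>i = 1..n. \<phi> b (real i / real n)))
    (\<lambda>b. int01 (\<phi> b)) sequentially"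
proof (rule uniform_limitI)
  fix e :: real assume e: "0 < e"
  have "uniformly_continuous_on (K \<times> {0..1}) (\<lambda>x. \<phi> (fst x) (snd x))"
    using assms by (intro compact_uniformly_continuous compact_Times compact_Icc) auto
  then obtain d where d: "0 < d" "\<And>x y. x \<in> K \<times> {0..1} \<Longrightarrow> y \<in> K \<times> {0..1} \<Longrightarrow> dist y x < d \<Longrightarrow>
      dist (\<phi> (fst y) (snd y)) (\<phi> (fst x) (snd x)) < e / 2"
    unfolding uniformly_continuous_on_def using e by (meson half_gt_zero)
  have "eventually (\<lambda>n. 1 / real n < d) sequentially"
    using d(1) by real_asymp
  then show "eventually (\<lambda>n. \<forall>b\<in>K. dist ((1 / real n) *\<^sub>R (\<Sum>i = 1..n. \<phi> b (real i / real n))) (int01 (\<phi> b)) < e) sequentially"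
    using eventually_gt_at_top[of 0]
  proof eventually_elim
    case (elim n)
    show ?case
    proof
      fix b assume b: "b \<in> K"
      have "continuous_on {0..1} (\<phi> b)"
        using continuous_on_compose2[OF assms(2), of "{0..1}" "\<lambda>t. (b, t)"] b
        by (force intro: continuous_intros)
      then have "norm ((1 / real n) *\<^sub>R (\<Sum>i = 1..n. \<phi> b (real i / real n)) - integral {0..real n / real n} (\<phi> b))
          \<le> real n / real n * (e / 2)"
      proof (rule riemann_cell_bound)
        fix s t :: real assume "s \<in> {0..1}" "t \<in> {0..1}" "\<bar>s - t\<bar> \<le> 1 / real n"
        then show "norm (\<phi> b s - \<phi> b t) \<le> e / 2"
          using d(2)[of "(b, t)" "(b, s)"] b elim by (simp add: dist_Pair_Pair dist_norm)
      qed (use elim in auto)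
      then show "dist ((1 / real n) *\<^sub>R (\<Sum>i = 1..n. \<phi> b (real i / real n))) (int01 (\<phi> b)) < e"
        using e elim by (simp add: dist_norm)
    qed
  qed
qed

lemma riemann_sums:
  fixes \<phi> :: "real \<Rightarrow> 'c::euclidean_space"
  assumes "continuous_on {0..1} \<phi>"
  shows "(\<lambda>n. (1 / real n) *\<^sub>R (\<Sum>i = 1..n. \<phi> (real i / real n))) \<longlonglongrightarrow> int01 \<phi>"
proof -
  \<comment> \<open>A one-point parameter set reduces the plain case to the uniform one.\<close>
  have "continuous_on ({0::real} \<times> {0..1}) (\<lambda>x. \<phi> (snd x))"
    by (rule continuous_on_compose2[OF assms]) (auto intro: continuous_intros)
  from riemann_sums_uniform[of "{0::real}" "\<lambda>_. \<phi>", OF _ this] show ?thesis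
    by (auto intro: tendsto_uniform_limitI)
qed

lemma riemann_sums_real:
  fixes \<phi> :: "real \<Rightarrow> real"
  assumes "continuous_on {0..1} \<phi>"
  shows "(\<lambda>n. (\<Sum>i = 1..n. \<phi> (real i / real n)) / real n) \<longlonglongrightarrow> int01 \<phi>"
  using riemann_sums[OF assms] by simp

text \<open>Concavity of \<open>ln\<close>, used as ln u - ln S \<le> u / S - 1 with u = n q_i x_i
  and summed over i. Any positive test values \<open>x\<close> thus bound the likelihood of
  \<open>q\<close> from above; the tests used are \<open>1 + g t / \<tau>\<close> and
  \<open>1 + a \<bullet> \<psi> n t\<close> on the grid.\<close>

lemma jensen_ln:
  fixes q x :: "nat \<Rightarrow> real"
  assumes n: "0 < n" and q: "\<And>i. i \<in> {1..n} \<Longrightarrow> 0 < q i" and x: "\<And>i. i \<in> {1..n} \<Longrightarrow> 0 < x i"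
  shows "(\<Sum>i = 1..n. ln (real n * q i)) / real n + (\<Sum>i = 1..n. ln (x i)) / real n \<le> ln (\<Sum>i = 1..n. q i * x i)"
proof -
  define S where "S = (\<Sum>i = 1..n. q i * x i)"
  have S: "0 < S" unfolding S_def using n q x by (intro sum_pos) auto
  have "(\<Sum>i = 1..n. ln (real n * q i) + ln (x i) - ln S) \<le> (\<Sum>i = 1..n. real n * (q i * x i) / S - 1)"
  proof (rule sum_mono)
    fix i assume i: "i \<in> {1..n}"
    have "ln (real n * q i) + ln (x i) - ln S = ln (real n * (q i * x i)) - ln S"
      using q[OF i] x[OF i] n by (simp add: ln_mult)
    also have "\<dots> \<le> (real n * (q i * x i) - S) / S"
      using S q[OF i] x[OF i] n by (intro ln_diff_le) auto
    finally show "ln (real n * q i) + ln (x i) - ln S \<le> real n * (q i * x i) / S - 1"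
      using S by (simp add: diff_divide_distrib)
  qed
  also have "\<dots> = real n * S / S - real n"
    by (simp only: sum_subtractf S_def sum_distrib_left sum_divide_distrib) simp
  also have "\<dots> = 0" using S by simp
  finally have "(\<Sum>i = 1..n. ln (real n * q i)) + (\<Sum>i = 1..n. ln (x i)) \<le> real n * ln S"
    by (simp add: sum_subtractf sum.distrib)
  then show ?thesis using n unfolding S_def[symmetric] by (simp add: field_simps)
qed

text \<open>Otherwise \<open>b \<mapsto> - \<rho> \<Psi> b / |\<Psi> b|\<close> would map the ball to itself, and a fixed point would
  lie on the sphere and violate the sign condition.\<close>

lemma zero_of_outward_field:
  fixes \<Psi> :: "'a::euclidean_space \<Rightarrow> 'a"
  assumes \<rho>: "0 < \<rho>" and cont: "continuous_on (cball 0 \<rho>) \<Psi>"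
    and out: "\<And>b. norm b = \<rho> \<Longrightarrow> 0 < b \<bullet> \<Psi> b"
  obtains b where "norm b \<le> \<rho>" "\<Psi> b = 0"
proof (rule ccontr)
  assume "\<not> thesis"
  with that have nz': "\<forall>b\<in>cball 0 \<rho>. \<Psi> b \<noteq> 0" by auto
  then have nz: "\<Psi> b \<noteq> 0" if "b \<in> cball 0 \<rho>" for b using that by blast
  define F where "F b = (- \<rho> / norm (\<Psi> b)) *\<^sub>R \<Psi> b" for b
  have normF: "norm (F b) = \<rho>" if "b \<in> cball 0 \<rho>" for b
    using nz[OF that] \<rho> by (simp add: F_def)
  have "continuous_on (cball 0 \<rho>) F" unfolding F_def using nz by (intro continuous_intros cont) auto
  moreover have "F ` cball 0 \<rho> \<subseteq> cball 0 \<rho>" using normF by auto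
  ultimately obtain b where b: "b \<in> cball 0 \<rho>" "F b = b"
    using brouwer[of "cball 0 \<rho>" F] \<rho> by (auto simp: image_subset_iff_funcset)
  then have "norm b = \<rho>" using normF by metis
  then have "0 < F b \<bullet> \<Psi> b" using out b by simp
  also have "F b \<bullet> \<Psi> b = - \<rho> * norm (\<Psi> b)"
    using nz[OF b(1)] by (simp add: F_def dot_square_norm power2_eq_square)
  finally show False using \<rho> by (simp add: mult_less_0_iff zero_less_mult_iff)
qed

text \<open>The likelihood as a functional of a path, so that a continuous mapping argument applies.
  With \<open>z\<close> the centred partial sums divided by \<open>sqrt n\<close>, the bracket is
  the sum recentred at \<open>\<mu>\<close>; only the grid values of \<open>z\<close> enter.\<close>

definition rescaled_EL ::
  "(real \<Rightarrow> real) \<Rightarrow> ('a::euclidean_space \<Rightarrow> 'b::euclidean_space) \<Rightarrow> 'a \<Rightarrow> nat \<Rightarrow> (real \<Rightarrow> 'a) \<Rightarrow> real" where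
  "rescaled_EL w H \<mu>0 n z = real n ^ n *
     Sup (insert 0 {(\<Prod>i = 1..n. q i) | q \<mu>.
       (\<forall>i\<in>{1..n}. 0 \<le> q i) \<and> (\<Sum>i = 1..n. q i) = 1 \<and>
       (\<Sum>i = 1..n. q i *\<^sub>R w (real i / real n) *\<^sub>R
          (sqrt (real n) *\<^sub>R z (real i / real n) - real i *\<^sub>R (\<mu> - \<mu>0))) = 0 \<and> H \<mu> = H \<mu>0})"

text \<open>Dividing the constraint by \<open>sqrt n\<close> separates noise from drift: whenever
  the weighted average of w(t) t is nonzero, \<open>h\<close> is the weighted path average divided
  by that number and by \<open>sqrt n\<close>.\<close>

lemma EL_constraint_iff:
  fixes z :: "nat \<Rightarrow> 'a::real_vector"
  assumes "0 < n"
  shows "(\<Sum>i = 1..n. q i *\<^sub>R v i *\<^sub>R (sqrt (real n) *\<^sub>R z i - real i *\<^sub>R h)) = 0 \<longleftrightarrow>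
    (\<Sum>i = 1..n. (q i * v i) *\<^sub>R z i) = (sqrt (real n) * (\<Sum>i = 1..n. q i * (v i * (real i / real n)))) *\<^sub>R h"
proof -
  let ?r = "sqrt (real n)"
  have r: "0 < ?r" "?r * ?r = real n" using assms by auto
  have "(\<Sum>i = 1..n. q i *\<^sub>R v i *\<^sub>R (?r *\<^sub>R z i - real i *\<^sub>R h))
    = (\<Sum>i = 1..n. ?r *\<^sub>R ((q i * v i) *\<^sub>R z i) - (q i * v i * real i) *\<^sub>R h)"
    by (intro sum.cong) (auto simp: algebra_simps)
  also have "\<dots> = ?r *\<^sub>R (\<Sum>i = 1..n. (q i * v i) *\<^sub>R z i) - (\<Sum>i = 1..n. q i * v i * real i) *\<^sub>R h"
    by (simp add: sum_subtractf scaleR_sum_right scaleR_sum_left)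
  also have "(\<Sum>i = 1..n. q i * v i * real i) = ?r * (?r * (\<Sum>i = 1..n. q i * (v i * (real i / real n))))"
    using assms r by (simp add: sum_distrib_left mult.assoc[symmetric])
  also have "?r *\<^sub>R (\<Sum>i = 1..n. (q i * v i) *\<^sub>R z i) - (?r * (?r * (\<Sum>i = 1..n. q i * (v i * (real i / real n))))) *\<^sub>R h
    = ?r *\<^sub>R ((\<Sum>i = 1..n. (q i * v i) *\<^sub>R z i) - (?r * (\<Sum>i = 1..n. q i * (v i * (real i / real n)))) *\<^sub>R h)"
    by (simp add: scaleR_right_diff_distrib)
  finally show ?thesis using r by simp
qed

section \<open>Likelihood bounds along a convergent sequence of paths\<close>

lemma grid_mem: "i \<in> {1..n} \<Longrightarrow> real i / real n \<in> {0..1}"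
  by (auto simp: divide_le_eq_1)

lemma average_le:
  fixes F :: "nat \<Rightarrow> real"
  assumes "0 < n" "\<And>i. i \<in> {1..n} \<Longrightarrow> F i \<le> C"
  shows "(\<Sum>i = 1..n. F i) / real n \<le> C"
  using sum_bounded_above[of "{1..n}" F C] assms by (simp add: field_simps)

text \<open>A deterministic setting: \<open>zn\<close> stands for the normalised partial sums and
  \<open>z\<close> for the limiting path. The derivative at the single point \<open>\<mu>0\<close>
  provides the linearisation; continuity on \<open>U\<close> is what Brouwer's theorem will
  use.\<close>

locale EL_setting =
  fixes w :: "real \<Rightarrow> real" and c :: real and H :: "'a::euclidean_space \<Rightarrow> 'b::euclidean_space"
    and \<mu>0 :: 'a and D :: "'a \<Rightarrow> 'b" and U :: "'a set" and z :: "real \<Rightarrow> 'a" and zn :: "nat \<Rightarrow> real \<Rightarrow> 'a"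
  assumes w_cont: "continuous_on {0..1} w"
    and w_nonneg: "\<And>t. t \<in> {0..1} \<Longrightarrow> 0 \<le> w t"
    and c: "0 < c" "c \<le> 1"
    and w_pos: "\<And>t. t \<in> {0<..<c} \<Longrightarrow> 0 < w t"
    and H_deriv: "(H has_derivative D) (at \<mu>0)"
    and U: "open U" "\<mu>0 \<in> U" "continuous_on U H"
    and z_cont: "continuous_on {0..1} z"
    and z_lim: "uniform_limit {0..1} zn z sequentially"
begin

definition f :: "real \<Rightarrow> 'b" where "f t = w t *\<^sub>R D (z t)"
definition \<psi> :: "nat \<Rightarrow> real \<Rightarrow> 'b" where "\<psi> n t = w t *\<^sub>R D (zn n t)"
text \<open>The drift coefficient: up to the factor \<open>sqrt n\<close>, its average under the
  weights multiplies \<open>\<mu> - \<mu>0\<close> in the constraint.\<close>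

definition g :: "real \<Rightarrow> real" where "g t = w t * t"

lemma D_linear: "bounded_linear D" using H_deriv by (rule has_derivative_bounded_linear)

lemma f_cont: "continuous_on {0..1} f"
  unfolding f_def by (intro continuous_intros w_cont z_cont bounded_linear.continuous_on[OF D_linear])

lemma g_cont: "continuous_on {0..1} g" unfolding g_def by (intro continuous_intros w_cont)

lemma g_nonneg: "t \<in> {0..1} \<Longrightarrow> 0 \<le> g t" using w_nonneg by (auto simp: g_def)

lemma \<psi>_conv:
  assumes e: "0 < e"
  shows "eventually (\<lambda>n. \<forall>t\<in>{0..1}. norm (\<psi> n t - f t) < e) sequentially"
proof -
  obtain W where W: "0 < W" "\<And>t. t \<in> {0..1} \<Longrightarrow> w t \<le> W" using continuous_on_Icc_bounded[OF w_cont] by blast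
  obtain K where K: "0 < K" "\<And>x. norm (D x) \<le> norm x * K"
    using bounded_linear.pos_bounded[OF D_linear] by blast
  have "eventually (\<lambda>n. \<forall>t\<in>{0..1}. dist (zn n t) (z t) < e / (W * K)) sequentially"
    using W K e by (intro uniform_limitD[OF z_lim]) auto
  then show ?thesis
  proof eventually_elim
    case (elim n)
    show ?case
    proof
      fix t :: real assume t: "t \<in> {0..1}"
      have "\<psi> n t - f t = w t *\<^sub>R D (zn n t - z t)"
        by (simp add: \<psi>_def f_def linear_diff[OF bounded_linear.linear[OF D_linear]] scaleR_right_diff_distrib)
      then have "norm (\<psi> n t - f t) = w t * norm (D (zn n t - z t))" using w_nonneg[OF t] by simp
      also have "\<dots> \<le> W * (norm (zn n t - z t) * K)"
        using W w_nonneg t K by (intro mult_mono) auto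
      also have "\<dots> < e" using elim t W K by (auto simp: dist_norm field_simps)
      finally show "norm (\<psi> n t - f t) < e" .
    qed
  qed
qed

lemma weighted_path_bound:
  obtains B where "0 < B" "eventually (\<lambda>n. \<forall>t\<in>{0..1}. norm (w t *\<^sub>R zn n t) \<le> B) sequentially"
proof -
  obtain W where W: "0 < W" "\<And>t. t \<in> {0..1} \<Longrightarrow> w t \<le> W" using continuous_on_Icc_bounded[OF w_cont] by blast
  have "bounded (z ` {0..1})" by (intro compact_imp_bounded compact_continuous_image z_cont compact_Icc)
  then obtain Z where Z: "0 < Z" "\<forall>t\<in>{0..1}. norm (z t) \<le> Z" by (auto simp: bounded_pos)
  have "eventually (\<lambda>n. \<forall>t\<in>{0..1}. dist (zn n t) (z t) < 1) sequentially"
    by (intro uniform_limitD[OF z_lim]) auto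
  then have "eventually (\<lambda>n. \<forall>t\<in>{0..1}. norm (w t *\<^sub>R zn n t) \<le> W * (Z + 1)) sequentially"
  proof eventually_elim
    case (elim n)
    show ?case
    proof
      fix t :: real assume t: "t \<in> {0..1}"
      have "norm (zn n t) \<le> Z + 1"
        using elim Z(2) t norm_triangle_sub[of "zn n t" "z t"] by (fastforce simp: dist_norm)
      then have "\<bar>w t\<bar> * norm (zn n t) \<le> W * (Z + 1)"
        using W t w_nonneg[OF t] by (intro mult_mono) auto
      then show "norm (w t *\<^sub>R zn n t) \<le> W * (Z + 1)" by simp
    qed
  qed
  moreover have "0 < W * (Z + 1)" using W Z by simp
  ultimately show thesis using that by blast
qed

lemma derivative_bound:
  assumes "0 < \<delta>"
  obtains \<eta> where "0 < \<eta>"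
    "\<And>h. norm h < \<eta> \<Longrightarrow> \<mu>0 + h \<in> U \<and> norm (H (\<mu>0 + h) - H \<mu>0 - D h) \<le> \<delta> * norm h"
proof -
  obtain \<eta>1 where 1: "0 < \<eta>1" "\<And>y. norm (y - \<mu>0) < \<eta>1 \<Longrightarrow> norm (H y - H \<mu>0 - D (y - \<mu>0)) \<le> \<delta> * norm (y - \<mu>0)"
    using H_deriv assms unfolding has_derivative_at_alt by blast
  obtain \<eta>2 where 2: "0 < \<eta>2" "ball \<mu>0 \<eta>2 \<subseteq> U" using U open_contains_ball by blast
  show thesis
  proof (rule that[of "min \<eta>1 \<eta>2"])
    show "0 < min \<eta>1 \<eta>2" using 1 2 by simp
    fix h :: 'a assume "norm h < min \<eta>1 \<eta>2"
    then show "\<mu>0 + h \<in> U \<and> norm (H (\<mu>0 + h) - H \<mu>0 - D h) \<le> \<delta> * norm h"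
      using 1(2)[of "\<mu>0 + h"] 2(2) by (auto simp: dist_norm subset_iff)
  qed
qed

lemma D_weighted_sum:
  "D (\<Sum>i = 1..n. (q i * w (real i / real n)) *\<^sub>R zn n (real i / real n)) = (\<Sum>i = 1..n. q i *\<^sub>R \<psi> n (real i / real n))"
  by (simp add: \<psi>_def linear_sum[OF bounded_linear.linear[OF D_linear]]
      linear_scale[OF bounded_linear.linear[OF D_linear]])

text \<open>On the middle third of (0, c), away from the zeros that \<open>g\<close> may have at the
  ends, \<open>g\<close> is bounded below, so the integral diverges as \<open>\<tau>\<close> tends
  to 0. The test \<open>1 + g t / \<tau>\<close> in Jensen's inequality then penalises weights with
  a small average of \<open>g\<close>.\<close>

lemma integral_ln_g_large:
  obtains \<tau> where "0 < \<tau>" "C < int01 (\<lambda>t. ln (1 + g t / \<tau>))"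
proof -
  have sub: "{c / 3..2 * c / 3} \<subseteq> {0..1}" using c by auto
  have "continuous_on {c / 3..2 * c / 3} g" using sub by (rule continuous_on_subset[OF g_cont])
  then obtain t0 where t0: "t0 \<in> {c / 3..2 * c / 3}" "\<And>t. t \<in> {c / 3..2 * c / 3} \<Longrightarrow> g t0 \<le> g t"
    using continuous_attains_inf[of "{c / 3..2 * c / 3}" g] c by auto
  define \<gamma> where "\<gamma> = g t0"
  have \<gamma>: "0 < \<gamma>" using t0(1) c w_pos[of t0] by (auto simp: \<gamma>_def g_def intro!: mult_pos_pos)
  \<comment> \<open>Chosen so that \<open>K\<close> times the length \<open>c / 3\<close> of the
    interval is \<open>\<bar>C\<bar> + 1\<close>; with \<open>\<tau> = \<gamma> / exp K\<close> the
    integrand is at least \<open>K\<close> there.\<close>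
  define K where "K = 3 * (\<bar>C\<bar> + 1) / c"
  define \<tau> where "\<tau> = \<gamma> / exp K"
  have \<tau>: "0 < \<tau>" using \<gamma> by (simp add: \<tau>_def)
  have ge1: "1 \<le> 1 + g t / \<tau>" if "t \<in> {0..1}" for t using g_nonneg[OF that] \<tau> by simp
  have cont: "continuous_on {0..1} (\<lambda>t. ln (1 + g t / \<tau>))"
    using ge1 \<tau> by (intro continuous_intros g_cont) (auto, smt (verit) atLeastAtMost_iff)
  have "K * (c / 3) = integral {c / 3..2 * c / 3} (\<lambda>t. K)" using c by simp
  also have "\<dots> \<le> integral {c / 3..2 * c / 3} (\<lambda>t. ln (1 + g t / \<tau>))"
  proof (intro integral_le)
    fix t assume t: "t \<in> {c / 3..2 * c / 3}"
    have "exp K = \<gamma> / \<tau>" using \<gamma> by (simp add: \<tau>_def)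
    also have "\<dots> \<le> g t / \<tau>" using t0(2)[OF t] \<tau> by (intro divide_right_mono) (auto simp: \<gamma>_def)
    also have "\<dots> \<le> 1 + g t / \<tau>" by simp
    finally have "ln (exp K) \<le> ln (1 + g t / \<tau>)" by (intro ln_mono) auto
    then show "K \<le> ln (1 + g t / \<tau>)" by simp
  qed (use sub cont in \<open>auto intro!: integrable_continuous_interval continuous_on_subset[OF cont]\<close>)
  also have "\<dots> \<le> int01 (\<lambda>t. ln (1 + g t / \<tau>))"
    using ge1 sub cont
    by (intro integral_subset_le integrable_continuous_interval continuous_on_subset[OF cont]) auto
  also have "K * (c / 3) = \<bar>C\<bar> + 1" using c by (simp add: K_def)
  finally show thesis using that[OF \<tau>] by linarith
qed

text \<open>Jensen's inequality is used twice. The test \<open>1 + g t / \<tau>\<close> shows that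
  weights beating \<open>- \<bar>L\<bar>\<close> have \<open>s\<close> at least
  \<open>\<tau>\<close>, hence \<open>h\<close> of order n^(-1/2). The test
  \<open>1 + a \<bullet> \<psi> n t\<close> leaves the error \<open>a \<bullet> D m\<close>, which
  is small because \<open>D h\<close> is only a linearisation error.\<close>

lemma likelihood_le:
  assumes adm: "\<And>t. t \<in> {0..1} \<Longrightarrow> 0 < 1 + a \<bullet> f t" and e: "0 < e"
  shows "eventually (\<lambda>n. \<forall>q h. (\<forall>i\<in>{1..n}. 0 < q i) \<longrightarrow> (\<Sum>i = 1..n. q i) = 1 \<longrightarrow>
    (\<Sum>i = 1..n. q i *\<^sub>R w (real i / real n) *\<^sub>R
      (sqrt (real n) *\<^sub>R zn n (real i / real n) - real i *\<^sub>R h)) = 0 \<longrightarrow> H (\<mu>0 + h) = H \<mu>0 \<longrightarrow>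
    (\<Sum>i = 1..n. ln (real n * q i)) / real n \<le> - int01 (\<lambda>t. ln (1 + a \<bullet> f t)) + e) sequentially"
proof -
  define L where "L = int01 (\<lambda>t. ln (1 + a \<bullet> f t))"
  have c1: "continuous_on {0..1} (\<lambda>t. 1 + a \<bullet> f t)" by (intro continuous_intros f_cont)
  have nz: "\<And>t. t \<in> {0..1} \<Longrightarrow> 1 + a \<bullet> f t \<noteq> 0" using adm by (metis less_irrefl)
  have cln: "continuous_on {0..1} (\<lambda>t. ln (1 + a \<bullet> f t))" using nz by (intro continuous_intros c1) auto
  obtain \<tau> where \<tau>: "0 < \<tau>" "\<bar>L\<bar> + 1 < int01 (\<lambda>t. ln (1 + g t / \<tau>))" using integral_ln_g_large by blast
  have ge1: "1 \<le> 1 + g t / \<tau>" if "t \<in> {0..1}" for t using g_nonneg[OF that] \<tau> by simp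
  have cg: "continuous_on {0..1} (\<lambda>t. ln (1 + g t / \<tau>))"
    using ge1 \<tau> by (intro continuous_intros g_cont) (auto, smt (verit) atLeastAtMost_iff)
  obtain t1 where t1: "t1 \<in> {0..1}" "\<And>t. t \<in> {0..1} \<Longrightarrow> 1 + a \<bullet> f t1 \<le> 1 + a \<bullet> f t"
    using continuous_attains_inf[OF compact_Icc _ c1] by auto
  define \<kappa> where "\<kappa> = 1 + a \<bullet> f t1"
  have \<kappa>: "0 < \<kappa>" "\<And>t. t \<in> {0..1} \<Longrightarrow> \<kappa> \<le> 1 + a \<bullet> f t"
    using adm t1 unfolding \<kappa>_def by blast+
  obtain B where B: "0 < B" "eventually (\<lambda>n. \<forall>t\<in>{0..1}. norm (w t *\<^sub>R zn n t) \<le> B) sequentially"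
    using weighted_path_bound by blast
  \<comment> \<open>Makes the final error \<open>norm a * (\<delta> * B)\<close> at most
    \<open>e / 4\<close>; the summand 1 in the denominator covers \<open>a = 0\<close>.\<close>
  define \<delta> where "\<delta> = e / (4 * (norm a * B + 1))"
  have pos1: "0 < norm a * B + 1" using B by (intro add_nonneg_pos) auto
  have \<delta>: "0 < \<delta>" "norm a * (\<delta> * B) \<le> e / 4"
  proof -
    show "0 < \<delta>" using e pos1 by (simp add: \<delta>_def)
    have "norm a * (\<delta> * B) = (norm a * B) / (norm a * B + 1) * (e / 4)" by (simp add: \<delta>_def algebra_simps)
    also have "\<dots> \<le> 1 * (e / 4)" using pos1 e by (intro mult_right_mono) auto
    finally show "norm a * (\<delta> * B) \<le> e / 4" by simp
  qed
  obtain \<eta> where \<eta>: "0 < \<eta>"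
    "\<And>h. norm h < \<eta> \<Longrightarrow> \<mu>0 + h \<in> U \<and> norm (H (\<mu>0 + h) - H \<mu>0 - D h) \<le> \<delta> * norm h"
    using derivative_bound[OF \<delta>(1)] by blast
  \<comment> \<open>The first term of the minimum keeps \<open>1 + a \<bullet> \<psi> n t\<close>
    above \<open>\<kappa> / 2\<close>; the second then limits the change of its logarithm to
    \<open>e / 4\<close>.\<close>
  define e' where "e' = min (\<kappa> / 2) (\<kappa> * e / 8) / (norm a + 1)"
  have na: "0 < norm a + 1" by (simp add: add_nonneg_pos)
  have e': "0 < e'" "norm a * e' \<le> \<kappa> / 2" "norm a * e' \<le> \<kappa> * e / 8"
  proof -
    show "0 < e'" using \<kappa> e na by (simp add: e'_def)
    have "norm a * e' \<le> (norm a + 1) * e'" using \<open>0 < e'\<close> by simp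
    also have "\<dots> = min (\<kappa> / 2) (\<kappa> * e / 8)" using na by (simp add: e'_def)
    finally show "norm a * e' \<le> \<kappa> / 2" "norm a * e' \<le> \<kappa> * e / 8" by simp_all
  qed
  have ev1: "eventually (\<lambda>n. \<bar>L\<bar> + 1 < (\<Sum>i = 1..n. ln (1 + g (real i / real n) / \<tau>)) / real n) sequentially"
    by (rule order_tendstoD(1)[OF riemann_sums_real[OF cg] \<tau>(2)])
  have ev2: "eventually (\<lambda>n. L - e / 4 < (\<Sum>i = 1..n. ln (1 + a \<bullet> f (real i / real n))) / real n) sequentially"
    by (rule order_tendstoD(1)[OF riemann_sums_real[OF cln]]) (use e in \<open>simp add: L_def\<close>)
  have ev5: "eventually (\<lambda>n. B / (sqrt (real n) * \<tau>) < \<eta>) sequentially"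
    using \<eta>(1) B(1) \<tau>(1) by real_asymp
  from ev1 ev2 \<psi>_conv[OF e'(1)] B(2) ev5 eventually_gt_at_top[of 0]
  show ?thesis unfolding L_def[symmetric]
  proof eventually_elim
    case (elim n)
    have n: "0 < n" by (fact elim)
    show ?case
    proof (intro allI impI)
      fix q :: "nat \<Rightarrow> real" and h
      assume q: "\<forall>i\<in>{1..n}. 0 < q i" "(\<Sum>i = 1..n. q i) = 1"
        and con: "(\<Sum>i = 1..n. q i *\<^sub>R w (real i / real n) *\<^sub>R
          (sqrt (real n) *\<^sub>R zn n (real i / real n) - real i *\<^sub>R h)) = 0"
        and Hh: "H (\<mu>0 + h) = H \<mu>0"
      define P where "P = (\<Sum>i = 1..n. ln (real n * q i)) / real n"
      \<comment> \<open>Weights with \<open>P \<le> - \<bar>L\<bar>\<close> satisfy the claim at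
        once, since \<open>- \<bar>L\<bar> \<le> - L\<close>; the others have enough mass where
        \<open>g\<close> is positive.\<close>
      show "(\<Sum>i = 1..n. ln (real n * q i)) / real n \<le> - L + e"
      proof (cases "P \<le> - \<bar>L\<bar>")
        case True
        then show ?thesis using e unfolding P_def by linarith
      next
        case False
        define m where "m = (\<Sum>i = 1..n. (q i * w (real i / real n)) *\<^sub>R zn n (real i / real n))"
        define s where "s = (\<Sum>i = 1..n. q i * (w (real i / real n) * (real i / real n)))"
        define r where "r = sqrt (real n)"
        have r: "0 < r" using n by (simp add: r_def)
        have mh: "m = (r * s) *\<^sub>R h"
          using con unfolding EL_constraint_iff[OF n] by (simp add: m_def s_def r_def)
        have "(\<Sum>i = 1..n. q i * (1 + g (real i / real n) / \<tau>)) = (\<Sum>i = 1..n. q i) + s / \<tau>"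
          by (simp add: distrib_left sum.distrib s_def g_def sum_divide_distrib)
        then have sum_g: "(\<Sum>i = 1..n. q i * (1 + g (real i / real n) / \<tau>)) = 1 + s / \<tau>" using q by simp
        have "P + (\<Sum>i = 1..n. ln (1 + g (real i / real n) / \<tau>)) / real n \<le> ln (1 + s / \<tau>)"
          unfolding P_def sum_g[symmetric]
          by (rule jensen_ln) (use n q ge1[OF grid_mem] in \<open>auto intro: less_le_trans[OF zero_less_one]\<close>)
        then have "1 < ln (1 + s / \<tau>)" using False elim(1) by linarith
        moreover have s0: "0 \<le> s" unfolding s_def
          by (rule sum_nonneg, rule mult_nonneg_nonneg)
            (use q g_nonneg[OF grid_mem] in \<open>auto simp: g_def less_imp_le\<close>)
        then have "ln (1 + s / \<tau>) \<le> s / \<tau>" using \<tau> by (intro ln_add_one_self_le_self) auto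
        ultimately have "1 < s / \<tau>" by linarith
        then have s\<tau>: "\<tau> \<le> s" using \<tau> by (simp add: pos_less_divide_eq)
        have s: "0 < s" using s\<tau> \<tau> by linarith
        have "norm m \<le> (\<Sum>i = 1..n. q i * B)"
          unfolding m_def
        proof (intro sum_norm_le)
          fix i assume i: "i \<in> {1..n}"
          have qi: "0 < q i" using q(1) i by blast
          have "norm ((q i * w (real i / real n)) *\<^sub>R zn n (real i / real n))
            = q i * norm (w (real i / real n) *\<^sub>R zn n (real i / real n))"
            using qi by (simp add: abs_mult)
          also have "\<dots> \<le> q i * B" using qi elim(4) grid_mem[OF i] by (intro mult_left_mono) (auto intro: less_imp_le)
          finally show "norm ((q i * w (real i / real n)) *\<^sub>R zn n (real i / real n)) \<le> q i * B" .
        qed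
        then have mB: "norm m \<le> B" using q(2) by (simp add: sum_distrib_right[symmetric])
        have nh: "norm m = r * s * norm h" using mh r s by simp
        then have "norm h = norm m / (r * s)" using r s by simp
        also have "\<dots> \<le> B / (r * \<tau>)" using mB s\<tau> r \<tau> B by (intro frac_le mult_left_mono) auto
        also have "\<dots> < \<eta>" using elim(5) by (simp add: r_def)
        \<comment> \<open>As \<open>H (\<mu>0 + h) = H \<mu>0\<close>, the linearisation error is
          \<open>D h\<close> itself. Multiplying by \<open>r * s\<close> turns \<open>h\<close> into
          \<open>m\<close>, and the factor \<open>sqrt n\<close> disappears from the
          estimate.\<close>
        finally have "norm (D h) \<le> \<delta> * norm h" using \<eta>(2)[of h] Hh by simp
        then have "(r * s) * norm (D h) \<le> (r * s) * (\<delta> * norm h)" using r s by (intro mult_left_mono) auto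
        then have "norm (D m) \<le> \<delta> * norm m"
          using r s unfolding nh by (simp add: mh linear_scale[OF bounded_linear.linear[OF D_linear]] mult_ac)
        also have "\<dots> \<le> \<delta> * B" using mB \<delta> by (intro mult_left_mono) auto
        finally have Dm: "norm (D m) \<le> \<delta> * B" .
        define x where "x i = 1 + a \<bullet> \<psi> n (real i / real n)" for i
        have x: "\<kappa> / 2 \<le> x i" "ln (1 + a \<bullet> f (real i / real n)) - e / 4 \<le> ln (x i)" if i: "i \<in> {1..n}" for i
        proof -
          let ?t = "real i / real n"
          have t: "?t \<in> {0..1}" by (rule grid_mem[OF i])
          have "\<bar>a \<bullet> (\<psi> n ?t - f ?t)\<bar> \<le> norm a * norm (\<psi> n ?t - f ?t)" by (rule Cauchy_Schwarz_ineq2)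
          also have "\<dots> \<le> norm a * e'" using elim(3) t by (intro mult_left_mono) (auto intro: less_imp_le)
          finally have d: "\<bar>a \<bullet> \<psi> n ?t - a \<bullet> f ?t\<bar> \<le> norm a * e'" by (simp add: inner_diff_right)
          show xi: "\<kappa> / 2 \<le> x i" using d e'(2) \<kappa>(2)[OF t] unfolding x_def by linarith
          have "ln (1 + a \<bullet> f ?t) - ln (x i) \<le> ((1 + a \<bullet> f ?t) - x i) / x i"
            using xi \<kappa>(1) adm[OF t] by (intro ln_diff_le) auto
          also have "\<dots> \<le> (\<kappa> * e / 8) / (\<kappa> / 2)"
            using d e'(3) xi \<kappa> e by (intro frac_le) (auto simp: x_def)
          also have "\<dots> = e / 4" using \<kappa> by simp
          finally show "ln (1 + a \<bullet> f ?t) - e / 4 \<le> ln (x i)" by simp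
        qed
        have x0: "0 < x i" if "i \<in> {1..n}" for i using x(1)[OF that] \<kappa>(1) by linarith
        have "(\<Sum>i = 1..n. q i * x i) = (\<Sum>i = 1..n. q i) + a \<bullet> (\<Sum>i = 1..n. q i *\<^sub>R \<psi> n (real i / real n))"
          by (simp add: x_def distrib_left sum.distrib inner_sum_right)
        then have sum_x: "(\<Sum>i = 1..n. q i * x i) = 1 + a \<bullet> D m"
          using q unfolding m_def D_weighted_sum by simp
        have "P + (\<Sum>i = 1..n. ln (x i)) / real n \<le> ln (\<Sum>i = 1..n. q i * x i)"
          unfolding P_def by (rule jensen_ln) (use n q x0 in auto)
        also have "\<dots> \<le> (\<Sum>i = 1..n. q i * x i) - 1"
          using n q x0 by (intro ln_le_minus_one sum_pos) auto
        also have "\<dots> = a \<bullet> D m" unfolding sum_x by simp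
        also have "\<dots> \<le> norm a * norm (D m)" by (rule norm_cauchy_schwarz)
        also have "\<dots> \<le> norm a * (\<delta> * B)" using Dm by (intro mult_left_mono) auto
        finally have 1: "P + (\<Sum>i = 1..n. ln (x i)) / real n \<le> e / 4" using \<delta>(2) by linarith
        have "(\<Sum>i = 1..n. ln (1 + a \<bullet> f (real i / real n)) - ln (x i)) / real n \<le> e / 4"
        proof (rule average_le[OF n])
          show "ln (1 + a \<bullet> f (real i / real n)) - ln (x i) \<le> e / 4" if "i \<in> {1..n}" for i
            using x(2)[OF that] by linarith
        qed
        then have "(\<Sum>i = 1..n. ln (1 + a \<bullet> f (real i / real n))) / real n - (\<Sum>i = 1..n. ln (x i)) / real n \<le> e / 4"
          by (simp add: sum_subtractf diff_divide_distrib)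
        then show ?thesis using 1 elim(2) e unfolding P_def by linarith
      qed
    qed
  qed
qed

end


section \<open>Feasible weights near an optimal density\<close>

context two_sided_path
begin

text \<open>This quadratic form is definite because no nonzero functional vanishes along the whole
  path. It is the inner product of \<open>b\<close> with the change of the moment of
  \<open>f\<close> when a density is tilted by \<open>b \<bullet> f\<close>.\<close>

lemma gram_lower_bound:
  assumes "0 < \<rho>"
  obtains \<kappa> where "0 < \<kappa>" "\<And>b. norm b = \<rho> \<Longrightarrow> \<kappa> \<le> int01 (\<lambda>t. (b \<bullet> f t)\<^sup>2)"
proof -
  define G where "G b = int01 (\<lambda>t. (b \<bullet> f t)\<^sup>2)" for b
  have cont: "continuous_on UNIV G"
    unfolding G_def by (rule continuous_int01_param) (intro continuous_intros)
  obtain b :: 'a where "b \<in> Basis" using nonempty_Basis by blast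
  then have "\<rho> *\<^sub>R b \<in> sphere 0 \<rho>" using assms by simp
  then have "sphere (0::'a) \<rho> \<noteq> {}" by blast
  then obtain b0 where b0: "b0 \<in> sphere 0 \<rho>" "\<And>b. b \<in> sphere 0 \<rho> \<Longrightarrow> G b0 \<le> G b"
    using continuous_attains_inf[OF compact_sphere _ continuous_on_subset[OF cont subset_UNIV]] by blast
  have "b0 \<noteq> 0" using b0(1) assms by auto
  then obtain t where "t \<in> {0..1}" "b0 \<bullet> f t < 0" using two_sided by blast
  then have "0 < G b0" unfolding G_def by (intro int01_pos[of _ t] continuous_intros) auto
  then show thesis using that[of "G b0"] b0(2) unfolding G_def by auto
qed

end

context EL_setting
begin

text \<open>The weights are proportional to \<open>q + b \<bullet> f\<close> on the grid. The exact
  constraint on \<open>H\<close> is a system in \<open>b\<close> with as many equations as unknowns,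
  and on the sphere of radius \<open>\<rho>\<close> it points outward: \<open>q\<close> has moment
  0, the tilt contributes the Gram form, and the other errors are smaller. So a solution exists, and
  a small \<open>\<rho>\<close> keeps the loss of likelihood below \<open>e\<close>.\<close>

lemma likelihood_ge:
  assumes ts: "two_sided_path f"
    and q_cont: "continuous_on {0..1} q" and q_pos: "\<And>t. t \<in> {0..1} \<Longrightarrow> 0 < q t"
    and q_int: "int01 q = 1" and q_f: "int01 (\<lambda>t. q t *\<^sub>R f t) = 0" and e: "0 < e"
  shows "eventually (\<lambda>n. \<exists>p h. (\<forall>i\<in>{1..n}. 0 < p i) \<and> (\<Sum>i = 1..n. p i) = 1 \<and>
    (\<Sum>i = 1..n. p i *\<^sub>R w (real i / real n) *\<^sub>R
      (sqrt (real n) *\<^sub>R zn n (real i / real n) - real i *\<^sub>R h)) = 0 \<and> H (\<mu>0 + h) = H \<mu>0 \<and>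
    - ((\<Sum>i = 1..n. ln (real n * p i)) / real n) \<le> int01 (\<lambda>t. - ln (q t)) + e) sequentially"
proof -
  interpret P: two_sided_path f by fact
  obtain M where M: "0 < M" "\<And>t. t \<in> {0..1} \<Longrightarrow> norm (f t) \<le> M" using P.f_bound by blast
  obtain Q where Q: "0 < Q" "\<And>t. t \<in> {0..1} \<Longrightarrow> q t \<le> Q" using continuous_on_Icc_bounded[OF q_cont] by blast
  obtain t1 where t1: "t1 \<in> {0..1}" "\<And>t. t \<in> {0..1} \<Longrightarrow> q t1 \<le> q t"
    using continuous_attains_inf[OF compact_Icc _ q_cont] by auto
  define \<eta> where "\<eta> = q t1 / 2"
  have \<eta>: "0 < \<eta>" "\<And>t. t \<in> {0..1} \<Longrightarrow> 2 * \<eta> \<le> q t"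
    using t1 q_pos by (auto simp: \<eta>_def)
  \<comment> \<open>The three bounds serve the positivity of the tilted density, the change of its
    logarithm, and its total mass.\<close>
  define \<rho> where "\<rho> = min \<eta> (min (\<eta> * e / 4) (e / 4)) / M"
  have \<rho>: "0 < \<rho>" "\<rho> * M \<le> \<eta>" "\<rho> * M \<le> \<eta> * e / 4" "\<rho> * M \<le> e / 4"
    using M \<eta> e by (auto simp: \<rho>_def)
  define qb where "qb b t = q t + b \<bullet> f t" for b t
  have bf: "\<bar>b \<bullet> f t\<bar> \<le> \<rho> * M" if "norm b \<le> \<rho>" "t \<in> {0..1}" for b t
  proof -
    have "\<bar>b \<bullet> f t\<bar> \<le> norm b * norm (f t)" by (rule Cauchy_Schwarz_ineq2)
    also have "\<dots> \<le> \<rho> * M" using that M \<rho>(1) by (intro mult_mono) auto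
    finally show ?thesis .
  qed
  have qb: "\<eta> \<le> qb b t" "qb b t \<le> Q + \<rho> * M" "- ln (qb b t) \<le> - ln (q t) + e / 4"
    if "norm b \<le> \<rho>" "t \<in> {0..1}" for b t
  proof -
    note 1 = bf[OF that] \<eta>(2)[OF that(2)] Q(2)[OF that(2)]
    show 2: "\<eta> \<le> qb b t" unfolding qb_def using 1 \<rho>(2) by linarith
    show "qb b t \<le> Q + \<rho> * M" unfolding qb_def using 1 by linarith
    have "ln (q t) - ln (qb b t) \<le> (q t - qb b t) / qb b t"
      using 2 \<eta>(1) q_pos[OF that(2)] by (intro ln_diff_le) auto
    also have "\<dots> \<le> (\<eta> * e / 4) / \<eta>"
      using 1 2 \<eta>(1) \<rho>(3) e by (intro frac_le) (auto simp: qb_def)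
    also have "\<dots> = e / 4" using \<eta>(1) by simp
    finally show "- ln (qb b t) \<le> - ln (q t) + e / 4" by linarith
  qed
  obtain \<kappa> where \<kappa>: "0 < \<kappa>" "\<And>b. norm b = \<rho> \<Longrightarrow> \<kappa> \<le> int01 (\<lambda>t. (b \<bullet> f t)\<^sup>2)"
    using P.gram_lower_bound[OF \<rho>(1)] by blast
  obtain B where B: "0 < B" "eventually (\<lambda>n. \<forall>t\<in>{0..1}. norm (w t *\<^sub>R zn n t) \<le> B) sequentially"
    using weighted_path_bound by blast
  define B' where "B' = (Q + \<rho> * M) * B"
  have QM: "0 < Q + \<rho> * M" using Q \<rho> M by (intro add_pos_pos mult_pos_pos) auto
  have B': "0 < B'" unfolding B'_def using QM B by simp
  \<comment> \<open>Makes the nonlinear remainder \<open>\<rho> * \<delta> * B'\<close> equal to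
    \<open>\<kappa> / 4\<close>, half of the linear term \<open>\<kappa> / 2\<close> from
    \<open>D_m\<close>.\<close>
  define \<delta> where "\<delta> = \<kappa> / (4 * \<rho> * B')"
  have \<delta>: "0 < \<delta>" using \<kappa> \<rho> B' by (simp add: \<delta>_def)
  obtain \<eta>2 where \<eta>2: "0 < \<eta>2"
    "\<And>h. norm h < \<eta>2 \<Longrightarrow> \<mu>0 + h \<in> U \<and> norm (H (\<mu>0 + h) - H \<mu>0 - D h) \<le> \<delta> * norm h"
    using derivative_bound[OF \<delta>] by blast
  \<comment> \<open>Replacing \<open>f\<close> by \<open>\<psi> n\<close> on the sphere then costs
    at most \<open>\<kappa> / 8\<close>.\<close>
  define e2 where "e2 = \<kappa> / (8 * (Q + \<rho> * M) * \<rho>)"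
  have "X * (\<rho> * (\<kappa> / (8 * X * \<rho>))) = \<kappa> / 8" if "X \<noteq> 0" for X using that \<rho>(1) by (simp add: field_simps)
  then have e2: "0 < e2" "(Q + \<rho> * M) * (\<rho> * e2) = \<kappa> / 8"
    unfolding e2_def using \<kappa>(1) QM \<rho>(1) by (simp, metis less_irrefl)
  define \<sigma> where "\<sigma> = int01 g / 2"
  have "0 < int01 g"
    using c w_pos[of "c / 2"] by (intro int01_pos[of _ "c / 2"] g_cont g_nonneg) (auto simp: g_def)
  then have \<sigma>: "0 < \<sigma>" "\<sigma> < int01 g" by (auto simp: \<sigma>_def)
  have cq: "continuous_on {0..1} (\<lambda>t. - ln (q t))"
    using q_pos by (intro continuous_intros q_cont) (metis less_irrefl)
  have "uniform_limit (cball 0 \<rho>) (\<lambda>n b. (1 / real n) *\<^sub>R (\<Sum>i = 1..n. (b \<bullet> f (real i / real n))\<^sup>2))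
      (\<lambda>b. int01 (\<lambda>t. (b \<bullet> f t)\<^sup>2)) sequentially"
    by (rule riemann_sums_uniform) (auto intro!: continuous_intros P.f_cont_snd)
  then have ev_a: "eventually (\<lambda>n. \<forall>b\<in>cball 0 \<rho>. dist ((1 / real n) *\<^sub>R (\<Sum>i = 1..n. (b \<bullet> f (real i / real n))\<^sup>2))
      (int01 (\<lambda>t. (b \<bullet> f t)\<^sup>2)) < \<kappa> / 4) sequentially"
    by (rule uniform_limitD) (use \<kappa> in simp)
  have ev_b: "eventually (\<lambda>n. (\<Sum>i = 1..n. q (real i / real n)) / real n < 1 + e / 4) sequentially"
    by (rule order_tendstoD(2)[OF riemann_sums_real[OF q_cont]]) (use e q_int in simp)
  have ev_c: "eventually (\<lambda>n. (\<Sum>i = 1..n. - ln (q (real i / real n))) / real n < int01 (\<lambda>t. - ln (q t)) + e / 4) sequentially"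
    by (rule order_tendstoD(2)[OF riemann_sums_real[OF cq]]) (use e in simp)
  have "(\<lambda>n. (1 / real n) *\<^sub>R (\<Sum>i = 1..n. q (real i / real n) *\<^sub>R f (real i / real n))) \<longlonglongrightarrow> 0"
    using riemann_sums[of "\<lambda>t. q t *\<^sub>R f t"] q_f by (simp add: continuous_on_scaleR[OF q_cont f_cont])
  then have ev_d: "eventually (\<lambda>n. norm ((1 / real n) *\<^sub>R (\<Sum>i = 1..n. q (real i / real n) *\<^sub>R f (real i / real n))) < \<kappa> / (8 * \<rho>)) sequentially"
    using \<kappa> \<rho> by (intro order_tendstoD(2)[OF tendsto_norm_zero]) auto
  have ev_g: "eventually (\<lambda>n. \<sigma> < (\<Sum>i = 1..n. g (real i / real n)) / real n) sequentially"
    by (rule order_tendstoD(1)[OF riemann_sums_real[OF g_cont] \<sigma>(2)])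
  have ev_h: "eventually (\<lambda>n. B' / (sqrt (real n) * (\<eta> * \<sigma>)) < \<eta>2) sequentially"
    using \<eta>2(1) B' \<eta>(1) \<sigma>(1) by real_asymp
  from ev_a ev_b ev_c ev_d \<psi>_conv[OF e2(1)] B(2) ev_g ev_h eventually_gt_at_top[of 0]
  show ?thesis
  proof eventually_elim
    case (elim n)
    have n: "0 < n" by (fact elim)
    define x where "x i = real i / real n" for i
    have x: "x i \<in> {0..1}" if "i \<in> {1..n}" for i unfolding x_def by (rule grid_mem[OF that])
    define r where "r = sqrt (real n)"
    have r: "0 < r" using n by (simp add: r_def)
    define m where "m b = (1 / real n) *\<^sub>R (\<Sum>i = 1..n. (qb b (x i) * w (x i)) *\<^sub>R zn n (x i))" for b
    define s where "s b = (\<Sum>i = 1..n. qb b (x i) * g (x i)) / real n" for b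
    have s_ge: "\<eta> * \<sigma> \<le> s b" if b: "norm b \<le> \<rho>" for b
    proof -
      have "\<eta> * \<sigma> \<le> \<eta> * ((\<Sum>i = 1..n. g (x i)) / real n)"
        using elim(7) \<eta>(1) unfolding x_def by (intro mult_left_mono) auto
      also have "\<dots> = (\<Sum>i = 1..n. \<eta> * g (x i)) / real n" by (simp add: sum_distrib_left)
      also have "\<dots> \<le> s b" unfolding s_def
        using qb(1)[OF b x] g_nonneg[OF x] by (intro divide_right_mono sum_mono mult_right_mono) auto
      finally show ?thesis .
    qed
    have s_pos: "0 < s b" if "norm b \<le> \<rho>" for b
      using s_ge[OF that] mult_pos_pos[OF \<eta>(1) \<sigma>(1)] by linarith
    have m_le: "norm (m b) \<le> B'" if b: "norm b \<le> \<rho>" for b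
    proof -
      have "norm (\<Sum>i = 1..n. (qb b (x i) * w (x i)) *\<^sub>R zn n (x i)) \<le> (\<Sum>i = 1..n. B')"
      proof (rule sum_norm_le)
        fix i assume i: "i \<in> {1..n}"
        have q0: "0 \<le> qb b (x i)" using qb(1)[OF b x[OF i]] \<eta>(1) by linarith
        have "norm ((qb b (x i) * w (x i)) *\<^sub>R zn n (x i)) = qb b (x i) * norm (w (x i) *\<^sub>R zn n (x i))"
          using q0 by (simp add: abs_mult)
        also have "\<dots> \<le> (Q + \<rho> * M) * B"
          using q0 qb(2)[OF b x[OF i]] elim(6) x[OF i] QM by (intro mult_mono) auto
        finally show "norm ((qb b (x i) * w (x i)) *\<^sub>R zn n (x i)) \<le> B'" by (simp add: B'_def)
      qed
      then show ?thesis using n by (simp add: m_def field_simps)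
    qed
    \<comment> \<open>The displacement that solves the weighted constraint for given
      \<open>b\<close>, read off from \<open>EL_constraint_iff\<close>; normalising the weights
      cancels in the quotient of \<open>m b\<close> and \<open>s b\<close>.\<close>
    define h where "h b = (1 / (r * s b)) *\<^sub>R m b" for b
    have h_small: "norm (h b) < \<eta>2" if b: "norm b \<le> \<rho>" for b
    proof -
      have "norm (h b) = norm (m b) / (r * s b)" using r s_pos[OF b] by (simp add: h_def)
      also have "\<dots> \<le> B' / (r * (\<eta> * \<sigma>))"
        using m_le[OF b] s_ge[OF b] r \<eta>(1) \<sigma>(1) B' by (intro frac_le mult_left_mono) auto
      also have "\<dots> < \<eta>2" using elim(8) by (simp add: r_def)
      finally show ?thesis .
    qed
    \<comment> \<open>The Gram sum is at least 3/4 of \<open>\<kappa>\<close>; the moment of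
      \<open>q\<close> and the replacement of \<open>f\<close> by \<open>\<psi> n\<close> cost
      \<open>\<kappa> / 8\<close> each.\<close>
    have D_m: "b \<bullet> D (m b) \<ge> \<kappa> / 2" if b: "norm b = \<rho>" for b
    proof -
      have b': "norm b \<le> \<rho>" using b by simp
      have Dm: "D (m b) = (1 / real n) *\<^sub>R (\<Sum>i = 1..n. qb b (x i) *\<^sub>R \<psi> n (x i))"
        unfolding m_def x_def
        by (subst linear_scale[OF bounded_linear.linear[OF D_linear]]) (simp only: D_weighted_sum)
      have "\<kappa> * 3 / 4 \<le> (\<Sum>i = 1..n. (b \<bullet> f (x i))\<^sup>2) / real n"
      proof -
        have "\<bar>(\<Sum>i = 1..n. (b \<bullet> f (x i))\<^sup>2) / real n - int01 (\<lambda>t. (b \<bullet> f t)\<^sup>2)\<bar> < \<kappa> / 4"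
          using bspec[OF elim(1), of b] b' by (simp add: dist_real_def x_def)
        then show ?thesis using \<kappa>(2)[OF b] by linarith
      qed
      moreover have "- (\<kappa> / 8) \<le> (\<Sum>i = 1..n. q (x i) * (b \<bullet> f (x i))) / real n"
      proof -
        have eq: "(\<Sum>i = 1..n. q (x i) * (b \<bullet> f (x i))) / real n
            = b \<bullet> ((1 / real n) *\<^sub>R (\<Sum>i = 1..n. q (x i) *\<^sub>R f (x i)))"
          by (simp add: inner_sum_right)
        have "\<bar>b \<bullet> ((1 / real n) *\<^sub>R (\<Sum>i = 1..n. q (x i) *\<^sub>R f (x i)))\<bar>
            \<le> norm b * norm ((1 / real n) *\<^sub>R (\<Sum>i = 1..n. q (x i) *\<^sub>R f (x i)))"
          by (rule Cauchy_Schwarz_ineq2)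
        also have "\<dots> \<le> \<rho> * (\<kappa> / (8 * \<rho>))"
          unfolding b using elim(4) \<rho>(1) unfolding x_def by (intro mult_left_mono) auto
        also have "\<dots> = \<kappa> / 8" using \<rho>(1) by simp
        finally show ?thesis unfolding eq by linarith
      qed
      moreover have "(\<Sum>i = 1..n. qb b (x i) * (b \<bullet> f (x i)) - qb b (x i) * (b \<bullet> \<psi> n (x i))) / real n \<le> \<kappa> / 8"
      proof (rule average_le[OF n])
        fix i assume i: "i \<in> {1..n}"
        have q0: "0 \<le> qb b (x i)" using qb(1)[OF b' x[OF i]] \<eta>(1) by linarith
        have "b \<bullet> (f (x i) - \<psi> n (x i)) \<le> norm b * norm (f (x i) - \<psi> n (x i))" by (rule norm_cauchy_schwarz)
        also have "\<dots> \<le> \<rho> * e2"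
          unfolding b using elim(5) x[OF i] \<rho>(1) by (intro mult_left_mono) (auto simp: norm_minus_commute intro: less_imp_le)
        finally have d: "b \<bullet> (f (x i) - \<psi> n (x i)) \<le> \<rho> * e2" .
        have "qb b (x i) * (b \<bullet> f (x i)) - qb b (x i) * (b \<bullet> \<psi> n (x i)) = qb b (x i) * (b \<bullet> (f (x i) - \<psi> n (x i)))"
          by (simp add: inner_diff_right right_diff_distrib)
        also have "\<dots> \<le> qb b (x i) * (\<rho> * e2)" using d q0 by (rule mult_left_mono)
        also have "\<dots> \<le> (Q + \<rho> * M) * (\<rho> * e2)"
          using qb(2)[OF b' x[OF i]] \<rho>(1) e2(1) by (intro mult_right_mono) auto
        finally show "qb b (x i) * (b \<bullet> f (x i)) - qb b (x i) * (b \<bullet> \<psi> n (x i)) \<le> \<kappa> / 8" using e2(2) by simp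
      qed
      moreover have "(\<Sum>i = 1..n. qb b (x i) * (b \<bullet> f (x i))) / real n
          = (\<Sum>i = 1..n. q (x i) * (b \<bullet> f (x i))) / real n + (\<Sum>i = 1..n. (b \<bullet> f (x i))\<^sup>2) / real n"
        by (simp add: qb_def distrib_right sum.distrib add_divide_distrib power2_eq_square)
      moreover have "b \<bullet> D (m b) = (\<Sum>i = 1..n. qb b (x i) * (b \<bullet> \<psi> n (x i))) / real n"
        unfolding Dm by (simp add: inner_sum_right)
      ultimately show ?thesis unfolding sum_subtractf diff_divide_distrib by linarith
    qed
    define \<Psi> where "\<Psi> b = H (\<mu>0 + h b) - H \<mu>0" for b
    have out: "0 < b \<bullet> \<Psi> b" if b: "norm b = \<rho>" for b
    proof -
      have b': "norm b \<le> \<rho>" using b by simp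
      have rs: "0 < r * s b" using r s_pos[OF b'] by simp
      have Dh: "D (h b) = (1 / (r * s b)) *\<^sub>R D (m b)"
        unfolding h_def by (rule linear_scale[OF bounded_linear.linear[OF D_linear]])
      have nh: "norm (h b) = norm (m b) / (r * s b)" using rs by (simp add: h_def)
      have "\<bar>b \<bullet> (\<Psi> b - D (h b))\<bar> \<le> norm b * norm (\<Psi> b - D (h b))" by (rule Cauchy_Schwarz_ineq2)
      also have "\<dots> \<le> \<rho> * (\<delta> * norm (h b))"
        unfolding b \<Psi>_def using \<eta>2(2)[OF h_small[OF b']] \<rho>(1) by (intro mult_left_mono) auto
      also have "\<dots> = \<rho> * \<delta> * norm (m b) / (r * s b)" by (simp add: nh)
      also have "\<dots> \<le> \<rho> * \<delta> * B' / (r * s b)"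
        using m_le[OF b'] \<rho>(1) \<delta> rs by (intro divide_right_mono mult_left_mono) auto
      also have "\<rho> * \<delta> * B' = \<kappa> / 4" using \<rho>(1) B' by (simp add: \<delta>_def)
      finally have ge: "b \<bullet> D (h b) - \<kappa> / 4 / (r * s b) \<le> b \<bullet> \<Psi> b" by (simp add: inner_diff_right)
      have "\<kappa> / 4 / (r * s b) < \<kappa> / 2 / (r * s b)"
        using \<kappa>(1) rs by (intro divide_strict_right_mono) auto
      also have "\<dots> \<le> (b \<bullet> D (m b)) / (r * s b)"
        using D_m[OF b] rs by (intro divide_right_mono) auto
      also have "\<dots> = b \<bullet> D (h b)" by (simp add: Dh)
      finally have "0 < b \<bullet> D (h b) - \<kappa> / 4 / (r * s b)" unfolding diff_gt_0_iff_gt .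
      then show ?thesis using ge by (rule less_le_trans)
    qed
    have "continuous_on (cball 0 \<rho>) s" unfolding s_def qb_def by (intro continuous_intros) (use n in auto)
    moreover have "continuous_on (cball 0 \<rho>) m" unfolding m_def qb_def by (intro continuous_intros)
    ultimately have h_cont: "continuous_on (cball 0 \<rho>) (\<lambda>b. \<mu>0 + h b)"
      unfolding h_def using r s_pos by (intro continuous_intros) (auto, metis less_irrefl)
    \<comment> \<open>\<open>h_small\<close> keeps \<open>\<mu>0 + h b\<close> inside
      \<open>U\<close>, where \<open>H\<close> is continuous.\<close>
    have "continuous_on (cball 0 \<rho>) \<Psi>"
      unfolding \<Psi>_def using \<eta>2(2)[OF h_small]
      by (intro continuous_on_diff continuous_on_const continuous_on_compose2[OF U(3) h_cont]) auto
    then obtain b where b: "norm b \<le> \<rho>" "\<Psi> b = 0" using zero_of_outward_field[OF \<rho>(1) _ out] by blast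
    \<comment> \<open>The normaliser exceeds 1 by at most \<open>e / 2\<close>: \<open>e / 4\<close>
      from the Riemann sum of \<open>q\<close> and \<open>e / 4\<close> from the tilt.\<close>
    define N where "N = (\<Sum>i = 1..n. qb b (x i)) / real n"
    have qb0: "0 < qb b (x i)" if "i \<in> {1..n}" for i using qb(1)[OF b(1) x[OF that]] \<eta>(1) by linarith
    have N: "0 < N" unfolding N_def using n qb0 by (intro divide_pos_pos sum_pos) auto
    define p where "p i = qb b (x i) / (real n * N)" for i
    have "(\<Sum>i = 1..n. b \<bullet> f (x i)) / real n \<le> \<rho> * M"
      using bf[OF b(1) x] by (intro average_le[OF n]) (meson abs_le_D1)
    then have "N \<le> 1 + e / 2"
      using elim(2) \<rho>(4) unfolding N_def qb_def by (simp add: sum.distrib add_divide_distrib x_def)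
    moreover have "ln N \<le> N - 1" using N by (rule ln_le_minus_one)
    ultimately have lnN: "ln N \<le> e / 2" by linarith
    show ?case
    proof (intro exI[of _ p] exI[of _ "h b"] conjI)
      show "\<forall>i\<in>{1..n}. 0 < p i" using qb0 n N by (simp add: p_def)
      have "(\<Sum>i = 1..n. p i) = (\<Sum>i = 1..n. qb b (x i)) / (real n * N)" unfolding p_def by (simp only: sum_divide_distrib)
      also have "(\<Sum>i = 1..n. qb b (x i)) = real n * N" using n by (simp add: N_def)
      finally have "(\<Sum>i = 1..n. p i) = real n * N / (real n * N)" .
      also have "\<dots> = 1" using N n by simp
      finally show "(\<Sum>i = 1..n. p i) = 1" .
      show "H (\<mu>0 + h b) = H \<mu>0" using b(2) by (simp add: \<Psi>_def)
      have 1: "(\<Sum>i = 1..n. (p i * w (x i)) *\<^sub>R zn n (x i)) = (1 / N) *\<^sub>R m b"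
        unfolding m_def p_def scaleR_sum_right by (intro sum.cong) (auto simp: field_simps)
      have 2: "(\<Sum>i = 1..n. p i * (w (x i) * x i)) = s b / N"
        unfolding s_def p_def g_def sum_divide_distrib by (intro sum.cong) (auto simp: field_simps)
      have "(1 / N) *\<^sub>R m b = (r * (s b / N)) *\<^sub>R h b" using r s_pos[OF b(1)] by (simp add: h_def)
      then show "(\<Sum>i = 1..n. p i *\<^sub>R w (real i / real n) *\<^sub>R
          (sqrt (real n) *\<^sub>R zn n (real i / real n) - real i *\<^sub>R h b)) = 0"
        unfolding EL_constraint_iff[OF n] using 1 2 by (simp add: x_def r_def)
      have "- ((\<Sum>i = 1..n. ln (real n * p i)) / real n) = (\<Sum>i = 1..n. - ln (qb b (x i)) + ln N) / real n"
      proof -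
        have "- (\<Sum>i = 1..n. ln (real n * p i)) = (\<Sum>i = 1..n. - ln (qb b (x i)) + ln N)"
          unfolding sum_negf[symmetric]
        proof (intro sum.cong refl)
          fix i assume i: "i \<in> {1..n}"
          have "real n * p i = qb b (x i) / N" using n by (simp add: p_def)
          then show "- ln (real n * p i) = - ln (qb b (x i)) + ln N" using N qb0[OF i] by (simp add: ln_div)
        qed
        then show ?thesis by (metis minus_divide_left)
      qed
      also have "\<dots> \<le> (\<Sum>i = 1..n. - ln (q (x i)) + (e / 4 + e / 2)) / real n"
        using qb(3)[OF b(1) x] lnN by (intro divide_right_mono sum_mono) fastforce+
      also have "\<dots> = (\<Sum>i = 1..n. - ln (q (x i))) / real n + (e / 4 + e / 2)"
        using n unfolding sum.distrib add_divide_distrib by simp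
      also have "\<dots> \<le> int01 (\<lambda>t. - ln (q t)) + e" using elim(3) unfolding x_def by linarith
      finally show "- ((\<Sum>i = 1..n. ln (real n * p i)) / real n) \<le> int01 (\<lambda>t. - ln (q t)) + e" .
    qed
  qed
qed

text \<open>A squeeze between the two likelihood bounds. Weights with a zero entry have product 0
  and cannot produce a positive supremum. A ratio equal to 0 gives the value \<infinity>, which the
  lower estimate tolerates and the upper estimate excludes for large \<open>n\<close>.\<close>

lemma rescaled_EL_limit:
  assumes ts: "two_sided_path f"
  shows "(\<lambda>n. - (ereal (1 / real n) * elog (rescaled_EL w H \<mu>0 n (zn n)))) \<longlonglongrightarrow> el_val f"
proof -
  interpret P: two_sided_path f by fact
  define A where "A n = {(\<Prod>i = 1..n. q i) | q \<mu>.
       (\<forall>i\<in>{1..n}. 0 \<le> q i) \<and> (\<Sum>i = 1..n. q i) = (1::real) \<and>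
       (\<Sum>i = 1..n. q i *\<^sub>R w (real i / real n) *\<^sub>R
          (sqrt (real n) *\<^sub>R zn n (real i / real n) - real i *\<^sub>R (\<mu> - \<mu>0))) = 0 \<and> H \<mu> = H \<mu>0}" for n
  define R where "R n = rescaled_EL w H \<mu>0 n (zn n)" for n
  have R_eq: "R n = real n ^ n * Sup (insert 0 (A n))" for n by (simp add: R_def A_def rescaled_EL_def)
  have bdd: "bdd_above (insert 0 (A n))" for n
  proof (rule bdd_aboveI[of _ 1])
    fix a assume "a \<in> insert 0 (A n)"
    then consider "a = 0" | q where "a = (\<Prod>i = 1..n. q i)" "\<forall>i\<in>{1..n}. 0 \<le> q i" "(\<Sum>i = 1..n. q i) = (1::real)"
      by (auto simp: A_def)
    then show "a \<le> 1"
    proof cases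
      case 2
      have "q i \<le> 1" if "i \<in> {1..n}" for i using member_le_sum[OF that, of q] 2 by auto
      then show ?thesis unfolding 2(1) using 2(2) by (intro prod_le_1) auto
    qed simp
  qed
  have ln_prod_scaled: "ln (real n ^ n * (\<Prod>i = 1..n. q i)) = (\<Sum>i = 1..n. ln (real n * q i))"
      "0 < real n ^ n * (\<Prod>i = 1..n. q i)"
    if "0 < n" "\<And>i. i \<in> {1..n} \<Longrightarrow> 0 < q i" for n q
  proof -
    have "real n ^ n * (\<Prod>i = 1..n. q i) = (\<Prod>i = 1..n. real n * q i)" by (simp add: prod.distrib)
    moreover have "ln (\<Prod>i = 1..n. real n * q i) = (\<Sum>i = 1..n. ln (real n * q i))"
      using that by (intro ln_prod) (auto simp: less_imp_neq[symmetric])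
    ultimately show "ln (real n ^ n * (\<Prod>i = 1..n. q i)) = (\<Sum>i = 1..n. ln (real n * q i))" by simp
    show "0 < real n ^ n * (\<Prod>i = 1..n. q i)" using that by (intro mult_pos_pos prod_pos) auto
  qed
  have upper: "eventually (\<lambda>n. - (ereal (1 / real n) * elog (R n)) \<le> ereal (P.V + e)) sequentially" if e: "0 < e" for e
  proof -
    obtain q where q: "continuous_on {0..1} q" "\<And>t. t \<in> {0..1} \<Longrightarrow> 0 < q t" "int01 q = 1"
      "int01 (\<lambda>t. q t *\<^sub>R f t) = 0" "int01 (\<lambda>t. - ln (q t)) \<le> P.V + e / 2"
      using P.dual_density[of "e / 2"] e by auto
    from likelihood_ge[OF ts q(1-4), of "e / 2"] e
    have "eventually (\<lambda>n. \<exists>p h. (\<forall>i\<in>{1..n}. 0 < p i) \<and> (\<Sum>i = 1..n. p i) = 1 \<and>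
      (\<Sum>i = 1..n. p i *\<^sub>R w (real i / real n) *\<^sub>R
        (sqrt (real n) *\<^sub>R zn n (real i / real n) - real i *\<^sub>R h)) = 0 \<and> H (\<mu>0 + h) = H \<mu>0 \<and>
      - ((\<Sum>i = 1..n. ln (real n * p i)) / real n) \<le> int01 (\<lambda>t. - ln (q t)) + e / 2) sequentially" by simp
    then show ?thesis using eventually_gt_at_top[of 0]
    proof eventually_elim
      case (elim n)
      then obtain p h where p: "\<forall>i\<in>{1..n}. 0 < p i" "(\<Sum>i = 1..n. p i) = 1"
        "(\<Sum>i = 1..n. p i *\<^sub>R w (real i / real n) *\<^sub>R
          (sqrt (real n) *\<^sub>R zn n (real i / real n) - real i *\<^sub>R h)) = 0" "H (\<mu>0 + h) = H \<mu>0"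
        "- ((\<Sum>i = 1..n. ln (real n * p i)) / real n) \<le> int01 (\<lambda>t. - ln (q t)) + e / 2" by blast
      have "(\<Prod>i = 1..n. p i) \<in> A n"
        unfolding A_def using p by (intro CollectI exI[of _ p] exI[of _ "\<mu>0 + h"]) (auto intro: less_imp_le)
      then have "(\<Prod>i = 1..n. p i) \<le> Sup (insert 0 (A n))" by (intro cSup_upper bdd) auto
      then have le: "real n ^ n * (\<Prod>i = 1..n. p i) \<le> R n" unfolding R_eq by (intro mult_left_mono) auto
      have pos: "0 < R n" using le ln_prod_scaled(2)[of n p] elim(2) p(1) by force
      have "(\<Sum>i = 1..n. ln (real n * p i)) \<le> ln (R n)"
        using le ln_prod_scaled[of n p] elim(2) p(1) by (metis ln_mono)
      then have "- (ln (R n) / real n) \<le> - ((\<Sum>i = 1..n. ln (real n * p i)) / real n)"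
        using elim(2) by (simp add: divide_right_mono)
      also have "\<dots> \<le> P.V + e" using p(5) q(5) by simp
      finally show ?case using pos by (simp add: elog_def)
    qed
  qed
  have lower: "eventually (\<lambda>n. ereal (P.V - e) \<le> - (ereal (1 / real n) * elog (R n))) sequentially" if e: "0 < e" for e
  proof -
    obtain a where a: "\<And>t. t \<in> {0..1} \<Longrightarrow> 0 < 1 + a \<bullet> f t" "P.V - e / 2 < int01 (\<lambda>t. ln (1 + a \<bullet> f t))"
      using P.V_approx[of "e / 2"] e by auto
    define L where "L = int01 (\<lambda>t. ln (1 + a \<bullet> f t))"
    from likelihood_le[OF a(1), of "e / 2"] e
    have "eventually (\<lambda>n. \<forall>q h. (\<forall>i\<in>{1..n}. 0 < q i) \<longrightarrow> (\<Sum>i = 1..n. q i) = 1 \<longrightarrow>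
      (\<Sum>i = 1..n. q i *\<^sub>R w (real i / real n) *\<^sub>R
        (sqrt (real n) *\<^sub>R zn n (real i / real n) - real i *\<^sub>R h)) = 0 \<longrightarrow> H (\<mu>0 + h) = H \<mu>0 \<longrightarrow>
      (\<Sum>i = 1..n. ln (real n * q i)) / real n \<le> - L + e / 2) sequentially"
      by (simp add: L_def)
    then show ?thesis using eventually_gt_at_top[of 0]
    proof eventually_elim
      case (elim n)
      have n: "0 < n" by (fact elim)
      \<comment> \<open>The bound on the scaled products is an exponential, hence positive, so it
        also covers products equal to 0.\<close>
      define E where "E = exp (real n * (- L + e / 2))"
      have "a' \<le> E / real n ^ n" if mem: "a' \<in> insert 0 (A n)" for a'
      proof (cases "a' > 0")
        case False
        then show ?thesis unfolding E_def by (smt (verit) divide_nonneg_nonneg exp_ge_zero of_nat_0_le_iff zero_le_power)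
      next
        case True
        then obtain q \<mu> where q: "a' = (\<Prod>i = 1..n. q i)" "\<forall>i\<in>{1..n}. 0 \<le> q i" "(\<Sum>i = 1..n. q i) = 1"
          "(\<Sum>i = 1..n. q i *\<^sub>R w (real i / real n) *\<^sub>R
            (sqrt (real n) *\<^sub>R zn n (real i / real n) - real i *\<^sub>R (\<mu> - \<mu>0))) = 0" "H \<mu> = H \<mu>0"
          using mem unfolding A_def by (blast dest: less_imp_neq)
        have "\<forall>i\<in>{1..n}. q i \<noteq> 0" using True unfolding q(1) by (metis finite_atLeastAtMost less_irrefl prod_zero)
        then have q0: "\<forall>i\<in>{1..n}. 0 < q i" using q(2) by (auto simp: less_le)
        have "(\<Sum>i = 1..n. ln (real n * q i)) / real n \<le> - L + e / 2"
          using elim(1) q0 q(3,4,5) by (auto dest!: spec[of _ q] spec[of _ "\<mu> - \<mu>0"])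
        then have "ln (real n ^ n * a') \<le> real n * (- L + e / 2)"
          using n ln_prod_scaled(1)[OF n, of q] q0 unfolding q(1) by (simp add: field_simps)
        then have "real n ^ n * a' \<le> E"
          unfolding E_def using ln_prod_scaled(2)[OF n, of q] q0 unfolding q(1) by (metis exp_le_cancel_iff exp_ln)
        then show ?thesis using n by (simp add: field_simps)
      qed
      then have "Sup (insert 0 (A n)) \<le> E / real n ^ n" by (intro cSup_least) auto
      then have RE: "R n \<le> E" unfolding R_eq using n by (simp add: field_simps)
      show ?case
      proof (cases "0 < R n")
        case True
        then have "ln (R n) \<le> ln E" using RE by (intro ln_mono) auto
        then have "ln (R n) \<le> real n * (- L + e / 2)" by (simp add: E_def)
        then have "ln (R n) / real n \<le> - L + e / 2" using n by (simp add: field_simps)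
        then have "P.V - e \<le> - (ln (R n) / real n)" using a(2) unfolding L_def by linarith
        then show ?thesis using True by (simp add: elog_def)
      next
        case False
        then show ?thesis using n by (simp add: elog_def)
      qed
    qed
  qed
  show ?thesis unfolding R_def[symmetric] P.el_val_eq
  proof (rule order_tendstoI)
    fix y assume "y < ereal P.V"
    then obtain v where v: "y < ereal v" "v < P.V" by (metis ereal_dense2 less_ereal.simps(1))
    from lower[of "P.V - v"] v show "eventually (\<lambda>n. y < - (ereal (1 / real n) * elog (R n))) sequentially"
      by (auto elim!: eventually_mono intro: less_le_trans)
  next
    fix y assume "ereal P.V < y"
    then obtain v where v: "ereal v < y" "P.V < v" by (metis ereal_dense2 less_ereal.simps(1))
    from upper[of "v - P.V"] v show "eventually (\<lambda>n. - (ereal (1 / real n) * elog (R n)) < y) sequentially"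
      by (auto elim!: eventually_mono intro: le_less_trans)
  qed
qed

end


section \<open>The extended continuous mapping theorem\<close>

text \<open>The two bounds make the real infima meaningful: the constant \<open>C\<close> is an
  integrable majorant, and integrals of majorants stay above \<open>- C\<close>.\<close>

lemma outer_expectation_mono:
  assumes "prob_space M"
    and le: "\<And>\<omega>. \<omega> \<in> space M \<Longrightarrow> h \<omega> \<le> h' \<omega>"
    and bd: "\<And>\<omega>. \<omega> \<in> space M \<Longrightarrow> - C \<le> h \<omega>" "\<And>\<omega>. \<omega> \<in> space M \<Longrightarrow> h' \<omega> \<le> C"
  shows "outer_expectation M h \<le> outer_expectation M h'"
proof -
  interpret prob_space M by fact
  show ?thesis unfolding outer_expectation_def
  proof (rule cInf_superset_mono)
    show "integral\<^sup>L M ` {U. integrable M U \<and> (\<forall>\<omega>\<in>space M. h' \<omega> \<le> U \<omega>)} \<noteq> {}"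
      using bd(2) by (auto intro!: exI[of _ "\<lambda>_. C"])
    show "bdd_below (integral\<^sup>L M ` {U. integrable M U \<and> (\<forall>\<omega>\<in>space M. h \<omega> \<le> U \<omega>)})"
    proof (rule bdd_belowI[of _ "- C"])
      fix x assume "x \<in> integral\<^sup>L M ` {U. integrable M U \<and> (\<forall>\<omega>\<in>space M. h \<omega> \<le> U \<omega>)}"
      then obtain U where U: "x = integral\<^sup>L M U" "integrable M U" "\<forall>\<omega>\<in>space M. h \<omega> \<le> U \<omega>" by auto
      have "(\<integral>\<omega>. - C \<partial>M) \<le> integral\<^sup>L M U"
        using U bd(1) by (intro integral_mono) (auto intro: order_trans)
      then show "- C \<le> x" by (simp add: U prob_space)
    qed
    show "integral\<^sup>L M ` {U. integrable M U \<and> (\<forall>\<omega>\<in>space M. h' \<omega> \<le> U \<omega>)}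
      \<subseteq> integral\<^sup>L M ` {U. integrable M U \<and> (\<forall>\<omega>\<in>space M. h \<omega> \<le> U \<omega>)}"
      using le by (intro image_mono) (auto intro: order_trans)
  qed
qed

text \<open>Violations \<open>y K\<close> at indices \<open>k K \<ge> K\<close> are spliced into one sequence that stays at the base
  point elsewhere; it converges because each \<open>K\<close> occurs at one index only.\<close>

lemma sequential_imp_local_uniform:
  fixes \<Phi> :: "nat \<Rightarrow> 's \<Rightarrow> real" and d :: "'s \<Rightarrow> real"
  assumes seq: "\<And>y. (\<And>n. y n \<in> S) \<Longrightarrow> (\<lambda>n. d (y n)) \<longlonglongrightarrow> 0 \<Longrightarrow> (\<lambda>n. \<Phi> n (y n)) \<longlonglongrightarrow> L"
    and z: "z \<in> S" "d z = 0" and d: "\<And>y. y \<in> S \<Longrightarrow> 0 \<le> d y" and e: "0 < e"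
  obtains K \<delta> where "0 < \<delta>" "\<And>n y. K \<le> n \<Longrightarrow> y \<in> S \<Longrightarrow> d y < \<delta> \<Longrightarrow> \<bar>\<Phi> n y - L\<bar> < e"
proof (rule ccontr)
  assume no: "\<not> thesis"
  have "\<exists>n y. K \<le> n \<and> y \<in> S \<and> d y < inverse (real (Suc K)) \<and> e \<le> \<bar>\<Phi> n y - L\<bar>" for K
    using no that[of "inverse (real (Suc K))" K] by (force simp: not_less)
  then obtain k y where y: "\<And>K. K \<le> k K" "\<And>K. y K \<in> S" "\<And>K. d (y K) < inverse (real (Suc K))"
    "\<And>K. e \<le> \<bar>\<Phi> (k K) (y K) - L\<bar>" by metis
  define A where "A n = {K. k K = n}" for n
  have fin: "finite (A n)" for n
    by (rule finite_subset[of _ "{..n}"]) (use y(1) in \<open>auto simp: A_def\<close>)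
  define x where "x n = (if A n = {} then z else y (Max (A n)))" for n
  have "x n \<in> S" for n using y(2) z by (simp add: x_def)
  moreover have "(\<lambda>n. d (x n)) \<longlonglongrightarrow> 0"
  proof (rule LIMSEQ_I)
    fix r :: real assume "0 < r"
    then obtain K0 where K0: "inverse (real (Suc K0)) < r" using reals_Archimedean by blast
    \<comment> \<open>Past the largest index used by the violations numbered up to
      \<open>K0\<close>, a spliced violation has number greater than \<open>K0\<close> and hence
      distance below \<open>r\<close>.\<close>
    have "norm (d (x n) - 0) < r" if n: "Max (k ` {..K0}) < n" for n
    proof (cases "A n = {}")
      case True
      then show ?thesis using \<open>0 < r\<close> z by (simp add: x_def)
    next
      case False
      define K where "K = Max (A n)"
      have "k K = n" using Max_in[OF fin False] by (simp add: A_def K_def)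
      then have "K0 < K" using n by (metis Max_ge finite_atMost finite_imageI imageI atMost_iff not_le)
      then have "inverse (real (Suc K)) \<le> inverse (real (Suc K0))" by simp
      then have "d (y K) < r" using y(3)[of K] K0 by linarith
      then show ?thesis using d[OF y(2)[of K]] False by (simp add: x_def K_def)
    qed
    then show "\<exists>no. \<forall>n\<ge>no. norm (d (x n) - 0) < r"
      by (meson Suc_le_eq)
  qed
  ultimately have "(\<lambda>n. \<Phi> n (x n)) \<longlonglongrightarrow> L" by (rule seq)
  then obtain n0 where n0: "\<And>n. n0 \<le> n \<Longrightarrow> \<bar>\<Phi> n (x n) - L\<bar> < e"
    using LIMSEQ_D[OF _ e] by (metis real_norm_def)
  define K where "K = Max (A (k n0))"
  have ne: "A (k n0) \<noteq> {}" by (auto simp: A_def)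
  then have "k K = k n0" using Max_in[OF fin ne] by (simp add: A_def K_def)
  then have "e \<le> \<bar>\<Phi> (k n0) (x (k n0)) - L\<bar>" using y(4)[of K] ne by (simp add: x_def K_def)
  then show False using n0[of "k n0"] y(1)[of n0] by simp
qed

text \<open>The envelopes are \<open>\<phi> k z = sup {h n y - k d(y, z) | n \<ge> k}\<close>.\<close>

lemma Lipschitz_upper_envelope:
  fixes m :: "'s metric" and h :: "nat \<Rightarrow> 's \<Rightarrow> real"
  assumes bd: "\<And>n z. z \<in> mspace m \<Longrightarrow> \<bar>h n z\<bar> \<le> C"
    and lim: "\<And>z y. z \<in> G \<Longrightarrow> z \<in> mspace m \<Longrightarrow> (\<And>n. y n \<in> mspace m) \<Longrightarrow>
      (\<lambda>n. mdist m (y n) z) \<longlonglongrightarrow> 0 \<Longrightarrow> (\<lambda>n. h n (y n)) \<longlonglongrightarrow> h0 z"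
  obtains \<phi> :: "nat \<Rightarrow> 's \<Rightarrow> real" where
    "\<And>k. continuous_map (mtopology_of m) euclideanreal (\<phi> k)"
    "\<And>k z. z \<in> mspace m \<Longrightarrow> \<bar>\<phi> k z\<bar> \<le> C"
    "\<And>k n z. z \<in> mspace m \<Longrightarrow> k \<le> n \<Longrightarrow> h n z \<le> \<phi> k z"
    "\<And>z. z \<in> G \<Longrightarrow> z \<in> mspace m \<Longrightarrow> (\<lambda>k. \<phi> k z) \<longlonglongrightarrow> h0 z"
proof -
  define I where "I k = {k..} \<times> mspace m" for k :: nat
  define \<phi> where "\<phi> k z = (SUP p\<in>I k. h (fst p) (snd p) - real k * mdist m (snd p) z)" for k z
  have bdd: "bdd_above ((\<lambda>p. h (fst p) (snd p) - real k * mdist m (snd p) z) ` I k)" for k z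
  proof (rule bdd_aboveI2[of _ _ C])
    fix p assume "p \<in> I k"
    then have "\<bar>h (fst p) (snd p)\<bar> \<le> C" by (intro bd) (auto simp: I_def)
    moreover have "0 \<le> real k * mdist m (snd p) z" by simp
    ultimately show "h (fst p) (snd p) - real k * mdist m (snd p) z \<le> C" by linarith
  qed
  have le_\<phi>: "h n y - real k * mdist m y z \<le> \<phi> k z" if "y \<in> mspace m" "k \<le> n" for n y k z
    unfolding \<phi>_def using cSUP_upper[OF _ bdd, of "(n, y)" k z] that by (auto simp: I_def)
  have \<phi>_le: "\<phi> k z \<le> c" if "z \<in> mspace m" "\<And>n y. y \<in> mspace m \<Longrightarrow> k \<le> n \<Longrightarrow> h n y - real k * mdist m y z \<le> c" for k z c
    unfolding \<phi>_def using that by (intro cSUP_least) (auto simp: I_def)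
  have ge: "h n z \<le> \<phi> k z" if "z \<in> mspace m" "k \<le> n" for n z k
  proof -
    have "mdist m z z = 0" using that(1) by simp
    then show ?thesis using le_\<phi>[OF that, of z] by simp
  qed
  have \<phi>_bd: "\<bar>\<phi> k z\<bar> \<le> C" if z: "z \<in> mspace m" for k z
  proof -
    have "\<phi> k z \<le> C"
    proof (rule \<phi>_le[OF z])
      fix n y assume "y \<in> mspace m"
      then have "\<bar>h n y\<bar> \<le> C" by (rule bd)
      moreover have "0 \<le> real k * mdist m y z" by simp
      ultimately show "h n y - real k * mdist m y z \<le> C" by linarith
    qed
    moreover have "- C \<le> \<phi> k z" using ge[OF z, of k k] bd[OF z, of k] by linarith
    ultimately show ?thesis by linarith
  qed
  \<comment> \<open>A supremum of functions with Lipschitz constant \<open>k\<close> is Lipschitz;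
    this gives continuity whatever the regularity of \<open>h\<close>.\<close>
  have lip: "\<phi> k z \<le> \<phi> k z' + real k * mdist m z z'" if z: "z \<in> mspace m" "z' \<in> mspace m" for k z z'
  proof (rule \<phi>_le[OF z(1)])
    fix n y assume y: "y \<in> mspace m" "k \<le> n"
    have "mdist m y z' \<le> mdist m y z + mdist m z z'" using y z by (intro mdist_triangle)
    then have "real k * mdist m y z' \<le> real k * (mdist m y z + mdist m z z')" by (rule mult_left_mono) simp
    then show "h n y - real k * mdist m y z \<le> \<phi> k z' + real k * mdist m z z'"
      using le_\<phi>[OF y, of z'] by (simp add: distrib_left)
  qed
  have "Lipschitz_continuous_map m euclidean_metric (\<phi> k)" for k
    unfolding Lipschitz_continuous_map_def
  proof (intro conjI exI[of _ "real k"] ballI)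
    fix z z' assume z: "z \<in> mspace m" "z' \<in> mspace m"
    show "mdist euclidean_metric (\<phi> k z) (\<phi> k z') \<le> real k * mdist m z z'"
      using lip[OF z, of k] lip[OF z(2,1), of k] mdist_commute[of m z z'] by (simp add: dist_real_def)
  qed simp
  then have cont: "continuous_map (mtopology_of m) euclideanreal (\<phi> k)" for k
    using Lipschitz_continuous_imp_continuous_map by fastforce
  have conv: "(\<lambda>k. \<phi> k z) \<longlonglongrightarrow> h0 z" if z: "z \<in> G" "z \<in> mspace m" for z
  proof (rule LIMSEQ_I)
    fix e :: real assume e: "0 < e"
    obtain K \<delta> where K: "0 < \<delta>" "\<And>n y. K \<le> n \<Longrightarrow> y \<in> mspace m \<Longrightarrow> mdist m y z < \<delta> \<Longrightarrow> \<bar>h n y - h0 z\<bar> < e / 2"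
      by (rule sequential_imp_local_uniform[where \<Phi> = h and L = "h0 z" and d = "\<lambda>y. mdist m y z"
            and S = "mspace m" and z = z and e = "e / 2"])
        (use lim[OF z] z e in auto)
    \<comment> \<open>From \<open>K1\<close> on, the penalty at distance \<open>\<delta>\<close> or
      more exceeds \<open>C - h0 z\<close>, so far points cannot raise the envelope.\<close>
    obtain K1 where K1: "(C - h0 z) / \<delta> < real K1" using reals_Archimedean2 by blast
    have "norm (\<phi> k z - h0 z) < e" if k: "max K K1 \<le> k" for k
    proof -
      have "mdist m z z = 0" using z(2) by simp
      then have "mdist m z z < \<delta>" using K(1) by linarith
      moreover have "K \<le> k" using k by simp
      ultimately have "\<bar>h k z - h0 z\<bar> < e / 2" using K(2) z(2) by blast
      then have "h0 z - e / 2 \<le> \<phi> k z" using ge[OF z(2), of k k] by linarith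
      moreover have "\<phi> k z \<le> h0 z + e / 2"
      proof (rule \<phi>_le[OF z(2)])
        fix n y assume y: "y \<in> mspace m" "k \<le> n"
        show "h n y - real k * mdist m y z \<le> h0 z + e / 2"
        proof (cases "mdist m y z < \<delta>")
          case True
          then have "\<bar>h n y - h0 z\<bar> < e / 2" using K(2)[of n y] y k by simp
          moreover have "0 \<le> real k * mdist m y z" by simp
          ultimately show ?thesis by linarith
        next
          case False
          have "C - h0 z \<le> real K1 * \<delta>" using K1 K(1) by (simp add: field_simps)
          also have "\<dots> \<le> real k * mdist m y z" using False k K(1) by (intro mult_mono) auto
          finally show ?thesis using bd[OF y(1), of n] e by linarith
        qed
      qed
      ultimately show ?thesis using e unfolding real_norm_def by linarith
    qed
    then show "\<exists>no. \<forall>n\<ge>no. norm (\<phi> n z - h0 z) < e" by blast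
  qed
  show thesis using that[of \<phi>] cont \<phi>_bd ge conv by blast
qed

text \<open>For a fixed envelope the weak convergence lets \<open>n\<close> grow; dominated
  convergence then lets the index \<open>k\<close> of the envelopes grow.\<close>

lemma conv_in_dist_limits:
  fixes m :: "'s metric" and h :: "nat \<Rightarrow> 's \<Rightarrow> real"
  assumes M: "prob_space M" and N: "prob_space N" and conv: "conv_in_dist (mtopology_of m) M Z N Z'"
    and bd: "\<And>n z. z \<in> mspace m \<Longrightarrow> \<bar>\<phi> n z\<bar> \<le> C"
    and cont: "\<And>k. continuous_map (mtopology_of m) euclideanreal (\<phi> k)"
    and meas: "(\<lambda>\<omega>. h0 (Z' \<omega>)) \<in> borel_measurable N"
    and lim: "AE \<omega> in N. (\<lambda>k. \<phi> k (Z' \<omega>)) \<longlonglongrightarrow> h0 (Z' \<omega>)"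
  shows "(\<lambda>k. \<integral>\<omega>. \<phi> k (Z' \<omega>) \<partial>N) \<longlonglongrightarrow> (\<integral>\<omega>. h0 (Z' \<omega>) \<partial>N)"
    and "(\<lambda>n. outer_expectation M (\<lambda>\<omega>. \<phi> k (Z n \<omega>))) \<longlonglongrightarrow> (\<integral>\<omega>. \<phi> k (Z' \<omega>) \<partial>N)"
proof -
  interpret N: prob_space N by fact
  have Z': "Z' \<omega> \<in> mspace m" if "\<omega> \<in> space N" for \<omega>
    using conv that by (auto simp: conv_in_dist_def)
  have "bounded (\<phi> k ` mspace m)" for k
    using bd by (auto intro!: boundedI[of _ C])
  then have c: "(\<lambda>\<omega>. \<phi> k (Z' \<omega>)) \<in> borel_measurable N \<and>
      (\<lambda>n. outer_expectation M (\<lambda>\<omega>. \<phi> k (Z n \<omega>))) \<longlonglongrightarrow> (\<integral>\<omega>. \<phi> k (Z' \<omega>) \<partial>N)" for k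
    using conv cont[of k] by (auto simp: conv_in_dist_def)
  then show "(\<lambda>n. outer_expectation M (\<lambda>\<omega>. \<phi> k (Z n \<omega>))) \<longlonglongrightarrow> (\<integral>\<omega>. \<phi> k (Z' \<omega>) \<partial>N)" by blast
  show "(\<lambda>k. \<integral>\<omega>. \<phi> k (Z' \<omega>) \<partial>N) \<longlonglongrightarrow> (\<integral>\<omega>. h0 (Z' \<omega>) \<partial>N)"
    by (rule integral_dominated_convergence[where w = "\<lambda>_. C"]) (use c meas lim bd Z' in auto)
qed

text \<open>The functions \<open>h n\<close> are sandwiched between continuous envelopes, the lower
  ones being minus the envelopes of \<open>- h n\<close>. For fixed \<open>k\<close> the outer
  expectations of the envelopes converge, and letting \<open>k\<close> grow closes the gap on
  \<open>G\<close>. Outer expectations absorb any lack of measurability of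
  \<open>h n\<close>.\<close>

lemma extended_continuous_mapping:
  fixes m :: "'s metric" and h :: "nat \<Rightarrow> 's \<Rightarrow> real"
  assumes M: "prob_space M" and N: "prob_space N" and conv: "conv_in_dist (mtopology_of m) M Z N Z'"
    and bd: "\<And>n z. z \<in> mspace m \<Longrightarrow> \<bar>h n z\<bar> \<le> C"
    and G: "AE \<omega> in N. Z' \<omega> \<in> G"
    and lim: "\<And>z y. z \<in> G \<Longrightarrow> z \<in> mspace m \<Longrightarrow> (\<And>n. y n \<in> mspace m) \<Longrightarrow>
      (\<lambda>n. mdist m (y n) z) \<longlonglongrightarrow> 0 \<Longrightarrow> (\<lambda>n. h n (y n)) \<longlonglongrightarrow> h0 z"
    and meas: "(\<lambda>\<omega>. h0 (Z' \<omega>)) \<in> borel_measurable N"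
  shows "(\<lambda>n. outer_expectation M (\<lambda>\<omega>. h n (Z n \<omega>))) \<longlonglongrightarrow> (\<integral>\<omega>. h0 (Z' \<omega>) \<partial>N)"
proof -
  obtain u where u: "\<And>k. continuous_map (mtopology_of m) euclideanreal (u k)"
    "\<And>k z. z \<in> mspace m \<Longrightarrow> \<bar>u k z\<bar> \<le> C"
    "\<And>k n z. z \<in> mspace m \<Longrightarrow> k \<le> n \<Longrightarrow> h n z \<le> u k z"
    "\<And>z. z \<in> G \<Longrightarrow> z \<in> mspace m \<Longrightarrow> (\<lambda>k. u k z) \<longlonglongrightarrow> h0 z"
    using Lipschitz_upper_envelope[where h = h and ?h0.0 = h0, OF bd lim] by blast
  have lim': "(\<lambda>n. - h n (y n)) \<longlonglongrightarrow> - h0 z"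
    if "z \<in> G" "z \<in> mspace m" "\<And>n. y n \<in> mspace m" "(\<lambda>n. mdist m (y n) z) \<longlonglongrightarrow> 0" for z y
    using lim[OF that] by (rule tendsto_minus)
  have bd': "\<And>n z. z \<in> mspace m \<Longrightarrow> \<bar>- h n z\<bar> \<le> C" using bd by simp
  obtain v where v: "\<And>k. continuous_map (mtopology_of m) euclideanreal (v k)"
    "\<And>k z. z \<in> mspace m \<Longrightarrow> \<bar>v k z\<bar> \<le> C"
    "\<And>k n z. z \<in> mspace m \<Longrightarrow> k \<le> n \<Longrightarrow> - h n z \<le> v k z"
    "\<And>z. z \<in> G \<Longrightarrow> z \<in> mspace m \<Longrightarrow> (\<lambda>k. v k z) \<longlonglongrightarrow> - h0 z"
    using Lipschitz_upper_envelope[where h = "\<lambda>n z. - h n z" and ?h0.0 = "\<lambda>z. - h0 z", OF bd' lim'] by blast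
  have Z': "Z' \<omega> \<in> mspace m" if "\<omega> \<in> space N" for \<omega>
    using conv that by (auto simp: conv_in_dist_def)
  have Z: "Z n \<omega> \<in> mspace m" if "\<omega> \<in> space M" for \<omega> n
    using conv that by (auto simp: conv_in_dist_def)
  have AE_u: "AE \<omega> in N. (\<lambda>k. u k (Z' \<omega>)) \<longlonglongrightarrow> h0 (Z' \<omega>)"
    using G by (rule AE_mp) (auto intro!: AE_I2 u(4) Z')
  have AE_v: "AE \<omega> in N. (\<lambda>k. - v k (Z' \<omega>)) \<longlonglongrightarrow> h0 (Z' \<omega>)"
  proof (rule AE_mp[OF G], rule AE_I2, rule impI)
    fix \<omega> assume "\<omega> \<in> space N" "Z' \<omega> \<in> G"
    then show "(\<lambda>k. - v k (Z' \<omega>)) \<longlonglongrightarrow> h0 (Z' \<omega>)" using tendsto_minus[OF v(4)] Z' by fastforce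
  qed
  have cv: "continuous_map (mtopology_of m) euclideanreal (\<lambda>z. - v k z)" for k
    using v(1) by (intro continuous_map_minus)
  have bv: "\<bar>- v k z\<bar> \<le> C" if "z \<in> mspace m" for k z using v(2)[OF that] by simp
  note U = conv_in_dist_limits[OF M N conv u(2) u(1) meas AE_u]
  note V = conv_in_dist_limits[OF M N conv bv cv meas AE_v]
  define E where "E = (\<integral>\<omega>. h0 (Z' \<omega>) \<partial>N)"
  show ?thesis unfolding E_def[symmetric]
  proof (rule order_tendstoI)
    fix a assume "a < E"
    then have "eventually (\<lambda>k. a < (\<integral>\<omega>. - v k (Z' \<omega>) \<partial>N)) sequentially"
      using V(1) unfolding E_def by (rule order_tendstoD[rotated])
    then obtain k where "a < (\<integral>\<omega>. - v k (Z' \<omega>) \<partial>N)" by (auto simp: eventually_sequentially)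
    then have "eventually (\<lambda>n. a < outer_expectation M (\<lambda>\<omega>. - v k (Z n \<omega>))) sequentially"
      using V(2)[of k] by (rule order_tendstoD[rotated])
    then show "eventually (\<lambda>n. a < outer_expectation M (\<lambda>\<omega>. h n (Z n \<omega>))) sequentially"
      using eventually_ge_at_top[of k]
    proof eventually_elim
      case (elim n)
      have "outer_expectation M (\<lambda>\<omega>. - v k (Z n \<omega>)) \<le> outer_expectation M (\<lambda>\<omega>. h n (Z n \<omega>))"
      proof (rule outer_expectation_mono[OF M, where C = C])
        fix \<omega> assume w: "\<omega> \<in> space M"
        show "- v k (Z n \<omega>) \<le> h n (Z n \<omega>)" using v(3)[OF Z[OF w, of n] elim(2)] by linarith
        show "- C \<le> - v k (Z n \<omega>)" using v(2)[OF Z[OF w, of n], of k] by linarith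
        show "h n (Z n \<omega>) \<le> C" using bd[OF Z[OF w, of n], of n] by linarith
      qed
      then show ?case using elim by linarith
    qed
  next
    fix a assume "E < a"
    then have "eventually (\<lambda>k. (\<integral>\<omega>. u k (Z' \<omega>) \<partial>N) < a) sequentially"
      using U(1) unfolding E_def by (rule order_tendstoD[rotated])
    then obtain k where "(\<integral>\<omega>. u k (Z' \<omega>) \<partial>N) < a" by (auto simp: eventually_sequentially)
    then have "eventually (\<lambda>n. outer_expectation M (\<lambda>\<omega>. u k (Z n \<omega>)) < a) sequentially"
      using U(2)[of k] by (rule order_tendstoD[rotated])
    then show "eventually (\<lambda>n. outer_expectation M (\<lambda>\<omega>. h n (Z n \<omega>)) < a) sequentially"
      using eventually_ge_at_top[of k]
    proof eventually_elim
      case (elim n)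
      have "outer_expectation M (\<lambda>\<omega>. h n (Z n \<omega>)) \<le> outer_expectation M (\<lambda>\<omega>. u k (Z n \<omega>))"
      proof (rule outer_expectation_mono[OF M, where C = C])
        fix \<omega> assume w: "\<omega> \<in> space M"
        show "h n (Z n \<omega>) \<le> u k (Z n \<omega>)" using u(3)[OF Z[OF w, of n] elim(2)] by linarith
        show "- C \<le> h n (Z n \<omega>)" using bd[OF Z[OF w, of n], of n] by linarith
        show "u k (Z n \<omega>) \<le> C" using u(2)[OF Z[OF w, of n], of k] by linarith
      qed
      then show ?case using elim by linarith
    qed
  qed
qed


section \<open>Increments of Brownian motion\<close>

lemma strict_mono_chain_bounds:
  fixes \<tau> :: "nat \<Rightarrow> real"
  assumes "0 \<le> \<tau> 0" "\<tau> k \<le> 1" "\<forall>i<k. \<tau> i < \<tau> (Suc i)" "j \<le> k"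
  shows "\<tau> j \<in> {0..1}"
proof -
  have "\<tau> a \<le> \<tau> b" if "a \<le> b" "b \<le> k" for a b
    using that by (induction b rule: dec_induct) (use assms(3) in \<open>auto intro: order_trans less_imp_le simp: Suc_le_eq\<close>)
  from this[of 0 j] this[of j k] show ?thesis using assms by auto
qed

lemma iid_bm_coordinate:
  assumes "iid_brownian_motions01 N B"
  shows "brownian_motion01 N (\<lambda>t \<omega>. B t \<omega> $ i)"
  using assms by (simp add: iid_brownian_motions01_def)

lemma iid_bm_measurable:
  fixes B :: "real \<Rightarrow> 'b \<Rightarrow> real ^ 'd"
  assumes "iid_brownian_motions01 N B" "t \<in> {0..1}"
  shows "B t \<in> borel_measurable N"
proof -
  have "(\<lambda>\<omega>. B t \<omega> $ i) \<in> borel_measurable N" for i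
    using iid_bm_coordinate[OF assms(1), of i] assms(2) by (simp add: brownian_motion01_def)
  then show ?thesis
    by (subst borel_measurable_euclidean_space) (auto simp: Basis_vec_def inner_axis)
qed

lemma iid_bm_path:
  fixes B :: "real \<Rightarrow> 'b \<Rightarrow> real ^ 'd"
  assumes "iid_brownian_motions01 N B" "\<omega> \<in> space N"
  shows "B 0 \<omega> = 0" "continuous_on {0..1} (\<lambda>t. B t \<omega>)"
proof -
  have 1: "B 0 \<omega> $ i = 0 \<and> continuous_on {0..1} (\<lambda>t. B t \<omega> $ i)" for i
    using iid_bm_coordinate[OF assms(1), of i] assms(2) by (simp add: brownian_motion01_def)
  then show "B 0 \<omega> = 0" by (simp add: vec_eq_iff)
  have "continuous_on {0..1} (\<lambda>t. \<chi> i. B t \<omega> $ i)" using 1 by (intro continuous_on_vec_lambda) auto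
  then show "continuous_on {0..1} (\<lambda>t. B t \<omega>)" by simp
qed

text \<open>The probability of a grid of increment events factors first over the coordinates, by
  independence of the coordinate paths, and then over the times within each coordinate.\<close>

lemma iid_bm_increments_indep:
  fixes B :: "real \<Rightarrow> 'b \<Rightarrow> real ^ 'd"
  assumes N: "prob_space N" and B: "iid_brownian_motions01 N B"
    and k: "0 < k" and \<tau>: "0 \<le> \<tau> 0" "\<tau> k \<le> 1" "\<forall>i<k. \<tau> i < \<tau> (Suc i)"
  shows "prob_space.indep_vars N (\<lambda>_. borel) (\<lambda>p \<omega>. B (\<tau> (Suc (fst p))) \<omega> $ snd p - B (\<tau> (fst p)) \<omega> $ snd p)
    ({..<k} \<times> (UNIV :: 'd set))"
proof -
  interpret prob_space N by fact
  have \<tau>01: "\<tau> j \<in> {0..1}" if "j \<le> k" for j using strict_mono_chain_bounds[OF \<tau> that] .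
  have bm: "(\<lambda>\<omega>. B t \<omega> $ i) \<in> borel_measurable N" if "t \<in> {0..1}" for t i
    using iid_bm_coordinate[OF B, of i] that by (simp add: brownian_motion01_def)
  define X where "X p \<omega> = B (\<tau> (Suc (fst p))) \<omega> $ snd p - B (\<tau> (fst p)) \<omega> $ snd p" for p and \<omega>
  define Y where "Y i \<omega> = (\<lambda>t\<in>{0..1::real}. B t \<omega> $ i)" for i \<omega>
  have Xm: "X p \<in> borel_measurable N" if "fst p < k" for p
    unfolding X_def using that by (intro borel_measurable_diff bm \<tau>01) auto
  have iY: "indep_vars (\<lambda>_. PiM {0..1} (\<lambda>_. borel)) Y UNIV"
    using B unfolding iid_brownian_motions01_def Y_def by simp
  have iX: "indep_vars (\<lambda>_. borel) (\<lambda>j. X (j, i)) {..<k}" for i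
    using iid_bm_coordinate[OF B, of i] \<tau> unfolding brownian_motion01_def X_def by simp
  define F where "F p = {X p -` A \<inter> space N | A. A \<in> sets borel}" for p
  \<comment> \<open>For a finite index set it suffices to factor intersections over all indices, as
    each \<open>F p\<close> contains the whole space.\<close>
  have "indep_sets F ({..<k} \<times> UNIV)"
  proof (subst indep_sets_finite)
    show "{..<k} \<times> (UNIV :: 'd set) \<noteq> {}" using k by auto
    show "finite ({..<k} \<times> (UNIV :: 'd set))" by simp
    show "F p \<subseteq> events" if "p \<in> {..<k} \<times> UNIV" for p
      using that Xm[of p] unfolding F_def by (auto intro: measurable_sets)
    show "space N \<in> F p" if "p \<in> {..<k} \<times> UNIV" for p
      unfolding F_def by (auto intro!: exI[of _ UNIV])
    show "\<forall>A\<in>Pi ({..<k} \<times> UNIV) F. prob (\<Inter>p\<in>{..<k} \<times> UNIV. A p) = (\<Prod>p\<in>{..<k} \<times> UNIV. prob (A p))"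
    proof
      fix A assume A: "A \<in> Pi ({..<k} \<times> (UNIV::'d set)) F"
      then have "\<exists>S. \<forall>p\<in>{..<k} \<times> UNIV. S p \<in> sets borel \<and> A p = X p -` S p \<inter> space N"
        unfolding F_def Pi_iff by (intro bchoice) blast
      then obtain S where "\<forall>p\<in>{..<k} \<times> UNIV. S p \<in> sets borel \<and> A p = X p -` S p \<inter> space N" by blast
      then have S: "\<And>j i. j < k \<Longrightarrow> S (j, i) \<in> sets borel"
        "\<And>j i. j < k \<Longrightarrow> A (j, i) = X (j, i) -` S (j, i) \<inter> space N" by auto
      \<comment> \<open>The joint event of all increments of coordinate \<open>i\<close>, written on
        path space, where the independence of whole coordinate paths applies.\<close>
      define E where "E i = {x \<in> space (PiM {0..1::real} (\<lambda>_. borel :: real measure)).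
        \<forall>j\<in>{..<k}. x (\<tau> (Suc j)) - x (\<tau> j) \<in> S (j, i)}" for i
      have Em: "E i \<in> sets (PiM {0..1} (\<lambda>_. borel))" for i
        unfolding E_def
      proof (intro sets.sets_Collect_finite_All)
        fix j assume j: "j \<in> {..<k}"
        have m: "(\<lambda>x. x (\<tau> (Suc j)) - x (\<tau> j)) \<in> borel_measurable (PiM {0..1::real} (\<lambda>_. borel :: real measure))"
          using j by (intro borel_measurable_diff measurable_component_singleton \<tau>01) auto
        show "{x \<in> space (PiM {0..1::real} (\<lambda>_. borel :: real measure)). x (\<tau> (Suc j)) - x (\<tau> j) \<in> S (j, i)}
          \<in> sets (PiM {0..1} (\<lambda>_. borel))"
          using measurable_sets[OF m S(1)[of j i]] j by (simp add: vimage_def Int_def conj_commute)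
      qed simp
      have YE: "Y i -` E i \<inter> space N = (\<Inter>j\<in>{..<k}. A (j, i))" for i
      proof (intro set_eqI iffI)
        fix \<omega> assume "\<omega> \<in> Y i -` E i \<inter> space N"
        then show "\<omega> \<in> (\<Inter>j\<in>{..<k}. A (j, i))"
          using \<tau>01 by (auto simp: S(2) E_def Y_def X_def)
      next
        fix \<omega> assume w: "\<omega> \<in> (\<Inter>j\<in>{..<k}. A (j, i))"
        then have sp: "\<omega> \<in> space N" using k S(2)[of 0 i] by auto
        have "\<forall>j\<in>{..<k}. Y i \<omega> (\<tau> (Suc j)) - Y i \<omega> (\<tau> j) \<in> S (j, i)"
        proof
          fix j assume j: "j \<in> {..<k}"
          then have "\<omega> \<in> A (j, i)" using w by blast
          then show "Y i \<omega> (\<tau> (Suc j)) - Y i \<omega> (\<tau> j) \<in> S (j, i)"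
            using j \<tau>01[of j] \<tau>01[of "Suc j"] by (simp add: S(2) Y_def X_def)
        qed
        moreover have "Y i \<omega> \<in> space (PiM {0..1::real} (\<lambda>_. borel :: real measure))"
          by (simp add: Y_def space_PiM)
        ultimately show "\<omega> \<in> Y i -` E i \<inter> space N" using sp by (simp add: E_def)
      qed
      have "(\<Inter>p\<in>{..<k} \<times> UNIV. A p) = (\<Inter>i\<in>UNIV. Y i -` E i \<inter> space N)"
        unfolding YE by auto
      then have "prob (\<Inter>p\<in>{..<k} \<times> UNIV. A p) = prob (\<Inter>i\<in>UNIV. Y i -` E i \<inter> space N)" by simp
      also have "\<dots> = (\<Prod>i\<in>UNIV. prob (Y i -` E i \<inter> space N))"
        by (rule indep_varsD_finite[OF iY]) (use Em in auto)
      also have "\<dots> = (\<Prod>i\<in>UNIV. \<Prod>j\<in>{..<k}. prob (A (j, i)))"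
      proof (intro prod.cong refl)
        fix i :: 'd
        have "prob (\<Inter>j\<in>{..<k}. X (j, i) -` S (j, i) \<inter> space N) = (\<Prod>j\<in>{..<k}. prob (X (j, i) -` S (j, i) \<inter> space N))"
          by (rule indep_varsD_finite[OF iX]) (use k S in auto)
        then show "prob (Y i -` E i \<inter> space N) = (\<Prod>j\<in>{..<k}. prob (A (j, i)))"
          unfolding YE by (simp add: S(2))
      qed
      also have "\<dots> = (\<Prod>j\<in>{..<k}. \<Prod>i\<in>UNIV. prob (A (j, i)))" by (rule prod.swap)
      also have "\<dots> = (\<Prod>p\<in>{..<k} \<times> UNIV. prob (A p))" by (simp add: prod.cartesian_product)
      finally show "prob (\<Inter>p\<in>{..<k} \<times> UNIV. A p) = (\<Prod>p\<in>{..<k} \<times> UNIV. prob (A p))" .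
    qed
  qed
  then show ?thesis unfolding indep_vars_def2 F_def using Xm by (auto simp: X_def[abs_def])
qed

section \<open>Visits of Brownian motion to orthants\<close>

abbreviation std_normal :: "real measure" where
  "std_normal \<equiv> density lborel (\<lambda>x. ennreal (std_normal_density x))"

lemma prob_space_std_normal: "prob_space std_normal"
  by (rule prob_space_normal_density) simp

text \<open>The sign is absorbed by the symmetry of the normal law, so that all orthants can be
  treated alike.\<close>

lemma iid_bm_scaled_increment:
  fixes B :: "real \<Rightarrow> 'b \<Rightarrow> real ^ 'd"
  assumes N: "prob_space N" and B: "iid_brownian_motions01 N B"
    and st: "0 \<le> s" "s < t" "t \<le> 1" and \<epsilon>: "\<bar>\<epsilon>\<bar> = (1::real)" and S: "S \<in> sets borel"
  shows "measure N {\<omega> \<in> space N. \<epsilon> * (B t \<omega> $ i - B s \<omega> $ i) / sqrt (t - s) \<in> S} = measure std_normal S"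
proof -
  interpret prob_space N by fact
  have d: "distributed N lborel (\<lambda>\<omega>. B t \<omega> $ i - B s \<omega> $ i) (normal_density 0 (sqrt (t - s)))"
    using iid_bm_coordinate[OF B, of i] st unfolding brownian_motion01_def by blast
  have "distributed N lborel (\<lambda>\<omega>. 0 + (\<epsilon> / sqrt (t - s)) * (B t \<omega> $ i - B s \<omega> $ i))
      (normal_density (0 + (\<epsilon> / sqrt (t - s)) * 0) (\<bar>\<epsilon> / sqrt (t - s)\<bar> * sqrt (t - s)))"
    using st \<epsilon> by (intro normal_density_affine d) auto
  moreover have "\<bar>\<epsilon> / sqrt (t - s)\<bar> * sqrt (t - s) = 1" using st \<epsilon> by simp
  moreover have "0 + (\<epsilon> / sqrt (t - s)) * x = \<epsilon> * x / sqrt (t - s)" for x by simp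
  ultimately have "distributed N lborel (\<lambda>\<omega>. \<epsilon> * (B t \<omega> $ i - B s \<omega> $ i) / sqrt (t - s)) std_normal_density"
    by (simp only: mult_zero_right add_0_right)
  then have eq: "distr N lborel (\<lambda>\<omega>. \<epsilon> * (B t \<omega> $ i - B s \<omega> $ i) / sqrt (t - s)) = std_normal"
    and m: "(\<lambda>\<omega>. \<epsilon> * (B t \<omega> $ i - B s \<omega> $ i) / sqrt (t - s)) \<in> measurable N lborel"
    by (auto simp: distributed_def)
  have "measure std_normal S = measure N ((\<lambda>\<omega>. \<epsilon> * (B t \<omega> $ i - B s \<omega> $ i) / sqrt (t - s)) -` S \<inter> space N)"
    unfolding eq[symmetric] using S by (intro measure_distr m) simp
  then show ?thesis by (simp add: vimage_def Int_def conj_commute)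
qed

lemma std_normal_tail_pos: "0 < measure std_normal {1<..}"
proof -
  interpret S: prob_space std_normal by (rule prob_space_std_normal)
  have "measure std_normal {1<..} \<noteq> 0"
  proof
    assume "measure std_normal {1<..} = 0"
    then have "emeasure std_normal {1<..} = 0" by (simp add: S.emeasure_eq_measure)
    then have "(\<integral>\<^sup>+x. ennreal (std_normal_density x) * indicator {1<..} x \<partial>lborel) = 0"
      by (simp add: emeasure_density)
    then have "AE x in lborel. ennreal (std_normal_density x) * indicator {1<..} x = 0"
      by (subst (asm) nn_integral_0_iff_AE) auto
    then have "AE x in lborel. x \<notin> {1<..(2::real)}"
    proof (rule AE_mp, intro AE_I2 impI notI)
      fix x :: real assume "ennreal (std_normal_density x) * indicator {1<..} x = 0" "x \<in> {1<..2}"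
      moreover have "0 < std_normal_density x" by (rule normal_density_pos) simp
      ultimately show False by simp
    qed
    then have "emeasure lborel {x \<in> space lborel. \<not> x \<notin> {1<..(2::real)}} = 0"
      by (subst (asm) AE_iff_measurable[OF _ refl]) auto
    moreover have "{x \<in> space lborel. \<not> x \<notin> {1<..(2::real)}} = {1<..2}" by auto
    ultimately show False by (simp del: greaterThanAtMost_iff)
  qed
  then show ?thesis using measure_nonneg[of std_normal "{1<..}"] by linarith
qed

lemma std_normal_tail_tendsto_0: "(\<lambda>n. measure std_normal {x. real n \<le> \<bar>x\<bar>}) \<longlonglongrightarrow> 0"
proof -
  interpret S: prob_space std_normal by (rule prob_space_std_normal)
  have m: "{x. real n \<le> \<bar>x\<bar>} \<in> sets std_normal" for n
  proof -
    have "{x \<in> space borel. real n \<le> \<bar>x\<bar>} \<in> sets borel" by measurable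
    then show ?thesis by simp
  qed
  have "(\<lambda>n. measure std_normal {x. real n \<le> \<bar>x\<bar>}) \<longlonglongrightarrow> measure std_normal (\<Inter>n. {x. real n \<le> \<bar>x\<bar>})"
    by (rule S.finite_Lim_measure_decseq) (use m in \<open>auto simp: decseq_def\<close>)
  moreover have "(\<Inter>n. {x::real. real n \<le> \<bar>x\<bar>}) = {}"
    using reals_Archimedean2 by (auto simp: not_le set_eq_iff)
  ultimately show ?thesis by simp
qed


text \<open>Along the times \<open>c0 / (n\<^sup>2 + 1)\<^sup>l\<close>, \<open>l \<le> m\<close>, each increment beats the preceding value with
  probability tending to \<open>1\<close> as \<open>n\<close> grows, and the \<open>m\<close> independent increments all miss the
  orthant with probability \<open>(1 - q)\<^sup>m\<close>.\<close>

lemma iid_bm_orthant: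
  fixes B :: "real \<Rightarrow> 'b \<Rightarrow> real ^ 'd"
  assumes N: "prob_space N" and B: "iid_brownian_motions01 N B"
    and c: "0 < c" "c \<le> 1" and \<epsilon>: "\<And>i. \<bar>\<epsilon> i\<bar> = (1::real)"
  shows "AE \<omega> in N. \<exists>t\<in>{0<..<c}. \<forall>i. 0 < \<epsilon> i * B t \<omega> $ i"
proof -
  interpret prob_space N by fact
  define c0 where "c0 = c / 2"
  have c0: "0 < c0" "c0 < c" using c by (auto simp: c0_def)
  \<comment> \<open>Indexed by the ratio parameter and the exponent: a countable family of times,
    which makes \<open>bad\<close> measurable.\<close>
  define tm where "tm r = c0 / (real (fst r) ^ 2 + 1) ^ snd r" for r :: "nat \<times> nat"
  have tm: "0 < tm r" "tm r \<le> c0" for r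
  proof -
    have "1 \<le> (real (fst r) ^ 2 + 1) ^ snd r" by (intro one_le_power) simp
    then have "0 < (real (fst r) ^ 2 + 1) ^ snd r" by linarith
    then show "0 < tm r" unfolding tm_def using c0(1) by (intro divide_pos_pos)
    have "c0 * 1 \<le> c0 * (real (fst r) ^ 2 + 1) ^ snd r" using c0(1) \<open>1 \<le> _\<close> by (intro mult_left_mono) auto
    then show "tm r \<le> c0" unfolding tm_def using \<open>0 < (real (fst r) ^ 2 + 1) ^ snd r\<close> by (simp add: divide_le_eq)
  qed
  have tm01: "tm r \<in> {0..1}" for r using tm[of r] c0 c by auto
  have bm: "(\<lambda>\<omega>. B t \<omega> $ i) \<in> borel_measurable N" if "t \<in> {0..1}" for t i
    using iid_bm_coordinate[OF B, of i] that by (simp add: brownian_motion01_def)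
  have bm' [measurable]: "(\<lambda>\<omega>. B (tm r) \<omega> $ i) \<in> borel_measurable N" for r i using bm[OF tm01] .
  define bad where "bad = {\<omega> \<in> space N. \<forall>r. \<not> (\<forall>i. 0 < \<epsilon> i * B (tm r) \<omega> $ i)}"
  have bad_m: "bad \<in> events" unfolding bad_def by measurable
  define p where "p = measure std_normal {1<..}"
  define q where "q = p ^ CARD('d)"
  interpret S: prob_space std_normal by (rule prob_space_std_normal)
  have q: "0 < q" "q \<le> 1"
    using std_normal_tail_pos S.prob_le_1 by (auto simp: q_def p_def intro: power_le_one)
  define \<kappa> where "\<kappa> n = measure std_normal {x. real n \<le> \<bar>x\<bar>}" for n
  have bound: "prob bad \<le> (1 - q) ^ m + real m * (real CARD('d) * \<kappa> n)" if mn: "0 < m" "0 < n" for m n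
  proof -
    \<comment> \<open>Counting the exponent downwards makes the times increase.\<close>
    define \<tau> where "\<tau> j = tm (n, m - j)" for j
    have \<tau>_Suc: "\<tau> (Suc j) = \<tau> j * (real n ^ 2 + 1)" if "j < m" for j
    proof -
      have "m - j = Suc (m - Suc j)" using that by simp
      moreover have "real n ^ 2 + 1 \<noteq> 0" using zero_le_power2[of "real n"] by linarith
      ultimately show ?thesis by (simp add: \<tau>_def tm_def)
    qed
    have \<tau>0: "0 < \<tau> j" "\<tau> j \<in> {0..1}" for j using tm tm01 by (auto simp: \<tau>_def simp del: atLeastAtMost_iff)
    have diff: "\<tau> (Suc j) - \<tau> j = \<tau> j * real n ^ 2" if "j < m" for j
      using \<tau>_Suc[OF that] by (simp add: algebra_simps)
    have mono: "\<tau> j < \<tau> (Suc j)" if "j < m" for j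
      using diff[OF that] \<tau>0(1)[of j] mn by (smt (verit) mult_pos_pos of_nat_0_less_iff zero_less_power)
    \<comment> \<open>One standard deviation of the increment is \<open>n\<close> times the scale
      \<open>sqrt (\<tau> j)\<close> of the preceding value; this is why consecutive times have
      ratio n^2 + 1.\<close>
    have sq: "sqrt (\<tau> (Suc j) - \<tau> j) = real n * sqrt (\<tau> j)" if "j < m" for j
      using diff[OF that] by (simp add: real_sqrt_mult)
    have \<tau>: "0 \<le> \<tau> 0" "\<tau> m \<le> 1" "\<forall>j<m. \<tau> j < \<tau> (Suc j)"
      using \<tau>0(1)[of 0] \<tau>0(2)[of m] mono by auto
    define X where "X p \<omega> = B (\<tau> (Suc (fst p))) \<omega> $ snd p - B (\<tau> (fst p)) \<omega> $ snd p" for p :: "nat \<times> 'd" and \<omega>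
    have ind: "indep_vars (\<lambda>_. borel) X ({..<m} \<times> UNIV)"
      using iid_bm_increments_indep[OF N B mn(1) \<tau>] unfolding X_def[abs_def] .
    have Xm [measurable]: "X p \<in> borel_measurable N" for p
      unfolding X_def by (intro borel_measurable_diff bm \<tau>0)
    define A where "A j = {\<omega> \<in> space N. \<forall>i. \<epsilon> i * X (j, i) \<omega> / sqrt (\<tau> (Suc j) - \<tau> j) \<in> {1<..}}" for j
    have Am: "A j \<in> events" for j unfolding A_def by measurable
    have A_single: "prob {\<omega> \<in> space N. \<epsilon> i * X (j, i) \<omega> / sqrt (\<tau> (Suc j) - \<tau> j) \<in> {1<..}} = p" if "j < m" for i j
      unfolding p_def X_def fst_conv snd_conv
      by (rule iid_bm_scaled_increment[OF N B _ _ _ \<epsilon>]) (use \<tau>0[of j] \<tau>0[of "Suc j"] mono[OF that] in auto)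
    have prob_A: "prob (A j) = q" if j: "j < m" for j
    proof -
      define I where "I r = {x::real. \<epsilon> (snd r) * x / sqrt (\<tau> (Suc j) - \<tau> j) \<in> {1<..}}" for r :: "nat \<times> 'd"
      have Im: "I r \<in> sets borel" for r
      proof -
        have "{x \<in> space borel. \<epsilon> (snd r) * x / sqrt (\<tau> (Suc j) - \<tau> j) \<in> {1<..}} \<in> sets borel" by measurable
        then show ?thesis by (simp add: I_def)
      qed
      have ind': "indep_vars (\<lambda>_. borel) X ({j} \<times> UNIV)" by (rule indep_vars_subset[OF ind]) (use j in auto)
      have "prob (\<Inter>r\<in>{j} \<times> UNIV. X r -` I r \<inter> space N) = (\<Prod>r\<in>{j} \<times> UNIV. prob (X r -` I r \<inter> space N))"
        by (rule indep_varsD_finite[OF ind']) (use Im in auto)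
      also have "(\<Inter>r\<in>{j} \<times> UNIV. X r -` I r \<inter> space N) = A j" by (auto simp: A_def I_def)
      also have "(\<Prod>r\<in>{j} \<times> UNIV. prob (X r -` I r \<inter> space N)) = (\<Prod>r\<in>{j} \<times> (UNIV::'d set). p)"
      proof (intro prod.cong refl)
        fix r :: "nat \<times> 'd" assume "r \<in> {j} \<times> UNIV"
        then obtain i where r: "r = (j, i)" by auto
        have "X r -` I r \<inter> space N = {\<omega> \<in> space N. \<epsilon> i * X (j, i) \<omega> / sqrt (\<tau> (Suc j) - \<tau> j) \<in> {1<..}}"
          by (auto simp: I_def r)
        then show "prob (X r -` I r \<inter> space N) = p" using A_single[OF j] by simp
      qed
      finally show ?thesis by (simp add: q_def card_cartesian_product)
    qed
    define Y where "Y j \<omega> = restrict (\<lambda>r. X r \<omega>) ({j} \<times> (UNIV::'d set))" for j \<omega>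
    have indY: "indep_vars (\<lambda>j. PiM ({j} \<times> (UNIV::'d set)) (\<lambda>_. borel)) Y {..<m}"
      unfolding Y_def[abs_def] by (rule indep_vars_restrict[OF ind]) (auto simp: disjoint_family_on_def)
    define C where "C j = {x \<in> space (PiM ({j} \<times> (UNIV::'d set)) (\<lambda>_. borel :: real measure)).
        \<not> (\<forall>i. \<epsilon> i * x (j, i) / sqrt (\<tau> (Suc j) - \<tau> j) \<in> {1<..})}" for j
    have Cm: "C j \<in> sets (PiM ({j} \<times> (UNIV::'d set)) (\<lambda>_. borel))" for j
      unfolding C_def by measurable
    have YC: "Y j -` C j \<inter> space N = space N - A j" for j
      by (auto simp: Y_def C_def A_def space_PiM)
    have "prob (\<Inter>j\<in>{..<m}. Y j -` C j \<inter> space N) = (\<Prod>j\<in>{..<m}. prob (Y j -` C j \<inter> space N))"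
      by (rule indep_varsD_finite[OF indY]) (use mn Cm in auto)
    also have "\<dots> = (\<Prod>j\<in>{..<m}. 1 - q)"
      unfolding YC by (intro prod.cong refl) (use prob_compl[OF Am] prob_A in auto)
    finally have none: "prob (\<Inter>j\<in>{..<m}. space N - A j) = (1 - q) ^ m" unfolding YC by simp
    \<comment> \<open>The exceptional events that a preceding value reaches one standard deviation
      of the next increment. Outside all of them, an increment exceeding one standard deviation in
      each required sign carries the process itself into the orthant.\<close>
    define E where "E r = {\<omega> \<in> space N. real n * sqrt (\<tau> (fst r)) \<le> \<bar>B (\<tau> (fst r)) \<omega> $ snd r\<bar>}" for r :: "nat \<times> 'd"
    have Em: "E r \<in> events" for r
    proof -
      have [measurable]: "(\<lambda>\<omega>. B (\<tau> (fst r)) \<omega> $ snd r) \<in> borel_measurable N" by (rule bm[OF \<tau>0(2)])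
      show ?thesis unfolding E_def by measurable
    qed
    have prob_E: "prob (E r) = \<kappa> n" if "fst r < m" for r
    proof -
      have "{x \<in> space borel. real n \<le> \<bar>x\<bar>} \<in> sets borel" by measurable
      then have "prob {\<omega> \<in> space N. 1 * (B (\<tau> (fst r)) \<omega> $ snd r - B 0 \<omega> $ snd r) / sqrt (\<tau> (fst r) - 0) \<in> {x. real n \<le> \<bar>x\<bar>}} = \<kappa> n"
        unfolding \<kappa>_def using \<tau>0[of "fst r"] by (intro iid_bm_scaled_increment[OF N B]) auto
      also have "{\<omega> \<in> space N. 1 * (B (\<tau> (fst r)) \<omega> $ snd r - B 0 \<omega> $ snd r) / sqrt (\<tau> (fst r) - 0) \<in> {x. real n \<le> \<bar>x\<bar>}} = E r"
        using iid_bm_path(1)[OF B] \<tau>0(1)[of "fst r"] by (auto simp: E_def field_simps)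
      finally show ?thesis .
    qed
    have sub: "bad \<subseteq> (\<Inter>j\<in>{..<m}. space N - A j) \<union> (\<Union>r\<in>{..<m} \<times> UNIV. E r)"
    proof
      fix \<omega> assume w: "\<omega> \<in> bad"
      then have sp: "\<omega> \<in> space N" by (simp add: bad_def)
      show "\<omega> \<in> (\<Inter>j\<in>{..<m}. space N - A j) \<union> (\<Union>r\<in>{..<m} \<times> UNIV. E r)"
      proof (rule ccontr)
        assume no: "\<not> ?thesis"
        then have "\<not> (\<forall>j\<in>{..<m}. \<omega> \<in> space N - A j)" by blast
        then obtain j where j: "j < m" "\<omega> \<in> A j" using sp by blast
        have "0 < \<epsilon> i * B (\<tau> (Suc j)) \<omega> $ i" for i
        proof -
          have "\<omega> \<notin> E (j, i)" using no j by auto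
          then have 1: "\<bar>B (\<tau> j) \<omega> $ i\<bar> < real n * sqrt (\<tau> j)" using sp by (simp add: E_def)
          have "1 < \<epsilon> i * X (j, i) \<omega> / sqrt (\<tau> (Suc j) - \<tau> j)" using j by (auto simp: A_def)
          then have "real n * sqrt (\<tau> j) < \<epsilon> i * X (j, i) \<omega>"
            unfolding sq[OF j(1)] using mn \<tau>0(1)[of j] by (simp add: field_simps)
          moreover have "\<bar>\<epsilon> i * B (\<tau> j) \<omega> $ i\<bar> = \<bar>B (\<tau> j) \<omega> $ i\<bar>" using \<epsilon> by (simp add: abs_mult)
          moreover have "\<epsilon> i * B (\<tau> (Suc j)) \<omega> $ i = \<epsilon> i * B (\<tau> j) \<omega> $ i + \<epsilon> i * X (j, i) \<omega>"
            by (simp add: X_def algebra_simps)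
          ultimately show ?thesis using 1 by linarith
        qed
        then show False using w unfolding bad_def \<tau>_def by blast
      qed
    qed
    have "prob bad \<le> prob ((\<Inter>j\<in>{..<m}. space N - A j) \<union> (\<Union>r\<in>{..<m} \<times> UNIV. E r))"
      using sub Am Em mn by (intro finite_measure_mono sets.Un sets.finite_INT sets.finite_UN) auto
    also have "\<dots> \<le> prob (\<Inter>j\<in>{..<m}. space N - A j) + prob (\<Union>r\<in>{..<m} \<times> UNIV. E r)"
      using Am Em mn by (intro measure_Un_le sets.finite_INT sets.finite_UN) auto
    also have "prob (\<Union>r\<in>{..<m} \<times> UNIV. E r) \<le> (\<Sum>r\<in>{..<m} \<times> UNIV. prob (E r))"
      using Em by (intro finite_measure_subadditive_finite) auto
    also have "(\<Sum>r\<in>{..<m} \<times> (UNIV::'d set). prob (E r)) = (\<Sum>r\<in>{..<m} \<times> (UNIV::'d set). \<kappa> n)"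
      using prob_E by (intro sum.cong) auto
    also have "\<dots> = real m * (real CARD('d) * \<kappa> n)" by (simp add: card_cartesian_product)
    finally show ?thesis using none by simp
  qed
  \<comment> \<open>First \<open>n\<close> grows, which removes the exceptional events, and
    afterwards the number \<open>m\<close> of independent trials.\<close>
  have bound2: "prob bad \<le> (1 - q) ^ m" if m: "0 < m" for m
  proof (rule LIMSEQ_le_const)
    have "(\<lambda>n. (1 - q) ^ m + real m * (real CARD('d) * \<kappa> n)) \<longlonglongrightarrow> (1 - q) ^ m + real m * (real CARD('d) * 0)"
      unfolding \<kappa>_def by (intro tendsto_intros std_normal_tail_tendsto_0)
    then show "(\<lambda>n. (1 - q) ^ m + real m * (real CARD('d) * \<kappa> n)) \<longlonglongrightarrow> (1 - q) ^ m" by simp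
    show "\<exists>N. \<forall>n\<ge>N. prob bad \<le> (1 - q) ^ m + real m * (real CARD('d) * \<kappa> n)"
      using bound[OF m] by (intro exI[of _ 1]) auto
  qed
  have "prob bad \<le> 0"
  proof (rule LIMSEQ_le_const)
    show "(\<lambda>m. (1 - q) ^ m) \<longlonglongrightarrow> 0" using q by (intro LIMSEQ_power_zero) auto
    show "\<exists>N. \<forall>n\<ge>N. prob bad \<le> (1 - q) ^ n" using bound2 by (intro exI[of _ 1]) auto
  qed
  then have "bad \<in> null_sets N" using bad_m by (simp add: emeasure_eq_measure measure_le_0_iff null_sets_def)
  then show ?thesis
  proof (rule AE_I')
    show "{\<omega> \<in> space N. \<not> (\<exists>t\<in>{0<..<c}. \<forall>i. 0 < \<epsilon> i * B t \<omega> $ i)} \<subseteq> bad"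
    proof safe
      fix \<omega> assume w: "\<omega> \<in> space N" "\<not> (\<exists>t\<in>{0<..<c}. \<forall>i. 0 < \<epsilon> i * B t \<omega> $ i)"
      have "tm r \<in> {0<..<c}" for r using tm[of r] c0(2) by auto
      then show "\<omega> \<in> bad" using w unfolding bad_def by blast
    qed
  qed
qed

text \<open>In the orthant whose signs oppose those of \<open>u\<close>, all terms of the inner
  product are nonpositive and one is negative. There are finitely many orthants, so a single null
  set serves all \<open>u\<close>.\<close>

lemma iid_bm_two_sided:
  fixes B :: "real \<Rightarrow> 'b \<Rightarrow> real ^ 'd"
  assumes N: "prob_space N" and B: "iid_brownian_motions01 N B" and c: "0 < c" "c \<le> 1"
  shows "AE \<omega> in N. \<forall>u. u \<noteq> 0 \<longrightarrow> (\<exists>t\<in>{0<..<c}. u \<bullet> B t \<omega> < 0)"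
proof -
  define sg where "sg b = (if b then 1 else - 1 :: real)" for b
  have "AE \<omega> in N. \<forall>b :: 'd \<Rightarrow> bool. \<exists>t\<in>{0<..<c}. \<forall>i. 0 < sg (b i) * B t \<omega> $ i"
    unfolding AE_all_countable by (intro allI iid_bm_orthant[OF N B c]) (simp add: sg_def)
  then show ?thesis
  proof (rule AE_mp, intro AE_I2 impI allI)
    fix \<omega> and u :: "real ^ 'd"
    assume all: "\<forall>b :: 'd \<Rightarrow> bool. \<exists>t\<in>{0<..<c}. \<forall>i. 0 < sg (b i) * B t \<omega> $ i" and u: "u \<noteq> 0"
    from spec[OF all, of "\<lambda>i. u $ i < 0"] obtain t
      where t: "t \<in> {0<..<c}" "\<And>i. 0 < sg (u $ i < 0) * B t \<omega> $ i" by blast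
    have le: "u $ i * B t \<omega> $ i \<le> 0" for i
      using t(2)[of i] by (auto simp: sg_def mult_le_0_iff split: if_splits)
    obtain i where i: "u $ i \<noteq> 0" using u by (auto simp: vec_eq_iff)
    have lt: "u $ i * B t \<omega> $ i < 0"
      using t(2)[of i] i by (auto simp: sg_def mult_less_0_iff split: if_splits)
    have "(\<Sum>i\<in>UNIV. u $ i * B t \<omega> $ i) < (\<Sum>i\<in>(UNIV::'d set). 0)"
      by (rule sum_strict_mono_ex1) (use le lt in auto)
    then have "u \<bullet> B t \<omega> < 0" by (simp add: inner_vec_def)
    then show "\<exists>t\<in>{0<..<c}. u \<bullet> B t \<omega> < 0" using t(1) by blast
  qed
qed


section \<open>Rotation invariance of Gaussian vectors\<close>

text \<open>A copy of a finite type carrying an arbitrary well-order: the library proves that orthogonal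
  maps preserve Lebesgue measure only for well-ordered index types.\<close>

typedef 'a wo = "UNIV :: 'a set" morphisms rep_wo abs_wo by simp

lemma bij_rep_wo: "bij rep_wo"
  by (metis UNIV_I abs_wo_inverse bijI' rep_wo_inject)

instance wo :: (finite) finite
proof
  have "finite (range (abs_wo :: 'a \<Rightarrow> 'a wo))" by simp
  then show "finite (UNIV :: 'a wo set)" by (metis rep_wo_inverse finite_subset rangeI subsetI)
qed

definition wo_index :: "('a::finite) wo \<Rightarrow> nat" where
  "wo_index = (SOME g. inj g)"

lemma inj_wo_index: "inj (wo_index :: ('a::finite) wo \<Rightarrow> nat)"
proof -
  have "\<exists>g :: 'a wo \<Rightarrow> nat. inj g"
    using finite_imp_inj_to_nat_seg[of "UNIV :: 'a wo set"] by auto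
  then show ?thesis unfolding wo_index_def by (rule someI_ex)
qed

instantiation wo :: (finite) wellorder
begin

definition less_eq_wo :: "'a wo \<Rightarrow> 'a wo \<Rightarrow> bool" where "x \<le> y \<longleftrightarrow> wo_index x \<le> wo_index y"
definition less_wo :: "'a wo \<Rightarrow> 'a wo \<Rightarrow> bool" where "x < y \<longleftrightarrow> wo_index x < wo_index y"

instance
proof
  fix P :: "'a wo \<Rightarrow> bool" and a
  assume step: "\<And>x. (\<And>y. y < x \<Longrightarrow> P y) \<Longrightarrow> P x"
  show "P a" by (induction a rule: measure_induct_rule[of wo_index]) (auto intro: step simp: less_wo_def)
qed (auto simp: less_eq_wo_def less_wo_def dest: injD[OF inj_wo_index])

end

section \<open>Gaussian vectors under orthonormal maps\<close>

abbreviation normal_measure :: "real \<Rightarrow> real measure" where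
  "normal_measure \<sigma> \<equiv> density lborel (\<lambda>x. ennreal (normal_density 0 \<sigma> x))"

text \<open>Encoded as the image of a product measure, because independence delivers joint laws in
  that form.\<close>

definition gauss_vec :: "real \<Rightarrow> (real ^ 'n::finite) measure" where
  "gauss_vec \<sigma> = distr (PiM UNIV (\<lambda>_. normal_measure \<sigma>)) borel (\<lambda>f. \<chi> i. f i)"

lemma sets_gauss_vec [simp]: "sets (gauss_vec \<sigma>) = sets borel"
  by (simp add: gauss_vec_def)

lemma measurable_vec_lambda:
  fixes F :: "'a \<Rightarrow> 'n::finite \<Rightarrow> real"
  assumes "\<And>i. (\<lambda>x. F x i) \<in> borel_measurable M"
  shows "(\<lambda>x. \<chi> i. F x i) \<in> borel_measurable M"
  using assms by (subst borel_measurable_euclidean_space) (auto simp: Basis_vec_def inner_axis)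

lemma measurable_vec_nth: "(\<lambda>x :: real ^ 'n. x $ i) \<in> borel_measurable borel"
  by (intro borel_measurable_continuous_onI continuous_intros)

lemma measurable_vec_of_PiM: "(\<lambda>f. \<chi> i. f i) \<in> measurable (PiM UNIV (\<lambda>_. normal_measure \<sigma>)) borel"
  by (rule measurable_vec_lambda) measurable

text \<open>The density is the form on which rotations act visibly. The two measures agree on
  measurable rectangles, where the Lebesgue integral factorises.\<close>

lemma gauss_vec_density:
  fixes \<sigma> :: real
  assumes \<sigma>: "0 < \<sigma>"
  shows "gauss_vec \<sigma> = density lborel (\<lambda>x :: real ^ 'n. \<Prod>i\<in>UNIV. ennreal (normal_density 0 \<sigma> (x $ i)))"
proof -
  let ?nd = "\<lambda>x. ennreal (normal_density 0 \<sigma> x)"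
  let ?M = "\<lambda>_ :: 'n. normal_measure \<sigma>"
  let ?G = "density lborel (\<lambda>x :: real ^ 'n. \<Prod>i\<in>UNIV. ?nd (x $ i))"
  note [measurable] = measurable_vec_nth
  interpret nm: prob_space "normal_measure \<sigma>" by (rule prob_space_normal_density[OF \<sigma>])
  interpret product_sigma_finite ?M by standard
  have tm: "(\<lambda>x :: real ^ 'n. \<lambda>i\<in>UNIV. x $ i) \<in> measurable ?G (PiM UNIV ?M)"
    by (rule measurable_restrict) simp
  have "distr ?G (PiM UNIV ?M) (\<lambda>x. \<lambda>i\<in>UNIV. x $ i) = PiM UNIV ?M"
  proof (rule PiM_eqI)
    fix A :: "'n \<Rightarrow> real set" assume "\<And>i. i \<in> UNIV \<Longrightarrow> A i \<in> sets (normal_measure \<sigma>)"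
    then have A [measurable]: "A i \<in> sets borel" for i by simp
    define ax :: "'n \<Rightarrow> real ^ 'n" where "ax i = axis i 1" for i
    have inj: "inj ax" by (auto simp: ax_def inj_on_def axis_eq_axis)
    have Basis: "(Basis :: (real ^ 'n) set) = range ax" by (auto simp: Basis_vec_def ax_def)
    have inv_ax: "inv ax (ax i) = i" "x \<bullet> ax i = x $ i" for i x
      using inj by (simp, simp add: ax_def inner_axis)
    \<comment> \<open>Lebesgue integrals factorise over \<open>Basis\<close>, so the factors are
      indexed by basis vectors; \<open>inv ax\<close> recovers the coordinate.\<close>
    define F where "F b y = ?nd y * indicator (A (inv ax b)) y" for b y
    have Pi_set: "Pi\<^sub>E UNIV A \<in> sets (PiM UNIV ?M)" by (rule sets_PiM_I_finite) auto
    have "emeasure (distr ?G (PiM UNIV ?M) (\<lambda>x. \<lambda>i\<in>UNIV. x $ i)) (Pi\<^sub>E UNIV A)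
      = emeasure ?G ((\<lambda>x. \<lambda>i\<in>UNIV. x $ i) -` Pi\<^sub>E UNIV A \<inter> space ?G)"
      by (rule emeasure_distr[OF tm Pi_set])
    also have "\<dots> = (\<integral>\<^sup>+x. (\<Prod>i\<in>UNIV. ?nd (x $ i)) * indicator ((\<lambda>x. \<lambda>i\<in>UNIV. x $ i) -` Pi\<^sub>E UNIV A \<inter> space ?G) x \<partial>lborel)"
      using measurable_sets[OF tm Pi_set] by (intro emeasure_density) auto
    also have "\<dots> = (\<integral>\<^sup>+x. (\<Prod>b\<in>Basis. F b (x \<bullet> b)) \<partial>lborel)"
    proof (intro nn_integral_cong)
      fix x :: "real ^ 'n"
      have ind: "indicator ((\<lambda>x. \<lambda>i\<in>UNIV. x $ i) -` Pi\<^sub>E UNIV A \<inter> space ?G) x = (\<Prod>i\<in>UNIV. indicator (A i) (x $ i) :: ennreal)"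
        by (auto simp: indicator_def PiE_iff)
      show "(\<Prod>i\<in>UNIV. ?nd (x $ i)) * indicator ((\<lambda>x. \<lambda>i\<in>UNIV. x $ i) -` Pi\<^sub>E UNIV A \<inter> space ?G) x
          = (\<Prod>b\<in>Basis. F b (x \<bullet> b))"
        unfolding ind Basis prod.reindex[OF inj] prod.distrib[symmetric]
        by (simp add: F_def inv_ax)
    qed
    also have "\<dots> = (\<Prod>b\<in>Basis. \<integral>\<^sup>+y. F b y \<partial>lborel)"
      by (rule nn_integral_lborel_prod) (auto simp: F_def)
    also have "\<dots> = (\<Prod>i\<in>UNIV. emeasure (normal_measure \<sigma>) (A i))"
      unfolding Basis prod.reindex[OF inj] by (simp add: F_def[abs_def] inv_ax emeasure_density)
    finally show "emeasure (distr ?G (PiM UNIV ?M) (\<lambda>x. \<lambda>i\<in>UNIV. x $ i)) (Pi\<^sub>E UNIV A)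
      = (\<Prod>i\<in>UNIV. emeasure (normal_measure \<sigma>) (A i))" .
  qed auto
  then have "gauss_vec \<sigma> = distr (distr ?G (PiM UNIV ?M) (\<lambda>x. \<lambda>i\<in>UNIV. x $ i)) borel (\<lambda>f. \<chi> i. f i)"
    by (simp add: gauss_vec_def)
  also have "\<dots> = distr ?G borel ((\<lambda>f. \<chi> i. f i) \<circ> (\<lambda>x. \<lambda>i\<in>UNIV. x $ i))"
    by (rule distr_distr[OF measurable_vec_of_PiM tm])
  also have "(\<lambda>f. \<chi> i. f i) \<circ> (\<lambda>x :: real ^ 'n. \<lambda>i\<in>UNIV. x $ i) = (\<lambda>x. x)" by (auto simp: fun_eq_iff vec_eq_iff)
  also have "distr ?G borel (\<lambda>x. x) = ?G" by (rule distr_id2) simp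
  finally show ?thesis .
qed

text \<open>Lebesgue measure is determined by its values on boxes; the preimage of a box is its
  image under the inverse map, which preserves volume.\<close>

lemma lborel_orthogonal_invariant:
  fixes T :: "real ^ 'n::{finite,wellorder} \<Rightarrow> real ^ 'n::_"
  assumes T: "orthogonal_transformation T"
  shows "distr lborel borel T = lborel"
proof (rule lborel_eqI[symmetric])
  have Tm: "T \<in> borel_measurable lborel"
    using orthogonal_transformation_linear[OF T]
    by (simp add: borel_measurable_continuous_onI linear_continuous_on linear_linear)
  fix l u :: "real ^ 'n::_" assume "\<And>b. b \<in> Basis \<Longrightarrow> l \<bullet> b \<le> u \<bullet> b"
  have img: "T -` box l u = inv T ` box l u"
    using orthogonal_transformation_bij[OF T] by (rule bij_vimage_eq_inv_image)
  have Ti: "orthogonal_transformation (inv T)" using T by (rule orthogonal_transformation_inv)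
  have lm: "inv T ` box l u \<in> lmeasurable" by (rule measurable_orthogonal_image[OF Ti]) simp
  have bor: "T -` box l u \<in> sets borel"
    using measurable_sets[OF Tm, of "box l u"] by simp
  have "emeasure (distr lborel borel T) (box l u) = emeasure lborel (T -` box l u)"
    using Tm by (simp add: emeasure_distr)
  also have "\<dots> = emeasure lebesgue (inv T ` box l u)" unfolding img[symmetric] using bor by simp
  also have "\<dots> = ennreal (measure lebesgue (inv T ` box l u))" by (rule emeasure_eq_measure2[OF lm])
  also have "\<dots> = ennreal (measure lebesgue (box l u))" by (simp add: measure_orthogonal_image[OF Ti])
  also have "\<dots> = emeasure lborel (box l u)" by (simp add: emeasure_eq_measure2[symmetric])
  also have "\<dots> = (\<Prod>b\<in>Basis. (u - l) \<bullet> b)"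
    using \<open>\<And>b. b \<in> Basis \<Longrightarrow> l \<bullet> b \<le> u \<bullet> b\<close> by simp
  finally show "emeasure (distr lborel borel T) (box l u) = (\<Prod>b\<in>Basis. (u - l) \<bullet> b)" .
qed simp

text \<open>The density depends on the norm only, and the reference measure is invariant.\<close>

lemma gauss_vec_orthogonal_invariant:
  fixes T :: "real ^ 'n::{finite,wellorder} \<Rightarrow> real ^ 'n::_"
  assumes T: "orthogonal_transformation T" and \<sigma>: "0 < \<sigma>"
  shows "distr (gauss_vec \<sigma>) borel T = gauss_vec \<sigma>"
proof -
  define h :: "real ^ 'n::_ \<Rightarrow> ennreal" where "h x = (\<Prod>i\<in>UNIV. ennreal (normal_density 0 \<sigma> (x $ i)))" for x
  have h_norm: "h x = ennreal ((1 / sqrt (2 * pi * \<sigma>\<^sup>2)) ^ CARD('n) * exp (- (norm x)\<^sup>2 / (2 * \<sigma>\<^sup>2)))" for x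
  proof -
    have "(norm x)\<^sup>2 = (\<Sum>i\<in>UNIV. (x $ i)\<^sup>2)"
      by (simp only: power2_norm_eq_inner inner_vec_def) (simp add: power2_eq_square)
    then have "(\<Prod>i\<in>UNIV. normal_density 0 \<sigma> (x $ i)) = (1 / sqrt (2 * pi * \<sigma>\<^sup>2)) ^ CARD('n) * exp (- (norm x)\<^sup>2 / (2 * \<sigma>\<^sup>2))"
      by (simp add: normal_density_def prod.distrib exp_sum[symmetric] sum_divide_distrib sum_negf power_one_over prod_dividef)
    then show ?thesis unfolding h_def by (simp add: prod_ennreal)
  qed
  note [measurable] = measurable_vec_nth
  have hm: "h \<in> borel_measurable borel" unfolding h_def[abs_def] by measurable
  have Tm: "T \<in> borel_measurable lborel"
    using orthogonal_transformation_linear[OF T]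
    by (simp add: borel_measurable_continuous_onI linear_continuous_on linear_linear)
  have "(\<lambda>x. h (T x)) = h" unfolding h_norm using orthogonal_transformation_norm[OF T] by simp
  then have "distr (density lborel h) borel T = density (distr lborel borel T) h"
    using density_distr[OF hm Tm] by simp
  then show ?thesis unfolding gauss_vec_density[OF \<sigma>] lborel_orthogonal_invariant[OF T] h_def[symmetric] by simp
qed

text \<open>Serves both to discard coordinates and, for bijective \<open>\<rho>\<close>, to relabel
  them.\<close>

lemma gauss_vec_marginal:
  fixes \<rho> :: "'m::finite \<Rightarrow> 'n::finite"
  assumes "inj \<rho>" and \<sigma>: "0 < \<sigma>"
  shows "distr (gauss_vec \<sigma>) borel (\<lambda>x :: real ^ 'n. \<chi> i. x $ \<rho> i) = gauss_vec \<sigma>"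
proof -
  let ?M = "\<lambda>_. normal_measure \<sigma>"
  note [measurable] = measurable_vec_nth
  have P: "distr (PiM UNIV ?M) (PiM UNIV ?M) (\<lambda>\<omega>. \<lambda>n\<in>UNIV. \<omega> (\<rho> n)) = PiM UNIV ?M"
    using assms(1) by (intro distr_PiM_reindex prob_space_normal_density[OF \<sigma>]) auto
  have m: "(\<lambda>\<omega>. \<lambda>n\<in>UNIV. \<omega> (\<rho> n)) \<in> measurable (PiM UNIV ?M) (PiM UNIV ?M)"
    by (rule measurable_restrict) measurable
  have m2: "(\<lambda>x :: real ^ 'n. \<chi> i. x $ \<rho> i) \<in> measurable borel borel"
    by (rule measurable_vec_lambda) measurable
  have "distr (gauss_vec \<sigma>) borel (\<lambda>x :: real ^ 'n. \<chi> i. x $ \<rho> i)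
    = distr (PiM UNIV ?M) borel ((\<lambda>x :: real ^ 'n. \<chi> i. x $ \<rho> i) \<circ> (\<lambda>f. \<chi> i. f i))"
    unfolding gauss_vec_def by (rule distr_distr[OF m2 measurable_vec_of_PiM])
  also have "(\<lambda>x :: real ^ 'n. \<chi> i. x $ \<rho> i) \<circ> (\<lambda>f. \<chi> i. f i) = (\<lambda>f. \<chi> i. f i) \<circ> (\<lambda>\<omega>. \<lambda>n\<in>UNIV. \<omega> (\<rho> n))"
    by (auto simp: fun_eq_iff)
  also have "distr (PiM UNIV ?M) borel ((\<lambda>f. \<chi> i. f i) \<circ> (\<lambda>\<omega>. \<lambda>n\<in>UNIV. \<omega> (\<rho> n)))
    = distr (distr (PiM UNIV ?M) (PiM UNIV ?M) (\<lambda>\<omega>. \<lambda>n\<in>UNIV. \<omega> (\<rho> n))) borel (\<lambda>f. \<chi> i. f i)"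
    by (rule distr_distr[OF measurable_vec_of_PiM m, symmetric])
  also have "\<dots> = gauss_vec \<sigma>" unfolding P by (simp add: gauss_vec_def)
  finally show ?thesis .
qed

definition orthonormal_family :: "('p \<Rightarrow> 'a::euclidean_space) \<Rightarrow> bool" where
  "orthonormal_family b \<longleftrightarrow> (\<forall>i j. b i \<bullet> b j = (if i = j then 1 else 0))"

text \<open>An orthonormal basis of the orthogonal complement fills the index positions outside the
  range of \<open>\<iota>\<close>, so that the vectors \<open>b i\<close> become rows of an
  orthogonal matrix.\<close>

lemma orthonormal_family_extends:
  fixes b :: "'p::finite \<Rightarrow> real ^ 'n"
  assumes b: "orthonormal_family b"
  obtains R :: "real ^ 'n ^ 'n" and \<iota> :: "'p \<Rightarrow> 'n"
  where "inj \<iota>" "orthogonal_transformation ((*v) R)" "\<And>i x. (R *v x) $ \<iota> i = b i \<bullet> x"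
proof -
  have bb: "b i \<bullet> b j = (if i = j then 1 else 0)" for i j using b by (simp add: orthonormal_family_def)
  have inj: "inj b" by (rule injI) (metis bb zero_neq_one)
  have "pairwise orthogonal (range b)" by (auto simp: pairwise_def orthogonal_def bb)
  moreover have "0 \<notin> range b" by (metis bb imageE inner_zero_left zero_neq_one)
  ultimately have indep: "independent (range b)" by (rule pairwise_orthogonal_independent)
  define S where "S = span (range b)"
  have dimS: "dim S = CARD('p)" unfolding S_def using indep inj by (simp add: dim_eq_card_independent card_image)
  define S' where "S' = {y \<in> UNIV. \<forall>x\<in>S. orthogonal x y}"
  have dimS': "dim S' + CARD('p) = CARD('n)"
    using dim_subspace_orthogonal_to_vectors[of S UNIV] unfolding S'_def dimS by (simp add: S_def)
  have subS': "subspace S'"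
    unfolding S'_def by (auto simp: subspace_def orthogonal_def inner_add_right)
  obtain C where C: "C \<subseteq> S'" "pairwise orthogonal C" "\<And>x. x \<in> C \<Longrightarrow> norm x = 1" "independent C" "card C = dim S'"
    using orthonormal_basis_subspace[OF subS'] by metis
  have finC: "finite C" using C(4) by (rule independent_imp_finite)
  have "CARD('p) \<le> CARD('n)" using dimS' by simp
  then obtain \<iota> :: "'p \<Rightarrow> 'n" where \<iota>: "inj \<iota>"
    using card_le_inj[of "UNIV :: 'p set" "UNIV :: 'n set"] by auto
  have "card (UNIV - range \<iota>) = card C"
    using \<iota> dimS' by (simp add: card_Diff_subset card_image C(5))
  then obtain g where g: "bij_betw g (UNIV - range \<iota>) C"
    using finC by (metis finite_same_card_bij finite)
  define r where "r j = (if j \<in> range \<iota> then b (inv \<iota> j) else g j)" for j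
  have r_\<iota>: "r (\<iota> i) = b i" for i using \<iota> by (simp add: r_def)
  have gC: "g j \<in> C" if "j \<notin> range \<iota>" for j using g that by (auto simp: bij_betw_def)
  have bS: "b i \<in> S" for i by (simp add: S_def span_base)
  have b_g: "b i \<bullet> g j = 0" if "j \<notin> range \<iota>" for i j
    using gC[OF that] C(1) bS[of i] by (auto simp: S'_def orthogonal_def)
  have rr: "r i \<bullet> r j = (if i = j then 1 else 0)" for i j
  proof (cases "i \<in> range \<iota>")
    case True
    then obtain a where a: "i = \<iota> a" by auto
    show ?thesis
    proof (cases "j \<in> range \<iota>")
      case True
      then obtain a' where "j = \<iota> a'" by auto
      then show ?thesis using \<iota> by (simp add: a r_\<iota> bb inj_eq)
    next
      case False
      then show ?thesis using b_g[OF False] True by (auto simp: a r_\<iota>) (simp add: r_def)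
    qed
  next
    case i: False
    show ?thesis
    proof (cases "j \<in> range \<iota>")
      case True
      then obtain a' where "j = \<iota> a'" by auto
      moreover have "r i = g i" using i by (simp add: r_def)
      ultimately show ?thesis using b_g[OF i, of a'] i by (auto simp: r_\<iota> inner_commute)
    next
      case j: False
      show ?thesis
      proof (cases "i = j")
        case True
        then show ?thesis using C(3)[OF gC[OF i]] i by (simp add: r_def dot_square_norm)
      next
        case False
        then have "g i \<noteq> g j" using g i j by (auto simp: bij_betw_def inj_on_def)
        then have "orthogonal (g i) (g j)" using C(2) gC[OF i] gC[OF j] by (auto simp: pairwise_def)
        then show ?thesis using False i j by (simp add: r_def orthogonal_def)
      qed
    qed
  qed
  define R :: "real ^ 'n ^ 'n" where "R = (\<chi> j. r j)"
  have row: "row j R = r j" for j by (simp add: R_def row_def vec_eq_iff)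
  have "orthogonal_matrix R"
    unfolding orthogonal_matrix_orthonormal_rows row by (simp add: norm_eq_1 orthogonal_def rr)
  then have "orthogonal_transformation ((*v) R)"
    by (simp add: orthogonal_transformation_matrix)
  moreover have "(R *v x) $ \<iota> i = b i \<bullet> x" for i x
    using row[of "\<iota> i"] by (simp add: matrix_vector_mul_component r_\<iota> R_def)
  ultimately show thesis using that \<iota> by blast
qed

text \<open>Relabelling, rotation by the completed matrix and restriction to the positions of
  \<open>\<iota>\<close> each preserve the law.\<close>

lemma gauss_vec_orthonormal_image:
  fixes b :: "'p::finite \<Rightarrow> real ^ ('d::finite) wo"
  assumes b: "orthonormal_family b" and \<sigma>: "0 < \<sigma>"
  shows "distr (gauss_vec \<sigma> :: (real ^ 'd) measure) borel (\<lambda>x. \<chi> i. b i \<bullet> (\<chi> j. x $ rep_wo j)) = gauss_vec \<sigma>"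
proof -
  obtain R :: "real ^ 'd wo ^ 'd wo" and \<iota> :: "'p \<Rightarrow> 'd wo"
    where R: "inj \<iota>" "orthogonal_transformation ((*v) R)" "\<And>i x. (R *v x) $ \<iota> i = b i \<bullet> x"
    using orthonormal_family_extends[OF b] by metis
  note [measurable] = measurable_vec_nth
  define r1 :: "real ^ 'd \<Rightarrow> real ^ 'd wo" where "r1 x = (\<chi> j. x $ rep_wo j)" for x
  define r3 :: "real ^ 'd wo \<Rightarrow> real ^ 'p" where "r3 x = (\<chi> i. x $ \<iota> i)" for x
  have m1: "r1 \<in> measurable borel borel" unfolding r1_def[abs_def] by (rule measurable_vec_lambda) measurable
  have m3: "r3 \<in> measurable borel borel" unfolding r3_def[abs_def] by (rule measurable_vec_lambda) measurable
  have m2: "(*v) R \<in> measurable borel borel"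
    by (intro borel_measurable_continuous_onI linear_continuous_on) (simp add: matrix_vector_mul_bounded_linear)
  have eq: "(\<lambda>x :: real ^ 'd. \<chi> i. b i \<bullet> (\<chi> j. x $ rep_wo j)) = r3 \<circ> ((*v) R \<circ> r1)"
    by (auto simp: fun_eq_iff r3_def r1_def R(3))
  have "distr (gauss_vec \<sigma> :: (real ^ 'd) measure) borel (r3 \<circ> ((*v) R \<circ> r1))
    = distr (distr (distr (gauss_vec \<sigma>) borel r1) borel ((*v) R)) borel r3"
  proof -
    have m1': "r1 \<in> measurable (gauss_vec \<sigma>) borel" using m1 by (simp cong: measurable_cong_sets)
    then have m21: "(*v) R \<circ> r1 \<in> measurable (gauss_vec \<sigma>) borel" using m2 by (rule measurable_comp)
    show ?thesis unfolding distr_distr[OF m2 m1'] distr_distr[OF m3 m21] ..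
  qed
  also have "distr (gauss_vec \<sigma>) borel r1 = gauss_vec \<sigma>"
    unfolding r1_def[abs_def] using bij_is_inj[OF bij_rep_wo] \<sigma> by (rule gauss_vec_marginal)
  also have "distr (gauss_vec \<sigma>) borel ((*v) R) = gauss_vec \<sigma>" by (rule gauss_vec_orthogonal_invariant[OF R(2) \<sigma>])
  also have "distr (gauss_vec \<sigma>) borel r3 = gauss_vec \<sigma>"
    unfolding r3_def[abs_def] using R(1) \<sigma> by (rule gauss_vec_marginal)
  finally show ?thesis unfolding eq .
qed


text \<open>Brownian motion in dimension p as seen by the product sigma-algebra, on which laws are
  compared and to which path continuity is invisible: start at 0 and independent centred Gaussian
  increments whose covariance is the time difference times the identity.\<close>

definition gauss_process :: "'b measure \<Rightarrow> (real \<Rightarrow> 'b \<Rightarrow> real ^ 'p::finite) \<Rightarrow> bool" where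
  "gauss_process N Z \<longleftrightarrow> (\<forall>t\<in>{0..1}. Z t \<in> borel_measurable N) \<and> (\<forall>\<omega>\<in>space N. Z 0 \<omega> = 0) \<and>
    (\<forall>k \<tau>. 0 < k \<longrightarrow> 0 \<le> \<tau> 0 \<longrightarrow> \<tau> k \<le> 1 \<longrightarrow> (\<forall>i<k. \<tau> i < \<tau> (Suc i)) \<longrightarrow>
      distr N (PiM {..<k} (\<lambda>_. borel)) (\<lambda>\<omega>. \<lambda>j\<in>{..<k}. Z (\<tau> (Suc j)) \<omega> - Z (\<tau> j) \<omega>)
        = PiM {..<k} (\<lambda>j. gauss_vec (sqrt (\<tau> (Suc j) - \<tau> j))))"

text \<open>Used with an orthonormal projection for \<open>B\<close> and with the identity for
  \<open>W\<close>. Linearity turns increments into increments, which stay independent under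
  \<open>T\<close>, and \<open>T_gauss\<close> fixes their laws.\<close>

lemma gauss_process_linear_image:
  fixes B :: "real \<Rightarrow> 'b \<Rightarrow> real ^ 'd" and T :: "real ^ 'd \<Rightarrow> real ^ 'p"
  assumes N: "prob_space N" and B: "iid_brownian_motions01 N B" and T: "linear T"
    and T_gauss: "\<And>\<sigma>. 0 < \<sigma> \<Longrightarrow> distr (gauss_vec \<sigma>) borel T = gauss_vec \<sigma>"
  shows "gauss_process N (\<lambda>t \<omega>. T (B t \<omega>))"
  unfolding gauss_process_def
proof (intro conjI ballI allI impI)
  interpret prob_space N by fact
  have Tm: "T \<in> measurable borel borel"
    using T by (simp add: borel_measurable_continuous_onI linear_continuous_on linear_linear)
  show "(\<lambda>\<omega>. T (B t \<omega>)) \<in> borel_measurable N" if "t \<in> {0..1}" for t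
    using Tm iid_bm_measurable[OF B that] by (rule measurable_compose[rotated])
  show "T (B 0 \<omega>) = 0" if "\<omega> \<in> space N" for \<omega>
    using iid_bm_path(1)[OF B that] T by (simp add: linear_0)
  fix k and \<tau> :: "nat \<Rightarrow> real"
  assume k: "0 < k" and \<tau>: "0 \<le> \<tau> 0" "\<tau> k \<le> 1" "\<forall>i<k. \<tau> i < \<tau> (Suc i)"
  have \<tau>01: "\<tau> j \<in> {0..1}" if "j \<le> k" for j using strict_mono_chain_bounds[OF \<tau> that] .
  define X where "X p \<omega> = B (\<tau> (Suc (fst p))) \<omega> $ snd p - B (\<tau> (fst p)) \<omega> $ snd p" for p :: "nat \<times> 'd" and \<omega>
  have ind: "indep_vars (\<lambda>_. borel) X ({..<k} \<times> UNIV)"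
    using iid_bm_increments_indep[OF N B k \<tau>] unfolding X_def[abs_def] .
  define D where "D j \<omega> = B (\<tau> (Suc j)) \<omega> - B (\<tau> j) \<omega>" for j \<omega>
  have Dm: "D j \<in> borel_measurable N" if "j < k" for j
    unfolding D_def using that by (intro borel_measurable_diff iid_bm_measurable[OF B] \<tau>01) auto
  define \<sigma> where "\<sigma> j = sqrt (\<tau> (Suc j) - \<tau> j)" for j
  have \<sigma>: "0 < \<sigma> j" if "j < k" for j using \<tau>(3) that by (simp add: \<sigma>_def)
  \<comment> \<open>Grouping the scalar increments by time yields independent blocks, one vector
    increment per block.\<close>
  have indY: "indep_vars (\<lambda>j. PiM ({j} \<times> (UNIV::'d set)) (\<lambda>_. borel)) (\<lambda>j \<omega>. restrict (\<lambda>r. X r \<omega>) ({j} \<times> (UNIV::'d set))) {..<k}"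
    by (rule indep_vars_restrict[OF ind]) (auto simp: disjoint_family_on_def)
  have "indep_vars (\<lambda>_. borel) (\<lambda>j \<omega>. T (\<chi> i. (restrict (\<lambda>r. X r \<omega>) ({j} \<times> (UNIV::'d set))) (j, i))) {..<k}"
    by (rule indep_vars_compose2[OF indY, where Y = "\<lambda>j x. T (\<chi> i. x (j, i))"])
      (intro measurable_compose[OF measurable_vec_lambda Tm] measurable_component_singleton, auto)
  moreover have "(\<chi> i. (restrict (\<lambda>r. X r \<omega>) ({j} \<times> (UNIV::'d set))) (j, i)) = D j \<omega>" for j \<omega>
    by (simp add: vec_eq_iff X_def D_def)
  ultimately have indD: "indep_vars (\<lambda>_. borel) (\<lambda>j \<omega>. T (D j \<omega>)) {..<k}" by simp
  have law: "distr N borel (\<lambda>\<omega>. T (D j \<omega>)) = gauss_vec (\<sigma> j)" if j: "j < k" for j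
  proof -
    have iY: "indep_vars (\<lambda>_. PiM {0..1} (\<lambda>_. borel)) (\<lambda>i \<omega>. \<lambda>t\<in>{0..1}. B t \<omega> $ i) UNIV"
      using B by (simp add: iid_brownian_motions01_def)
    have "indep_vars (\<lambda>_. borel) (\<lambda>i \<omega>. (\<lambda>t\<in>{0..1}. B t \<omega> $ i) (\<tau> (Suc j)) - (\<lambda>t\<in>{0..1}. B t \<omega> $ i) (\<tau> j)) UNIV"
      by (rule indep_vars_compose2[OF iY, where Y = "\<lambda>i x. x (\<tau> (Suc j)) - x (\<tau> j)"])
        (use \<tau>01 j in \<open>intro borel_measurable_diff measurable_component_singleton, auto\<close>)
    then have ind1: "indep_vars (\<lambda>_. borel) (\<lambda>i. X (j, i)) UNIV"
      using \<tau>01[of j] \<tau>01[of "Suc j"] j by (simp add: X_def[abs_def])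
    have Xm: "X (j, i) \<in> borel_measurable N" for i
      using ind j by (auto simp: indep_vars_def2)
    have Xlaw: "distr N borel (X (j, i)) = normal_measure (\<sigma> j)" for i
    proof -
      have "distributed N lborel (X (j, i)) (normal_density 0 (\<sigma> j))"
        using iid_bm_coordinate[OF B, of i] \<tau>01[of j] \<tau>01[of "Suc j"] \<tau>(3) j
        unfolding brownian_motion01_def X_def[abs_def] \<sigma>_def by auto
      then have "distr N lborel (X (j, i)) = normal_measure (\<sigma> j)" by (simp add: distributed_def)
      then show ?thesis by (simp cong: distr_cong)
    qed
    have "distr N (PiM UNIV (\<lambda>_. borel)) (\<lambda>\<omega>. \<lambda>i\<in>UNIV. X (j, i) \<omega>) = PiM UNIV (\<lambda>i. distr N borel (X (j, i)))"
      using ind1 by (subst (asm) indep_vars_iff_distr_eq_PiM) (use Xm in auto)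
    then have P: "distr N (PiM UNIV (\<lambda>_. borel)) (\<lambda>\<omega>. \<lambda>i\<in>UNIV. X (j, i) \<omega>) = PiM UNIV (\<lambda>_. normal_measure (\<sigma> j))"
      unfolding Xlaw .
    have m1: "(\<lambda>\<omega>. \<lambda>i\<in>UNIV. X (j, i) \<omega>) \<in> measurable N (PiM (UNIV::'d set) (\<lambda>_. borel))"
      using Xm by (intro measurable_restrict) auto
    have m2: "(\<lambda>f. \<chi> i. f i) \<in> measurable (PiM (UNIV::'d set) (\<lambda>_. borel)) (borel :: (real ^ 'd) measure)"
      by (rule measurable_vec_lambda) measurable
    have "gauss_vec (\<sigma> j) = distr (distr N (PiM UNIV (\<lambda>_. borel)) (\<lambda>\<omega>. \<lambda>i\<in>UNIV. X (j, i) \<omega>)) borel (\<lambda>f. \<chi> i. f i)"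
      unfolding gauss_vec_def P ..
    also have "\<dots> = distr N borel ((\<lambda>f. \<chi> i. f i) \<circ> (\<lambda>\<omega>. \<lambda>i\<in>UNIV. X (j, i) \<omega>))" by (rule distr_distr[OF m2 m1])
    also have "(\<lambda>f. \<chi> i. f i) \<circ> (\<lambda>\<omega>. \<lambda>i\<in>UNIV. X (j, i) \<omega>) = D j"
      by (auto simp: fun_eq_iff vec_eq_iff X_def D_def)
    finally have "gauss_vec (\<sigma> j) = distr N borel (D j)" .
    then have "gauss_vec (\<sigma> j) = distr (distr N borel (D j)) borel T" using T_gauss[OF \<sigma>[OF j]] by simp
    also have "\<dots> = distr N borel (T \<circ> D j)" by (rule distr_distr[OF Tm Dm[OF j]])
    finally show ?thesis by (simp add: comp_def)
  qed
  have "distr N (PiM {..<k} (\<lambda>_. borel)) (\<lambda>\<omega>. \<lambda>j\<in>{..<k}. T (D j \<omega>)) = PiM {..<k} (\<lambda>j. distr N borel (\<lambda>\<omega>. T (D j \<omega>)))"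
    using indD
    by (subst (asm) indep_vars_iff_distr_eq_PiM') (use k Dm Tm in \<open>auto intro: measurable_compose\<close>)
  also have "\<dots> = PiM {..<k} (\<lambda>j. gauss_vec (\<sigma> j))" by (intro PiM_cong refl law) simp
  finally show "distr N (PiM {..<k} (\<lambda>_. borel)) (\<lambda>\<omega>. \<lambda>j\<in>{..<k}. T (B (\<tau> (Suc j)) \<omega>) - T (B (\<tau> j) \<omega>))
        = PiM {..<k} (\<lambda>j. gauss_vec (sqrt (\<tau> (Suc j) - \<tau> j)))"
    by (simp add: D_def \<sigma>_def linear_diff[OF T])
qed

text \<open>The process starts at 0 at time \<open>\<tau> 0 = 0\<close>, so each value is a sum of
  increments along the chain. The probability is therefore that of a fixed set under a product of
  Gaussian laws determined by \<open>\<tau>\<close>.\<close>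

lemma gauss_process_event:
  fixes Y :: "real \<Rightarrow> 'b \<Rightarrow> real ^ 'p"
  assumes Y: "gauss_process M Y" and k: "0 < k" and \<tau>: "0 \<le> \<tau> 0" "\<tau> k \<le> 1" "\<forall>i<k. \<tau> i < \<tau> (Suc i)"
    and \<tau>00: "\<tau> 0 = 0" and idx: "\<And>t. t \<in> J \<Longrightarrow> idx t \<le> k \<and> \<tau> (idx t) = t"
    and J: "finite J" and A: "\<And>t. t \<in> J \<Longrightarrow> A t \<in> sets borel"
  shows "emeasure M {\<omega> \<in> space M. \<forall>t\<in>J. Y t \<omega> \<in> A t} =
    emeasure (PiM {..<k} (\<lambda>j. gauss_vec (sqrt (\<tau> (Suc j) - \<tau> j))))
      {x \<in> space (PiM {..<k} (\<lambda>_. borel)). \<forall>t\<in>J. (\<Sum>j<idx t. x j) \<in> A t}"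
proof -
  have \<tau>_in: "\<tau> i \<in> {0..1}" if "i \<le> k" for i using strict_mono_chain_bounds[OF \<tau> that] .
  define E where "E = {x \<in> space (PiM {..<k} (\<lambda>_. borel)). \<forall>t\<in>J. (\<Sum>j<idx t. x j) \<in> A t}"
  have E: "E \<in> sets (PiM {..<k} (\<lambda>_. borel))"
    unfolding E_def
  proof (intro sets.sets_Collect_finite_All J)
    fix t assume t: "t \<in> J"
    have m: "(\<lambda>x. (\<Sum>j<idx t. x j) :: real ^ 'p) \<in> borel_measurable (PiM {..<k} (\<lambda>_. borel))"
      using idx[of t] t by (intro borel_measurable_sum measurable_component_singleton) auto
    show "{x \<in> space (PiM {..<k} (\<lambda>_. borel)). (\<Sum>j<idx t. x j) \<in> A t} \<in> sets (PiM {..<k} (\<lambda>_. borel))"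
      using measurable_sets[OF m A[OF t]] by (simp add: vimage_def Int_def conj_commute)
  qed
  have Ym: "Y t \<in> borel_measurable M" if "t \<in> {0..1}" for t using Y that by (simp add: gauss_process_def)
  have Y0: "Y 0 \<omega> = 0" if "\<omega> \<in> space M" for \<omega> using Y that by (simp add: gauss_process_def)
  let ?D = "\<lambda>\<omega>. \<lambda>j\<in>{..<k}. Y (\<tau> (Suc j)) \<omega> - Y (\<tau> j) \<omega>"
  have Dm: "?D \<in> measurable M (PiM {..<k} (\<lambda>_. borel))"
    using \<tau>_in by (intro measurable_restrict borel_measurable_diff Ym) auto
  have sum: "(\<Sum>j<idx t. ?D \<omega> j) = Y t \<omega>" if "t \<in> J" "\<omega> \<in> space M" for t \<omega>
  proof -
    have "(\<Sum>j<idx t. ?D \<omega> j) = (\<Sum>j<idx t. Y (\<tau> (Suc j)) \<omega> - Y (\<tau> j) \<omega>)"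
      using idx[of t] that(1) by (intro sum.cong) auto
    also have "\<dots> = Y (\<tau> (idx t)) \<omega> - Y (\<tau> 0) \<omega>" by (rule sum_lessThan_telescope)
    finally show ?thesis using idx[of t] that Y0 by (simp add: \<tau>00)
  qed
  have "?D -` E \<inter> space M = {\<omega> \<in> space M. \<forall>t\<in>J. Y t \<omega> \<in> A t}"
  proof (rule set_eqI)
    fix \<omega>
    have "?D \<omega> \<in> space (PiM {..<k} (\<lambda>_. borel))" by (simp add: space_PiM)
    then have "\<omega> \<in> ?D -` E \<inter> space M \<longleftrightarrow> \<omega> \<in> space M \<and> (\<forall>t\<in>J. (\<Sum>j<idx t. ?D \<omega> j) \<in> A t)"
      unfolding E_def by blast
    also have "\<dots> \<longleftrightarrow> \<omega> \<in> space M \<and> (\<forall>t\<in>J. Y t \<omega> \<in> A t)"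
    proof (rule conj_cong[OF refl])
      assume "\<omega> \<in> space M"
      then show "(\<forall>t\<in>J. (\<Sum>j<idx t. ?D \<omega> j) \<in> A t) \<longleftrightarrow> (\<forall>t\<in>J. Y t \<omega> \<in> A t)"
        by (intro ball_cong refl arg_cong2[where f = "(\<in>)"] sum)
    qed
    finally show "\<omega> \<in> ?D -` E \<inter> space M \<longleftrightarrow> \<omega> \<in> {\<omega> \<in> space M. \<forall>t\<in>J. Y t \<omega> \<in> A t}" by blast
  qed
  then have "emeasure M {\<omega> \<in> space M. \<forall>t\<in>J. Y t \<omega> \<in> A t} = emeasure (distr M (PiM {..<k} (\<lambda>_. borel)) ?D) E"
    using emeasure_distr[OF Dm E] by simp
  also have "distr M (PiM {..<k} (\<lambda>_. borel)) ?D = PiM {..<k} (\<lambda>j. gauss_vec (sqrt (\<tau> (Suc j) - \<tau> j)))"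
    using Y k \<tau> unfolding gauss_process_def by blast
  finally show ?thesis unfolding E_def .
qed

lemma gauss_process_finite_dim_event:
  assumes Z: "gauss_process N Z" and J: "finite J" "J \<subseteq> {0..1}" and A: "\<And>t. t \<in> J \<Longrightarrow> A t \<in> sets borel"
    and Z': "gauss_process Q Z'"
  shows "emeasure N {\<omega> \<in> space N. \<forall>t\<in>J. Z t \<omega> \<in> A t} = emeasure Q {\<omega> \<in> space Q. \<forall>t\<in>J. Z' t \<omega> \<in> A t}"
proof -
  \<comment> \<open>Adding 0 lets values be summed from the start; adding 1 guarantees at least one
    increment even when \<open>J\<close> is contained in {0}.\<close>
  define L where "L = sorted_list_of_set (insert 0 (insert 1 J))"
  have set_L: "set L = insert 0 (insert 1 J)"
    unfolding L_def using J by (intro set_sorted_list_of_set) simp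
  have sorted: "sorted_wrt (<) L" unfolding L_def by (rule strict_sorted_list_of_set)
  have "card (insert 0 (insert 1 J)) = length L" unfolding L_def by (simp only: sorted_list_of_set.length_sorted_key_list_of_set)
  moreover have "2 \<le> card (insert (0::real) (insert 1 J))"
    using card_mono[of "insert 0 (insert 1 J)" "{0, 1::real}"] J by auto
  ultimately have len: "2 \<le> length L" by simp
  define k where "k = length L - 1"
  have k: "0 < k" "length L = Suc k" using len by (auto simp: k_def)
  define \<tau> where "\<tau> i = L ! i" for i
  have \<tau>_less: "\<tau> i < \<tau> j" if "i < j" "j \<le> k" for i j
    using sorted_wrt_nth_less[OF sorted that(1)] that k by (simp add: \<tau>_def)
  have \<tau>_in: "\<tau> i \<in> {0..1}" if "i \<le> k" for i
  proof -
    have "\<tau> i \<in> set L" unfolding \<tau>_def using that k by (intro nth_mem) simp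
    then show ?thesis using J unfolding set_L by auto
  qed
  have \<tau>: "0 \<le> \<tau> 0" "\<tau> k \<le> 1" "\<forall>i<k. \<tau> i < \<tau> (Suc i)"
    using \<tau>_in[of 0] \<tau>_in[of k] \<tau>_less by auto
  have ex: "\<exists>i\<le>k. \<tau> i = t" if "t \<in> insert 0 J" for t
  proof -
    have "t \<in> set L" using that by (auto simp: set_L)
    then show ?thesis unfolding in_set_conv_nth \<tau>_def using k by (auto simp: less_Suc_eq_le)
  qed
  then obtain idx where idx: "\<And>t. t \<in> insert 0 J \<Longrightarrow> idx t \<le> k \<and> \<tau> (idx t) = t" by metis
  have \<tau>00: "\<tau> 0 = 0"
  proof (rule ccontr)
    assume "\<tau> 0 \<noteq> 0"
    then have "0 < \<tau> 0" using \<tau>(1) by simp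
    moreover have "\<tau> 0 \<le> \<tau> (idx 0)" using \<tau>_less[of 0 "idx 0"] idx[of 0] by (cases "idx 0") auto
    ultimately show False using idx[of 0] by simp
  qed
  have idx': "\<And>t. t \<in> J \<Longrightarrow> idx t \<le> k \<and> \<tau> (idx t) = t" using idx by blast
  show ?thesis
    using gauss_process_event[OF Z k(1) \<tau> \<tau>00 idx' J(1) A] gauss_process_event[OF Z' k(1) \<tau> \<tau>00 idx' J(1) A]
    by simp
qed

lemma gauss_process_measurable:
  assumes "gauss_process M Y"
  shows "(\<lambda>\<omega>. \<lambda>t\<in>{0..1}. Y t \<omega>) \<in> measurable M (PiM {0..1} (\<lambda>_. borel))"
  using assms by (intro measurable_restrict) (simp add: gauss_process_def)

lemma gauss_process_cylinder:
  assumes Y: "gauss_process M Y" and J: "finite J" "J \<subseteq> {0..1}" and A: "\<And>i. i \<in> J \<Longrightarrow> A i \<in> sets borel"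
  shows "emeasure (distr M (PiM {0..1} (\<lambda>_. borel)) (\<lambda>\<omega>. \<lambda>t\<in>{0..1}. Y t \<omega>)) (prod_emb {0..1} (\<lambda>_. borel) J (Pi\<^sub>E J A))
    = emeasure M {\<omega> \<in> space M. \<forall>t\<in>J. Y t \<omega> \<in> A t}"
proof -
  have "emeasure (distr M (PiM {0..1} (\<lambda>_. borel)) (\<lambda>\<omega>. \<lambda>t\<in>{0..1}. Y t \<omega>)) (prod_emb {0..1} (\<lambda>_. borel) J (Pi\<^sub>E J A))
    = emeasure M ((\<lambda>\<omega>. \<lambda>t\<in>{0..1}. Y t \<omega>) -` prod_emb {0..1} (\<lambda>_. borel) J (Pi\<^sub>E J A) \<inter> space M)"
    using J A by (intro emeasure_distr gauss_process_measurable[OF Y] sets_PiM_I) auto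
  also have "(\<lambda>\<omega>. \<lambda>t\<in>{0..1}. Y t \<omega>) -` prod_emb {0..1} (\<lambda>_. borel) J (Pi\<^sub>E J A) \<inter> space M
    = {\<omega> \<in> space M. \<forall>t\<in>J. Y t \<omega> \<in> A t}"
    using J(2) by (auto simp: prod_emb_def space_PiM PiE_iff subset_iff)
  finally show ?thesis .
qed

text \<open>Cylinders over finite sets of times determine a finite measure on the product
  space.\<close>

lemma gauss_process_law_unique:
  fixes Z :: "real \<Rightarrow> 'b \<Rightarrow> real ^ 'p"
  assumes N: "prob_space N" and Z: "gauss_process N Z" and Z': "gauss_process Q Z'"
  shows "distr N (PiM {0..1} (\<lambda>_. borel)) (\<lambda>\<omega>. \<lambda>t\<in>{0..1}. Z t \<omega>)
    = distr Q (PiM {0..1} (\<lambda>_. borel)) (\<lambda>\<omega>. \<lambda>t\<in>{0..1}. Z' t \<omega>)"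
proof (rule measure_eqI_PiM_infinite[where I = "{0..1}" and M = "\<lambda>_. borel"])
  fix A J assume J: "finite J" "J \<subseteq> {0..1::real}" and A: "\<And>i. i \<in> J \<Longrightarrow> A i \<in> sets (borel :: (real ^ 'p) measure)"
  show "emeasure (distr N (PiM {0..1} (\<lambda>_. borel)) (\<lambda>\<omega>. \<lambda>t\<in>{0..1}. Z t \<omega>)) (prod_emb {0..1} (\<lambda>_. borel) J (Pi\<^sub>E J A))
    = emeasure (distr Q (PiM {0..1} (\<lambda>_. borel)) (\<lambda>\<omega>. \<lambda>t\<in>{0..1}. Z' t \<omega>)) (prod_emb {0..1} (\<lambda>_. borel) J (Pi\<^sub>E J A))"
    using gauss_process_cylinder[OF Z J A] gauss_process_cylinder[OF Z' J A]
      gauss_process_finite_dim_event[OF Z J A Z'] by simp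
next
  show "finite_measure (distr N (PiM {0..1} (\<lambda>_. borel)) (\<lambda>\<omega>. \<lambda>t\<in>{0..1}. Z t \<omega>))"
    using prob_space.prob_space_distr[OF N gauss_process_measurable[OF Z]] by (rule prob_space.finite_measure)
qed auto


section \<open>Measurability of the optimal value\<close>

lemma el_val_nonneg: "0 \<le> el_val f"
  unfolding el_val_def by (rule SUP_upper2[of 0]) auto

text \<open>The dual problem sees a path only through the scalar functions
  \<open>a \<bullet> f t\<close>; passing between \<open>a\<close> and \<open>a'\<close> preserves
  constraint and integrand.\<close>

lemma el_val_same_functionals:
  assumes "\<And>a. \<exists>a'. \<forall>t\<in>{0..1}. a \<bullet> f t = a' \<bullet> g t" "\<And>a'. \<exists>a. \<forall>t\<in>{0..1}. a \<bullet> f t = a' \<bullet> g t"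
  shows "el_val f = el_val g"
proof (rule antisym)
  have le: "el_val f1 \<le> el_val f2" if hyp: "\<And>a. \<exists>a'. \<forall>t\<in>{0..1}. a \<bullet> f1 t = a' \<bullet> f2 t"
    for f1 :: "real \<Rightarrow> 'm::euclidean_space" and f2 :: "real \<Rightarrow> 'n::euclidean_space"
    unfolding el_val_def
  proof (rule SUP_mono)
    fix a assume a: "a \<in> {a. \<forall>t\<in>{0..1}. 0 < 1 + a \<bullet> f1 t}"
    obtain a' where a': "\<And>t. t \<in> {0..1} \<Longrightarrow> a \<bullet> f1 t = a' \<bullet> f2 t" using hyp by blast
    have "int01 (\<lambda>t. ln (1 + a \<bullet> f1 t)) = int01 (\<lambda>t. ln (1 + a' \<bullet> f2 t))"
      by (intro integral_cong) (simp add: a')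
    then show "\<exists>m\<in>{a. \<forall>t\<in>{0..1}. 0 < 1 + a \<bullet> f2 t}.
        ereal (int01 (\<lambda>t. ln (1 + a \<bullet> f1 t))) \<le> ereal (int01 (\<lambda>t. ln (1 + m \<bullet> f2 t)))"
      using a a' by (intro bexI[of _ a']) auto
  qed
  show "el_val f \<le> el_val g" using assms(1) by (rule le)
  show "el_val g \<le> el_val f" using assms(2) by (intro le) metis
qed

text \<open>Reads only countably many values of the path: positivity with a margin is tested at
  rational times, and the integral is a limit of Riemann sums. The default 0 is harmless because
  \<open>el_val\<close> is at least 0.\<close>

definition el_term :: "(real \<Rightarrow> 'a::euclidean_space) \<Rightarrow> 'a \<Rightarrow> nat \<Rightarrow> ereal" where
  "el_term f a k = (if \<forall>t\<in>\<rat> \<inter> {0..1}. inverse (real (Suc k)) \<le> 1 + a \<bullet> f t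
     then ereal (lim (\<lambda>n. (\<Sum>i = 1..n. ln (1 + a \<bullet> f (real i / real n))) / real n)) else 0)"

lemma rational_ge_imp_ge:
  fixes \<phi> :: "real \<Rightarrow> real"
  assumes cont: "continuous_on {0..1} \<phi>" and ge: "\<forall>t\<in>\<rat> \<inter> {0..1}. c \<le> \<phi> t" and t: "t \<in> {0..1}"
  shows "c \<le> \<phi> t"
proof (rule ccontr)
  assume "\<not> c \<le> \<phi> t"
  then have "0 < c - \<phi> t" by simp
  then obtain d where d: "0 < d" "\<And>s. s \<in> {0..1} \<Longrightarrow> dist s t < d \<Longrightarrow> dist (\<phi> s) (\<phi> t) < c - \<phi> t"
    using cont t unfolding continuous_on_iff by blast
  have "max 0 (t - d) < min 1 (t + d)" using d(1) t by auto
  then obtain s where s: "s \<in> \<rat>" "max 0 (t - d) < s" "s < min 1 (t + d)" using Rats_dense_in_real by blast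
  then have "dist (\<phi> s) (\<phi> t) < c - \<phi> t" by (intro d(2)) (auto simp: dist_real_def)
  moreover have "c \<le> \<phi> s" using ge s by auto
  ultimately show False by (simp add: dist_real_def)
qed

text \<open>A strictly admissible point has a positive margin by compactness, and the objective is
  continuous near it; hence the points of a dense set with margins 1 / (k + 1) exhaust the
  supremum.\<close>

lemma el_val_countable:
  fixes f :: "real \<Rightarrow> 'a::euclidean_space"
  assumes f_cont: "continuous_on {0..1} f"
    and D: "\<And>X :: 'a set. open X \<Longrightarrow> X \<noteq> {} \<Longrightarrow> \<exists>d\<in>D. d \<in> X"
  shows "el_val f = (SUP p\<in>D \<times> UNIV. el_term f (fst p) (snd p))"
proof (rule antisym)
  have f_cont_snd: "continuous_on (S \<times> {0..1}) (\<lambda>x. f (snd x))" for S :: "'a set"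
    by (rule continuous_on_compose2[OF f_cont]) (auto intro: continuous_intros)
  have lim_eq: "lim (\<lambda>n. (\<Sum>i = 1..n. ln (1 + a \<bullet> f (real i / real n))) / real n) = int01 (\<lambda>t. ln (1 + a \<bullet> f t))"
    if "\<And>t. t \<in> {0..1} \<Longrightarrow> 0 < 1 + a \<bullet> f t" for a
  proof (rule limI, rule riemann_sums_real)
    have "\<And>t. t \<in> {0..1} \<Longrightarrow> 1 + a \<bullet> f t \<noteq> 0" using that by (metis less_irrefl)
    then show "continuous_on {0..1} (\<lambda>t. ln (1 + a \<bullet> f t))" by (intro continuous_intros f_cont) auto
  qed
  show "(SUP p\<in>D \<times> UNIV. el_term f (fst p) (snd p)) \<le> el_val f"
  proof (rule SUP_least)
    fix p :: "'a \<times> nat"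
    obtain a k where p: "p = (a, k)" by (cases p)
    show "el_term f (fst p) (snd p) \<le> el_val f"
    proof (cases "\<forall>t\<in>\<rat> \<inter> {0..1}. inverse (real (Suc k)) \<le> 1 + a \<bullet> f t")
      case True
      have "inverse (real (Suc k)) \<le> 1 + a \<bullet> f t" if "t \<in> {0..1}" for t
        by (rule rational_ge_imp_ge[OF _ True that]) (intro continuous_intros f_cont)
      then have pos: "0 < 1 + a \<bullet> f t" if "t \<in> {0..1}" for t
        using that by (meson less_le_trans inverse_positive_iff_positive of_nat_0_less_iff zero_less_Suc)
      have "lim (\<lambda>n. (\<Sum>i = 1..n. ln (1 + a \<bullet> f (real i / real n))) / real n) = int01 (\<lambda>t. ln (1 + a \<bullet> f t))"
        by (rule lim_eq, rule pos)
      then have "el_term f a k = ereal (int01 (\<lambda>t. ln (1 + a \<bullet> f t)))"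
        unfolding el_term_def if_P[OF True] by (rule arg_cong)
      also have "\<dots> \<le> el_val f" unfolding el_val_def using pos by (intro SUP_upper) auto
      finally show ?thesis by (simp add: p)
    next
      case False
      show ?thesis unfolding p fst_conv snd_conv el_term_def if_not_P[OF False] by (rule el_val_nonneg)
    qed
  qed
  show "el_val f \<le> (SUP p\<in>D \<times> UNIV. el_term f (fst p) (snd p))"
    unfolding el_val_def
  proof (rule SUP_least)
    fix a assume "a \<in> {a. \<forall>t\<in>{0..1}. 0 < 1 + a \<bullet> f t}"
    then have a: "0 < 1 + a \<bullet> f t" if "t \<in> {0..1}" for t using that by blast
    have c1: "continuous_on {0..1} (\<lambda>t. 1 + a \<bullet> f t)" by (intro continuous_intros f_cont)
    obtain t1 where t1: "t1 \<in> {0..1}" "\<And>t. t \<in> {0..1} \<Longrightarrow> 1 + a \<bullet> f t1 \<le> 1 + a \<bullet> f t"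
      using continuous_attains_inf[OF compact_Icc _ c1] by auto
    \<comment> \<open>Half the minimum, so that moving \<open>a\<close> by less than
      \<open>\<kappa> / M\<close> still leaves the margin \<open>\<kappa>\<close>.\<close>
    define \<kappa> where "\<kappa> = (1 + a \<bullet> f t1) / 2"
    have \<kappa>: "0 < \<kappa>" "\<And>t. t \<in> {0..1} \<Longrightarrow> 2 * \<kappa> \<le> 1 + a \<bullet> f t"
      using a[OF t1(1)] t1(2) unfolding \<kappa>_def by simp_all
    have "bounded (f ` {0..1})" by (intro compact_imp_bounded compact_continuous_image f_cont compact_Icc)
    then obtain M where M: "0 < M" "\<forall>t\<in>{0..1}. norm (f t) \<le> M" by (auto simp: bounded_pos)
    \<comment> \<open>Truncation at \<open>\<kappa>\<close> makes the objective continuous on the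
      whole space and leaves it unchanged near \<open>a\<close>.\<close>
    define I where "I b = int01 (\<lambda>t. ln (max (1 + b \<bullet> f t) \<kappa>))" for b
    have contI: "continuous_on UNIV I"
      unfolding I_def using \<kappa>(1)
      by (intro continuous_int01_param continuous_intros f_cont_snd) auto
    have I_eq: "I b = int01 (\<lambda>t. ln (1 + b \<bullet> f t))" if "\<And>t. t \<in> {0..1} \<Longrightarrow> \<kappa> \<le> 1 + b \<bullet> f t" for b
      unfolding I_def using that by (intro integral_cong) (simp add: max_absorb1)
    have Ia: "I a = int01 (\<lambda>t. ln (1 + a \<bullet> f t))" using \<kappa> by (intro I_eq) force
    show "ereal (int01 (\<lambda>t. ln (1 + a \<bullet> f t))) \<le> (SUP p\<in>D \<times> UNIV. el_term f (fst p) (snd p))"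
    proof (rule ereal_le_epsilon2)
        fix e :: real assume e: "0 < e"
        have "open {b \<in> UNIV. I a - e < I b}"
          using open_Collect_less[OF continuous_on_const contI, of "I a - e"] by simp
        then have "open ({b \<in> UNIV. I a - e < I b} \<inter> ball a (\<kappa> / M))" by (intro open_Int) auto
        moreover have "a \<in> {b \<in> UNIV. I a - e < I b} \<inter> ball a (\<kappa> / M)" using e \<kappa>(1) M(1) by auto
        ultimately have "\<exists>d\<in>D. d \<in> {b \<in> UNIV. I a - e < I b} \<inter> ball a (\<kappa> / M)" by (intro D) blast+
        then obtain b where b: "b \<in> D" "I a - e < I b" "dist a b < \<kappa> / M" by auto
        have ge: "\<kappa> \<le> 1 + b \<bullet> f t" if t: "t \<in> {0..1}" for t
        proof -
          have "(a - b) \<bullet> f t \<le> norm (a - b) * norm (f t)" by (rule norm_cauchy_schwarz)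
          also have "\<dots> \<le> (\<kappa> / M) * M" using b(3) M t \<kappa>(1) by (intro mult_mono) (auto simp: dist_norm)
          also have "\<dots> = \<kappa>" using M(1) by simp
          finally show ?thesis using \<kappa>(2)[OF t] by (simp add: inner_diff_left)
        qed
        obtain k where k: "inverse (real (Suc k)) < \<kappa>" using reals_Archimedean[OF \<kappa>(1)] by blast
        have cond: "\<forall>t\<in>\<rat> \<inter> {0..1}. inverse (real (Suc k)) \<le> 1 + b \<bullet> f t" using ge k by (metis IntD2 less_imp_le order_trans)
        have lb: "lim (\<lambda>n. (\<Sum>i = 1..n. ln (1 + b \<bullet> f (real i / real n))) / real n) = int01 (\<lambda>t. ln (1 + b \<bullet> f t))"
          by (rule lim_eq, rule less_le_trans[OF \<kappa>(1) ge])
        have Ib: "I b = int01 (\<lambda>t. ln (1 + b \<bullet> f t))" by (rule I_eq, rule ge)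
        have "el_term f b k = ereal (I b)"
          unfolding el_term_def if_P[OF cond] lb Ib ..
        moreover have "el_term f b k \<le> (SUP p\<in>D \<times> UNIV. el_term f (fst p) (snd p))"
          using b(1) by (intro SUP_upper2[of "(b, k)"]) auto
        ultimately have 1: "ereal (I b) \<le> (SUP p\<in>D \<times> UNIV. el_term f (fst p) (snd p))" by simp
        have "ereal (I a) \<le> ereal (I b) + ereal e" using b(2) by simp
        also have "\<dots> \<le> (SUP p\<in>D \<times> UNIV. el_term f (fst p) (snd p)) + ereal e" using 1 by (rule add_right_mono)
        finally show "ereal (int01 (\<lambda>t. ln (1 + a \<bullet> f t))) \<le> (SUP p\<in>D \<times> UNIV. el_term f (fst p) (snd p)) + ereal e"
          unfolding Ia .
    qed
  qed
qed

text \<open>A set in the product sigma-algebra depends on countably many coordinates only, so the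
  functional is built from \<open>el_term\<close> and tied to \<open>el_val\<close> on continuous
  paths. It is what allows equality of laws to be applied to the dual value.\<close>

lemma el_val_measurable_functional:
  fixes w :: "real \<Rightarrow> real"
  assumes w: "continuous_on {0..1} w"
  obtains \<Psi> :: "(real \<Rightarrow> real ^ 'p) \<Rightarrow> ereal"
  where "\<Psi> \<in> borel_measurable (PiM {0..1} (\<lambda>_. borel))"
    "\<And>z. continuous_on {0..1} z \<Longrightarrow> \<Psi> (\<lambda>t\<in>{0..1}. z t) = el_val (\<lambda>t. w t *\<^sub>R z t)"
proof -
  obtain D :: "(real ^ 'p) set" where D: "countable D" "\<And>X. open X \<Longrightarrow> X \<noteq> {} \<Longrightarrow> \<exists>d\<in>D. d \<in> X"
    using countable_dense_exists by blast
  define \<Psi> where "\<Psi> x = (SUP p\<in>D \<times> UNIV. el_term (\<lambda>t. w t *\<^sub>R x t) (fst p) (snd p))" for x :: "real \<Rightarrow> real ^ 'p"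
  let ?P = "PiM {0..1::real} (\<lambda>_. borel :: (real ^ 'p) measure)"
  have comp: "(\<lambda>x. 1 + a \<bullet> (w t *\<^sub>R x t)) \<in> borel_measurable ?P" if "t \<in> {0..1}" for a t
    using that by (intro borel_measurable_add borel_measurable_const borel_measurable_inner
        borel_measurable_scaleR measurable_component_singleton)
  have "el_term (\<lambda>t. w t *\<^sub>R x t) a k = (if \<forall>t\<in>\<rat> \<inter> {0..1}. inverse (real (Suc k)) \<le> 1 + a \<bullet> (w t *\<^sub>R x t)
     then ereal (lim (\<lambda>n. (\<Sum>i = 1..n. ln (1 + a \<bullet> (w (real i / real n) *\<^sub>R x (real i / real n)))) / real n)) else 0)"
    for x :: "real \<Rightarrow> real ^ 'p" and a k by (simp add: el_term_def)
  moreover have "(\<lambda>x. if \<forall>t\<in>\<rat> \<inter> {0..1}. inverse (real (Suc k)) \<le> 1 + a \<bullet> (w t *\<^sub>R x t)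
     then ereal (lim (\<lambda>n. (\<Sum>i = 1..n. ln (1 + a \<bullet> (w (real i / real n) *\<^sub>R x (real i / real n)))) / real n)) else 0)
     \<in> borel_measurable ?P" for a k
  proof (rule measurable_If)
    show "(\<lambda>x. ereal (lim (\<lambda>n. (\<Sum>i = 1..n. ln (1 + a \<bullet> (w (real i / real n) *\<^sub>R x (real i / real n)))) / real n)))
        \<in> borel_measurable ?P"
      by (intro borel_measurable_ereal borel_measurable_lim_metric borel_measurable_divide
          borel_measurable_sum borel_measurable_const borel_measurable_ln comp grid_mem)
    have c: "countable (\<rat> \<inter> {0..1::real})" using countable_rat by (rule countable_subset[rotated]) auto
    show "{x \<in> space ?P. \<forall>t\<in>\<rat> \<inter> {0..1}. inverse (real (Suc k)) \<le> 1 + a \<bullet> (w t *\<^sub>R x t)} \<in> sets ?P"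
    proof (rule sets.sets_Collect_countable_All'[OF _ c])
      fix t :: real assume "t \<in> \<rat> \<inter> {0..1}"
      then show "{x \<in> space ?P. inverse (real (Suc k)) \<le> 1 + a \<bullet> (w t *\<^sub>R x t)} \<in> sets ?P"
        by (intro borel_measurable_le borel_measurable_const comp) auto
    qed
  qed auto
  ultimately have "(\<lambda>x. el_term (\<lambda>t. w t *\<^sub>R x t) a k) \<in> borel_measurable ?P" for a k by simp
  then have "\<Psi> \<in> borel_measurable ?P"
    unfolding \<Psi>_def[abs_def] using D(1) by (intro borel_measurable_SUP countable_SIGMA) auto
  moreover have "\<Psi> (\<lambda>t\<in>{0..1}. z t) = el_val (\<lambda>t. w t *\<^sub>R z t)" if z: "continuous_on {0..1} z" for z
  proof -
    have "\<Psi> (\<lambda>t\<in>{0..1}. z t) = el_val (\<lambda>t. w t *\<^sub>R (\<lambda>t\<in>{0..1}. z t) t)"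
      unfolding \<Psi>_def
    proof (rule el_val_countable[symmetric, OF _ D(2)])
      have "continuous_on {0..1} (\<lambda>t. w t *\<^sub>R z t)" by (intro continuous_intros w z)
      then show "continuous_on {0..1} (\<lambda>t. w t *\<^sub>R (\<lambda>t\<in>{0..1}. z t) t)"
        by (rule continuous_on_eq) simp
    qed
    also have "\<dots> = el_val (\<lambda>t. w t *\<^sub>R z t)" by (rule el_val_same_functionals) auto
    finally show ?thesis .
  qed
  ultimately show thesis using that by blast
qed


section \<open>The limit theorem\<close>

text \<open>An orthonormal basis of the range of \<open>C\<close> spans the same functionals as
  \<open>C\<close>. This standardises the projected Gaussian limit without an inverse square root of
  its covariance matrix.\<close>

lemma orthonormal_row_space:
  fixes C :: "real ^ 'p \<Rightarrow> real ^ 'd"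
  assumes C: "linear C" "inj C"
  obtains b :: "'p \<Rightarrow> real ^ 'd wo" where "orthonormal_family b"
    "\<And>a. \<exists>a'. \<forall>x. C a \<bullet> x = a' \<bullet> (\<chi> i. b i \<bullet> (\<chi> j. x $ rep_wo j))"
    "\<And>a'. \<exists>a. \<forall>x. C a \<bullet> x = a' \<bullet> (\<chi> i. b i \<bullet> (\<chi> j. x $ rep_wo j))"
proof -
  define r :: "real ^ 'd \<Rightarrow> real ^ 'd wo" where "r x = (\<chi> j. x $ rep_wo j)" for x
  have r_inner: "r x \<bullet> r y = x \<bullet> y" for x y
    unfolding r_def inner_vec_def using sum.reindex_bij_betw[OF bij_rep_wo, of "\<lambda>i. x $ i * y $ i"] by simp
  have r_lin: "linear r" by (rule linearI) (auto simp: r_def vec_eq_iff)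
  have r_inj: "inj r"
  proof (rule injI)
    fix x y assume "r x = r y"
    then have "r (x - y) \<bullet> r (x - y) = 0" by (simp add: linear_diff[OF r_lin])
    then show "x = y" by (simp add: r_inner)
  qed
  define S where "S = range (r \<circ> C)"
  have lin: "linear (r \<circ> C)" by (rule linear_compose[OF C(1) r_lin])
  have sub: "subspace S" unfolding S_def by (rule linear_subspace_image[OF lin subspace_UNIV])
  have "dim S = dim (UNIV :: (real ^ 'p) set)"
    unfolding S_def using lin inj_compose[OF r_inj C(2)] by (intro dim_image_eq) auto
  then have dimS: "dim S = CARD('p)" by simp
  obtain Bs where Bs: "Bs \<subseteq> S" "pairwise orthogonal Bs" "\<And>x. x \<in> Bs \<Longrightarrow> norm x = 1"
    "independent Bs" "card Bs = dim S" "span Bs = S"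
    using orthonormal_basis_subspace[OF sub] by metis
  have "finite Bs" using Bs(4) by (rule independent_imp_finite)
  then obtain b where b: "bij_betw b (UNIV :: 'p set) Bs"
    using finite_same_card_bij[of "UNIV :: 'p set" Bs] Bs(5) dimS by auto
  have bB: "b i \<in> Bs" for i using b by (auto simp: bij_betw_def)
  have on: "b i \<bullet> b j = (if i = j then 1 else 0)" for i j
  proof (cases "i = j")
    case True
    then show ?thesis using Bs(3)[OF bB[of i]] by (simp add: dot_square_norm)
  next
    case False
    then have "b i \<noteq> b j" using b by (auto simp: bij_betw_def inj_eq)
    then have "orthogonal (b i) (b j)" using Bs(2) bB by (auto simp: pairwise_def)
    then show ?thesis using False by (simp add: orthogonal_def)
  qed
  show thesis
  proof (rule that[of b])
    show "orthonormal_family b" using on by (simp add: orthonormal_family_def)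
    fix a :: "real ^ 'p"
    define V where "V = {v. \<exists>a' :: real ^ 'p. \<forall>x. v \<bullet> r x = a' \<bullet> (\<chi> i. b i \<bullet> r x)}"
    have "subspace V"
    proof (rule subspaceI)
      show "0 \<in> V" unfolding V_def by (auto intro: exI[of _ 0])
    next
      fix v v' assume "v \<in> V" "v' \<in> V"
      then obtain a1 a2 :: "real ^ 'p" where "\<forall>x. v \<bullet> r x = a1 \<bullet> (\<chi> i. b i \<bullet> r x)" "\<forall>x. v' \<bullet> r x = a2 \<bullet> (\<chi> i. b i \<bullet> r x)"
        unfolding V_def by blast
      then have "\<forall>x. (v + v') \<bullet> r x = (a1 + a2) \<bullet> (\<chi> i. b i \<bullet> r x)" by (simp add: inner_add_left)
      then show "v + v' \<in> V" unfolding V_def by blast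
    next
      fix c v assume "v \<in> V"
      then obtain a1 :: "real ^ 'p" where "\<forall>x. v \<bullet> r x = a1 \<bullet> (\<chi> i. b i \<bullet> r x)" unfolding V_def by blast
      then have "\<forall>x. (c *\<^sub>R v) \<bullet> r x = (c *\<^sub>R a1) \<bullet> (\<chi> i. b i \<bullet> r x)" by simp
      then show "c *\<^sub>R v \<in> V" unfolding V_def by blast
    qed
    moreover have "Bs \<subseteq> V"
    proof
      fix v assume "v \<in> Bs"
      then obtain i where v: "v = b i" using b by (auto simp: bij_betw_def)
      have "b i \<bullet> r x = axis i 1 \<bullet> (\<chi> i. b i \<bullet> r x)" for x by (simp add: inner_axis')
      then show "v \<in> V" unfolding V_def v by blast
    qed
    ultimately have "S \<subseteq> V" using span_minimal[of Bs V] Bs(6) by simp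
    moreover have "r (C a) \<in> S" by (simp add: S_def)
    ultimately obtain a' :: "real ^ 'p" where "\<forall>x. r (C a) \<bullet> r x = a' \<bullet> (\<chi> i. b i \<bullet> r x)"
      unfolding V_def by blast
    then show "\<exists>a'. \<forall>x. C a \<bullet> x = a' \<bullet> (\<chi> i. b i \<bullet> (\<chi> j. x $ rep_wo j))"
      unfolding r_inner unfolding r_def by blast
  next
    fix a' :: "real ^ 'p"
    have "(\<Sum>i\<in>UNIV. a' $ i *\<^sub>R b i) \<in> span Bs"
      by (intro span_sum span_scale span_base bB)
    then obtain a where a: "(\<Sum>i\<in>UNIV. a' $ i *\<^sub>R b i) = r (C a)" unfolding Bs(6) S_def by auto
    have "C a \<bullet> x = a' \<bullet> (\<chi> i. b i \<bullet> r x)" for x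
    proof -
      have "C a \<bullet> x = (\<Sum>i\<in>UNIV. a' $ i *\<^sub>R b i) \<bullet> r x" by (simp add: a r_inner)
      also have "\<dots> = a' \<bullet> (\<chi> i. b i \<bullet> r x)" unfolding inner_sum_left by (subst inner_vec_def) simp
      finally show ?thesis .
    qed
    then show "\<exists>a. \<forall>x. C a \<bullet> x = a' \<bullet> (\<chi> i. b i \<bullet> (\<chi> j. x $ rep_wo j))"
      unfolding r_def by blast
  qed
qed

section \<open>From the data to the path functional\<close>

lemma centred_sum_shift: "centred_sum \<mu> x i = centred_sum \<mu>0 x i - real i *\<^sub>R (\<mu> - \<mu>0)"
  unfolding centred_sum_def by (induction i) (auto simp: algebra_simps)

lemma partial_sum_process_grid:
  assumes "0 < n"
  shows "partial_sum_process \<mu>0 x n (real i / real n) = centred_sum \<mu>0 x i"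
  using assms by (simp add: partial_sum_process_def Let_def frac_def)

lemma EBEL_ratio_eq_rescaled_EL:
  assumes n: "0 < n"
    and z: "\<And>i. i \<in> {1..n} \<Longrightarrow> z (real i / real n) = (1 / sqrt (real n)) *\<^sub>R partial_sum_process \<mu>0 x n (real i / real n)"
  shows "EBEL_ratio w H x n (H \<mu>0) = rescaled_EL w H \<mu>0 n z"
proof -
  have "sqrt (real n) *\<^sub>R z (real i / real n) - real i *\<^sub>R (\<mu> - \<mu>0) = centred_sum \<mu> x i" if "i \<in> {1..n}" for i \<mu>
    using n by (simp add: z[OF that] partial_sum_process_grid centred_sum_shift[of \<mu> x i \<mu>0])
  then have "(\<Sum>i = 1..n. q i *\<^sub>R block_sum w x n \<mu> i) = (\<Sum>i = 1..n. q i *\<^sub>R w (real i / real n) *\<^sub>R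
      (sqrt (real n) *\<^sub>R z (real i / real n) - real i *\<^sub>R (\<mu> - \<mu>0)))" for q \<mu>
    unfolding block_sum_def by (intro sum.cong) auto
  then show ?thesis unfolding EBEL_ratio_def rescaled_EL_def by simp
qed

text \<open>The random limit is defined by a choice operator and is known to equal a measurable
  function only almost surely. The level sets of the two functions differ by subsets of a null set,
  which the completion measures.\<close>

lemma borel_measurable_completion_AE:
  assumes G: "G \<in> borel_measurable Q" and eq: "AE \<omega> in Q. F \<omega> = G \<omega>"
  shows "F \<in> borel_measurable (completion Q)"
proof (rule measurableI)
  fix A :: "'b set" assume A: "A \<in> sets borel"
  have 1: "{\<omega> \<in> space Q. F \<omega> \<in> A \<and> F \<omega> \<noteq> G \<omega>} \<in> sets (completion Q)"
  proof -
    have "AE \<omega> in Q. \<not> (F \<omega> \<in> A \<and> F \<omega> \<noteq> G \<omega>)" using eq by (rule AE_mp) auto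
    from sets_completion_AE[OF this] show ?thesis by (simp add: pred_def)
  qed
  have 2: "{\<omega> \<in> space Q. G \<omega> \<in> A \<and> F \<omega> \<noteq> G \<omega>} \<in> sets (completion Q)"
  proof -
    have "AE \<omega> in Q. \<not> (G \<omega> \<in> A \<and> F \<omega> \<noteq> G \<omega>)" using eq by (rule AE_mp) auto
    from sets_completion_AE[OF this] show ?thesis by (simp add: pred_def)
  qed
  have 3: "G -` A \<inter> space Q \<in> sets (completion Q)" using measurable_sets[OF G A] by auto
  have "F -` A \<inter> space Q = (G -` A \<inter> space Q - {\<omega> \<in> space Q. G \<omega> \<in> A \<and> F \<omega> \<noteq> G \<omega>})
      \<union> {\<omega> \<in> space Q. F \<omega> \<in> A \<and> F \<omega> \<noteq> G \<omega>}" by auto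
  also have "\<dots> \<in> sets (completion Q)" using 1 2 3 by (intro sets.Un sets.Diff)
  finally show "F -` A \<inter> space (completion Q) \<in> sets (completion Q)" by simp
qed simp

theorem theorem3:
  fixes M :: "'a measure" and N :: "'b measure" and Q :: "'c measure"
    and X :: "int \<Rightarrow> 'a \<Rightarrow> real ^ 'd" and \<mu>\<^sub>0 :: "real ^ 'd"
    and w :: "real \<Rightarrow> real" and c :: real
    and \<Sigma> \<Sigma>_half :: "real ^ 'd ^ 'd" and B :: "real \<Rightarrow> 'b \<Rightarrow> real ^ 'd"
    and H :: "real ^ 'd \<Rightarrow> real ^ 'p" and U :: "(real ^ 'd) set"
    and W :: "real \<Rightarrow> 'c \<Rightarrow> real ^ 'p"
  defines "f \<equiv> \<lambda>\<omega> t. w t *\<^sub>R W t \<omega>"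
  defines "Y \<equiv> \<lambda>\<omega>. arg_min_on (g_fun (f \<omega>)) (K_bar (f \<omega>))"
  assumes "prob_space M" and "prob_space N" and "prob_space Q"
    and stationary: "strictly_stationary M X"
    and second_moment: "integrable M (\<lambda>\<omega>. (norm (X 0 \<omega>))\<^sup>2)"
    and mean: "\<And>t. (\<integral>\<omega>. X t \<omega> \<partial>M) = \<mu>\<^sub>0"
    and w_cont: "continuous_on {0..1} w"
    and w_nonneg: "\<And>t. t \<in> {0..1} \<Longrightarrow> 0 \<le> w t"
    and c: "0 < c" "c \<le> 1"
    and w_pos: "\<And>t. t \<in> {0<..<c} \<Longrightarrow> 0 < w t"
    and long_run_cov: "((\<lambda>(m, n). \<Sum>j = - int m..int n. cov_matrix M (X 0) (X j)) \<longlongrightarrow> \<Sigma>)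
           (sequentially \<times>\<^sub>F sequentially)"
    and pos_def: "positive_definite \<Sigma>"
    and sqrt_cov: "positive_definite \<Sigma>_half" "\<Sigma>_half ** \<Sigma>_half = \<Sigma>"
    and brownian_B: "iid_brownian_motions01 N B"
    and fclt: "conv_in_dist C01
           M (\<lambda>n \<omega>. \<lambda>t\<in>{0..1}. (1 / sqrt (real n)) *\<^sub>R partial_sum_process \<mu>\<^sub>0 (\<lambda>j. X j \<omega>) n t)
           N (\<lambda>\<omega>. \<lambda>t\<in>{0..1}. \<Sigma>_half *v B t \<omega>)"
    and dims: "CARD('p) \<le> CARD('d)"
    and nbhd: "open U" "\<mu>\<^sub>0 \<in> U"
    and H_C1: "H differentiable_on U" "continuous_on U (\<lambda>\<mu>. jacobian H (at \<mu>))"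
    and rank_H: "rank (jacobian H (at \<mu>\<^sub>0)) = CARD('p)"
    and brownian_W: "iid_brownian_motions01 Q W"
  shows "(AE \<omega> in Q. \<exists>!y. is_arg_min (g_fun (f \<omega>)) (\<lambda>y. y \<in> K_bar (f \<omega>)) y) \<and>
         conv_in_dist euclidean
           M (\<lambda>n \<omega>. - (ereal (1 / real n) * elog (EBEL_ratio w H (\<lambda>j. X j \<omega>) n (H \<mu>\<^sub>0))))
           (completion Q) (\<lambda>\<omega>. - g_fun (f \<omega>) (Y \<omega>))"
proof -
  interpret M: prob_space M by fact
  interpret N: prob_space N by fact
  interpret Q: prob_space Q by fact
  let ?m = "cfunspace (top_of_set {0..1}) euclidean_metric :: (real \<Rightarrow> real ^ 'd) metric"
  define J where "J = jacobian H (at \<mu>\<^sub>0)"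
  have "H differentiable (at \<mu>\<^sub>0)"
    using H_C1(1) nbhd by (metis at_within_open differentiable_on_def)
  then have H_deriv: "(H has_derivative (*v) J) (at \<mu>\<^sub>0)" unfolding J_def by (simp add: jacobian_works)
  have U_cont: "continuous_on U H" using H_C1(1) by (rule differentiable_imp_continuous_on)
  \<comment> \<open>Full row rank of \<open>J\<close> is injectivity of its transpose; with
    \<open>\<Sigma>_half\<close> injective as well, distinct functionals of the projected limit stay
    distinct on \<open>B\<close>.\<close>
  have J_inj: "inj ((*v) (transpose J))"
    using rank_H unfolding J_def full_rank_injective[symmetric] by (simp add: rank_transpose)
  have Sh_sym: "transpose \<Sigma>_half = \<Sigma>_half" using sqrt_cov(1) by (simp add: positive_definite_def)
  have Sh_inj: "inj ((*v) \<Sigma>_half)"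
  proof (rule injI)
    fix x y assume "\<Sigma>_half *v x = \<Sigma>_half *v y"
    then have "(x - y) \<bullet> (\<Sigma>_half *v (x - y)) = 0" by (simp add: matrix_vector_mult_diff_distrib)
    then show "x = y" using sqrt_cov(1) unfolding positive_definite_def by (metis eq_iff_diff_eq_0 less_irrefl)
  qed
  \<comment> \<open>The adjoint of \<open>J\<close> composed with \<open>\<Sigma>_half\<close>: it
    turns functionals of the projected limit into functionals of \<open>B\<close> itself.\<close>
  define C where "C a = \<Sigma>_half *v (transpose J *v a)" for a
  have C_lin: "linear C" unfolding C_def
    by (rule linearI) (simp_all add: matrix_vector_right_distrib matrix_vector_mult_scaleR)
  have C_inj: "inj C" unfolding C_def using inj_compose[OF Sh_inj J_inj] by (simp add: comp_def)
  have C_inner: "C a \<bullet> x = a \<bullet> (J *v (\<Sigma>_half *v x))" for a x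
    unfolding C_def using Sh_sym by (metis dot_lmul_matrix inner_commute transpose_matrix_vector transpose_transpose)
  obtain b :: "'p \<Rightarrow> real ^ 'd wo" where b: "orthonormal_family b"
    "\<And>a. \<exists>a'. \<forall>x. C a \<bullet> x = a' \<bullet> (\<chi> i. b i \<bullet> (\<chi> j. x $ rep_wo j))"
    "\<And>a'. \<exists>a. \<forall>x. C a \<bullet> x = a' \<bullet> (\<chi> i. b i \<bullet> (\<chi> j. x $ rep_wo j))"
    using orthonormal_row_space[OF C_lin C_inj] by metis
  \<comment> \<open>The orthonormal replacement for \<open>J\<close> composed with
    \<open>\<Sigma>_half\<close>: it offers the same functionals, hence the same dual value, while
    its image of \<open>B\<close> has the law of \<open>W\<close>.\<close>
  define T where "T x = (\<chi> i. b i \<bullet> (\<chi> j. x $ rep_wo j))" for x :: "real ^ 'd"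
  have T_lin: "linear T"
  proof (rule linearI)
    have lin: "(\<chi> j. (x + y) $ rep_wo j) = (\<chi> j. x $ rep_wo j) + (\<chi> j. y $ rep_wo j)"
      "(\<chi> j. (c *\<^sub>R x) $ rep_wo j) = c *\<^sub>R (\<chi> j. x $ rep_wo j)" for x y :: "real ^ 'd" and c
      by (simp_all add: vec_eq_iff)
    show "T (x + y) = T x + T y" "T (c *\<^sub>R x) = c *\<^sub>R T x" for x y c
      unfolding T_def lin by (simp_all only: inner_add_right inner_scaleR_right) (simp_all add: vec_eq_iff)
  qed
  have gp_B: "gauss_process N (\<lambda>t \<omega>. T (B t \<omega>))"
    using gauss_vec_orthonormal_image[OF b(1)] unfolding T_def[symmetric, abs_def]
    by (intro gauss_process_linear_image[OF N.prob_space_axioms brownian_B T_lin]) (simp add: T_def[abs_def])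
  have gp_W: "gauss_process Q W"
    using gauss_process_linear_image[OF Q.prob_space_axioms brownian_W, of "\<lambda>x. x"]
    by (simp add: linear_ident distr_id2)
  obtain \<Psi> :: "(real \<Rightarrow> real ^ 'p) \<Rightarrow> ereal" where \<Psi>: "\<Psi> \<in> borel_measurable (PiM {0..1} (\<lambda>_. borel))"
    "\<And>z. continuous_on {0..1} z \<Longrightarrow> \<Psi> (\<lambda>t\<in>{0..1}. z t) = el_val (\<lambda>t. w t *\<^sub>R z t)"
    using el_val_measurable_functional[OF w_cont] by blast
  have val_B: "el_val (\<lambda>t. w t *\<^sub>R (J *v (\<lambda>t\<in>{0..1}. \<Sigma>_half *v B t \<omega>) t)) = \<Psi> (\<lambda>t\<in>{0..1}. T (B t \<omega>))"
    if "\<omega> \<in> space N" for \<omega>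
  proof -
    have "el_val (\<lambda>t. w t *\<^sub>R (J *v (\<lambda>t\<in>{0..1}. \<Sigma>_half *v B t \<omega>) t)) = el_val (\<lambda>t. w t *\<^sub>R T (B t \<omega>))"
    proof (rule el_val_same_functionals)
      fix a
      obtain a' where "\<forall>x. C a \<bullet> x = a' \<bullet> T x" using b(2)[of a] unfolding T_def by blast
      then show "\<exists>a'. \<forall>t\<in>{0..1}. a \<bullet> (w t *\<^sub>R (J *v (\<lambda>t\<in>{0..1}. \<Sigma>_half *v B t \<omega>) t)) = a' \<bullet> (w t *\<^sub>R T (B t \<omega>))"
        by (intro exI[of _ a']) (simp add: C_inner[symmetric])
    next
      fix a'
      obtain a where "\<forall>x. C a \<bullet> x = a' \<bullet> T x" using b(3)[of a'] unfolding T_def by blast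
      then show "\<exists>a. \<forall>t\<in>{0..1}. a \<bullet> (w t *\<^sub>R (J *v (\<lambda>t\<in>{0..1}. \<Sigma>_half *v B t \<omega>) t)) = a' \<bullet> (w t *\<^sub>R T (B t \<omega>))"
        by (intro exI[of _ a]) (simp add: C_inner[symmetric])
    qed
    also have "\<dots> = \<Psi> (\<lambda>t\<in>{0..1}. T (B t \<omega>))"
      by (rule \<Psi>(2)[symmetric], rule linear_continuous_on_compose[OF iid_bm_path(2)[OF brownian_B that] T_lin])
    finally show ?thesis .
  qed
  have val_W: "el_val (f \<omega>) = \<Psi> (\<lambda>t\<in>{0..1}. W t \<omega>)" if "\<omega> \<in> space Q" for \<omega>
    unfolding f_def by (rule \<Psi>(2)[symmetric, OF iid_bm_path(2)[OF brownian_W that]])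
  have two_sided_W: "AE \<omega> in Q. two_sided_path (f \<omega>)"
  proof (rule AE_mp[OF iid_bm_two_sided[OF Q.prob_space_axioms brownian_W c]], intro AE_I2 impI)
    fix \<omega> assume w: "\<omega> \<in> space Q" and neg: "\<forall>u. u \<noteq> 0 \<longrightarrow> (\<exists>t\<in>{0<..<c}. u \<bullet> W t \<omega> < 0)"
    show "two_sided_path (f \<omega>)"
    proof
      show "continuous_on {0..1} (f \<omega>)"
        unfolding f_def by (intro continuous_intros w_cont iid_bm_path(2)[OF brownian_W w])
      fix u :: "real ^ 'p" assume "u \<noteq> 0"
      then obtain t where t: "t \<in> {0<..<c}" "u \<bullet> W t \<omega> < 0" using neg by blast
      then have "u \<bullet> f \<omega> t < 0" using w_pos[OF t(1)] by (simp add: f_def mult_pos_neg)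
      moreover have "t \<in> {0..1}" using t(1) c by auto
      ultimately show "\<exists>t\<in>{0..1}. u \<bullet> f \<omega> t < 0" by blast
    qed
  qed
  have AE_min: "AE \<omega> in Q. \<exists>!y. is_arg_min (g_fun (f \<omega>)) (\<lambda>y. y \<in> K_bar (f \<omega>)) y"
    using two_sided_W by (rule AE_mp) (auto intro!: AE_I2 g_fun_minimum(1))
  have AE_val: "AE \<omega> in Q. - g_fun (f \<omega>) (Y \<omega>) = el_val (f \<omega>)"
    using two_sided_W unfolding Y_def by (rule AE_mp) (auto intro!: AE_I2 g_fun_minimum(2))
  \<comment> \<open>The good limit paths: every direction turns negative inside (0, c), where
    \<open>w\<close> is positive and so preserves the sign.\<close>
  define G where "G = {z :: real \<Rightarrow> real ^ 'd. \<forall>u :: real ^ 'p. u \<noteq> 0 \<longrightarrow> (\<exists>t\<in>{0<..<c}. u \<bullet> (J *v z t) < 0)}"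
  have AE_G: "AE \<omega> in N. (\<lambda>t\<in>{0..1}. \<Sigma>_half *v B t \<omega>) \<in> G"
  proof (rule AE_mp[OF iid_bm_two_sided[OF N.prob_space_axioms brownian_B c]], intro AE_I2 impI)
    fix \<omega> assume neg: "\<forall>u. u \<noteq> 0 \<longrightarrow> (\<exists>t\<in>{0<..<c}. u \<bullet> B t \<omega> < 0)"
    show "(\<lambda>t\<in>{0..1}. \<Sigma>_half *v B t \<omega>) \<in> G"
      unfolding G_def
    proof (intro CollectI allI impI)
      fix u :: "real ^ 'p" assume "u \<noteq> 0"
      then have "C u \<noteq> 0" using C_inj linear_0[OF C_lin] by (metis injD)
      then obtain t where t: "t \<in> {0<..<c}" "C u \<bullet> B t \<omega> < 0" using neg by blast
      then show "\<exists>t\<in>{0<..<c}. u \<bullet> (J *v (\<lambda>t\<in>{0..1}. \<Sigma>_half *v B t \<omega>) t) < 0"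
        using c by (intro bexI[of _ t]) (auto simp: C_inner)
    qed
  qed
  have space_m: "continuous_on {0..1} z" if "z \<in> mspace ?m" for z
    using that by auto
  have path_limit: "(\<lambda>n. - (ereal (1 / real n) * elog (rescaled_EL w H \<mu>\<^sub>0 n (y n)))) \<longlonglongrightarrow> el_val (\<lambda>t. w t *\<^sub>R (J *v z t))"
    if z: "z \<in> G" "z \<in> mspace ?m" and y: "\<And>n. y n \<in> mspace ?m" and lim: "(\<lambda>n. mdist ?m (y n) z) \<longlonglongrightarrow> 0" for z y
  proof -
    have "uniform_limit {0..1} y z sequentially"
    proof (rule uniform_limitI)
      fix e :: real assume "0 < e"
      then have "eventually (\<lambda>n. mdist ?m (y n) z < e) sequentially" using lim by (rule order_tendstoD(2)[rotated])
      then show "eventually (\<lambda>n. \<forall>t\<in>{0..1}. dist (y n t) (z t) < e) sequentially"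
      proof eventually_elim
        case (elim n)
        show ?case
        proof
          fix t :: real assume "t \<in> {0..1}"
          then have "dist (y n t) (z t) \<le> mdist ?m (y n) z"
            using mdist_cfunspace_imp_mdist_le[OF y z(2) order_refl, of t n] by simp
          then show "dist (y n t) (z t) < e" using elim by linarith
        qed
      qed
    qed
    then interpret E: EL_setting w c H \<mu>\<^sub>0 "(*v) J" U z y
      using w_cont w_nonneg c w_pos H_deriv nbhd U_cont space_m[OF z(2)] by unfold_locales auto
    have "two_sided_path E.f"
    proof
      show "continuous_on {0..1} E.f" by (rule E.f_cont)
      fix u :: "real ^ 'p" assume "u \<noteq> 0"
      then obtain t where t: "t \<in> {0<..<c}" "u \<bullet> (J *v z t) < 0" using z(1) unfolding G_def by blast
      then have "u \<bullet> E.f t < 0" using w_pos[OF t(1)] by (simp add: E.f_def mult_pos_neg)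
      moreover have "t \<in> {0..1}" using t(1) c by auto
      ultimately show "\<exists>t\<in>{0..1}. u \<bullet> E.f t < 0" by blast
    qed
    from E.rescaled_EL_limit[OF this] show ?thesis unfolding E.f_def[abs_def] .
  qed
  have conv: "conv_in_dist euclidean
           M (\<lambda>n \<omega>. - (ereal (1 / real n) * elog (EBEL_ratio w H (\<lambda>j. X j \<omega>) n (H \<mu>\<^sub>0))))
           (completion Q) (\<lambda>\<omega>. - g_fun (f \<omega>) (Y \<omega>))"
    unfolding conv_in_dist_def
  proof (intro conjI allI impI)
    fix \<phi> :: "ereal \<Rightarrow> real"
    assume "continuous_map euclidean euclideanreal \<phi> \<and> bounded (\<phi> ` topspace euclidean)"
    then have \<phi>: "continuous_on UNIV \<phi>" "bounded (range \<phi>)" by auto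
    then obtain K where K: "\<And>x. \<bar>\<phi> x\<bar> \<le> K" by (auto simp: bounded_real)
    have \<phi>m: "\<phi> \<in> borel_measurable borel" using \<phi>(1) by (rule borel_measurable_continuous_onI)
    have \<phi>\<Psi>: "(\<lambda>x. \<phi> (\<Psi> x)) \<in> borel_measurable (PiM {0..1} (\<lambda>_. borel))"
      using \<Psi>(1) \<phi>m by (rule measurable_compose)
    define h where "h n z = \<phi> (- (ereal (1 / real n) * elog (rescaled_EL w H \<mu>\<^sub>0 n z)))" for n z
    define h0 where "h0 z = \<phi> (el_val (\<lambda>t. w t *\<^sub>R (J *v z t)))" for z :: "real \<Rightarrow> real ^ 'd"
    let ?Z = "\<lambda>n \<omega>. \<lambda>t\<in>{0..1}. (1 / sqrt (real n)) *\<^sub>R partial_sum_process \<mu>\<^sub>0 (\<lambda>j. X j \<omega>) n t"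
    let ?B = "\<lambda>\<omega>. \<lambda>t\<in>{0..1}. \<Sigma>_half *v B t \<omega>"
    have mB: "(\<lambda>\<omega>. \<phi> (\<Psi> (\<lambda>t\<in>{0..1}. T (B t \<omega>)))) \<in> borel_measurable N"
      using gauss_process_measurable[OF gp_B] \<phi>\<Psi> by (rule measurable_compose)
    have mW: "(\<lambda>\<omega>. \<phi> (\<Psi> (\<lambda>t\<in>{0..1}. W t \<omega>))) \<in> borel_measurable Q"
      using gauss_process_measurable[OF gp_W] \<phi>\<Psi> by (rule measurable_compose)
    have h0_B: "h0 (?B \<omega>) = \<phi> (\<Psi> (\<lambda>t\<in>{0..1}. T (B t \<omega>)))" if "\<omega> \<in> space N" for \<omega>
      unfolding h0_def val_B[OF that] ..
    have h0m: "(\<lambda>\<omega>. h0 (?B \<omega>)) \<in> borel_measurable N"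
      using mB by (subst measurable_cong[OF h0_B])
    have "(\<lambda>n. outer_expectation M (\<lambda>\<omega>. h n (?Z n \<omega>))) \<longlonglongrightarrow> (\<integral>\<omega>. h0 (?B \<omega>) \<partial>N)"
    proof (rule extended_continuous_mapping[where m = ?m and h = h and ?h0.0 = h0 and C = K and G = G])
      show "prob_space M" "prob_space N" by unfold_locales
      show "conv_in_dist (mtopology_of ?m) M ?Z N ?B" using fclt unfolding C01_def .
      show "AE \<omega> in N. ?B \<omega> \<in> G" by (rule AE_G)
      show "(\<lambda>\<omega>. h0 (?B \<omega>)) \<in> borel_measurable N" by (rule h0m)
      show "\<bar>h n z\<bar> \<le> K" for n z unfolding h_def by (rule K)
      fix z y assume z: "z \<in> G" "z \<in> mspace ?m" and y: "\<And>n. y n \<in> mspace ?m" and lim: "(\<lambda>n. mdist ?m (y n) z) \<longlonglongrightarrow> 0"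
      have "isCont \<phi> (el_val (\<lambda>t. w t *\<^sub>R (J *v z t)))" using \<phi>(1) by (simp add: continuous_on_eq_continuous_at)
      then show "(\<lambda>n. h n (y n)) \<longlonglongrightarrow> h0 z"
        unfolding h_def h0_def using path_limit[OF z y lim] by (rule isCont_tendsto_compose)
    qed
    \<comment> \<open>Rescaling by \<open>sqrt n\<close> identifies the two likelihoods from
      \<open>n = 1\<close> on, which is enough for the limit.\<close>
    moreover have "eventually (\<lambda>n. outer_expectation M (\<lambda>\<omega>. h n (?Z n \<omega>)) = outer_expectation M
        (\<lambda>\<omega>. \<phi> (- (ereal (1 / real n) * elog (EBEL_ratio w H (\<lambda>j. X j \<omega>) n (H \<mu>\<^sub>0)))))) sequentially"
      using eventually_gt_at_top[of 0]
    proof eventually_elim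
      case (elim n)
      have "EBEL_ratio w H (\<lambda>j. X j \<omega>) n (H \<mu>\<^sub>0) = rescaled_EL w H \<mu>\<^sub>0 n (?Z n \<omega>)" for \<omega>
        by (rule EBEL_ratio_eq_rescaled_EL[OF elim]) (use grid_mem in \<open>simp del: atLeastAtMost_iff\<close>)
      then show ?case unfolding h_def by simp
    qed
    ultimately have lim: "(\<lambda>n. outer_expectation M
        (\<lambda>\<omega>. \<phi> (- (ereal (1 / real n) * elog (EBEL_ratio w H (\<lambda>j. X j \<omega>) n (H \<mu>\<^sub>0)))))) \<longlonglongrightarrow> (\<integral>\<omega>. h0 (?B \<omega>) \<partial>N)"
      by (rule Lim_transform_eventually)
    \<comment> \<open>Both limits are integrals of the single function
      \<open>\<phi> (\<Psi> x)\<close>, under the law of the projected \<open>B\<close> and under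
      the law of \<open>W\<close>, and these laws coincide.\<close>
    have "(\<integral>\<omega>. h0 (?B \<omega>) \<partial>N) = (\<integral>\<omega>. \<phi> (\<Psi> (\<lambda>t\<in>{0..1}. T (B t \<omega>))) \<partial>N)"
      by (rule Bochner_Integration.integral_cong[OF refl h0_B])
    also have "\<dots> = (\<integral>x. \<phi> (\<Psi> x) \<partial>distr N (PiM {0..1} (\<lambda>_. borel)) (\<lambda>\<omega>. \<lambda>t\<in>{0..1}. T (B t \<omega>)))"
      by (rule integral_distr[symmetric, OF gauss_process_measurable[OF gp_B] \<phi>\<Psi>])
    also have "distr N (PiM {0..1} (\<lambda>_. borel)) (\<lambda>\<omega>. \<lambda>t\<in>{0..1}. T (B t \<omega>)) = distr Q (PiM {0..1} (\<lambda>_. borel)) (\<lambda>\<omega>. \<lambda>t\<in>{0..1}. W t \<omega>)"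
      by (rule gauss_process_law_unique[OF N.prob_space_axioms gp_B gp_W])
    also have "(\<integral>x. \<phi> (\<Psi> x) \<partial>distr Q (PiM {0..1} (\<lambda>_. borel)) (\<lambda>\<omega>. \<lambda>t\<in>{0..1}. W t \<omega>)) = (\<integral>\<omega>. \<phi> (\<Psi> (\<lambda>t\<in>{0..1}. W t \<omega>)) \<partial>Q)"
      by (rule integral_distr[OF gauss_process_measurable[OF gp_W] \<phi>\<Psi>])
    finally have int_eq: "(\<integral>\<omega>. h0 (?B \<omega>) \<partial>N) = (\<integral>\<omega>. \<phi> (\<Psi> (\<lambda>t\<in>{0..1}. W t \<omega>)) \<partial>Q)" .
    have AE_eq: "AE \<omega> in Q. \<phi> (- g_fun (f \<omega>) (Y \<omega>)) = \<phi> (\<Psi> (\<lambda>t\<in>{0..1}. W t \<omega>))"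
      using AE_val by (rule AE_mp) (auto intro!: AE_I2 simp: val_W)
    show meas: "(\<lambda>\<omega>. \<phi> (- g_fun (f \<omega>) (Y \<omega>))) \<in> borel_measurable (completion Q)"
      using mW AE_eq by (rule borel_measurable_completion_AE)
    have "(\<integral>\<omega>. \<phi> (- g_fun (f \<omega>) (Y \<omega>)) \<partial>completion Q) = (\<integral>\<omega>. \<phi> (\<Psi> (\<lambda>t\<in>{0..1}. W t \<omega>)) \<partial>completion Q)"
      by (rule integral_cong_AE[OF meas measurable_completion[OF mW] AE_completion[OF AE_eq]])
    also have "\<dots> = (\<integral>\<omega>. \<phi> (\<Psi> (\<lambda>t\<in>{0..1}. W t \<omega>)) \<partial>Q)" by (rule integral_completion[OF mW])
    finally show "(\<lambda>n. outer_expectation M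
        (\<lambda>\<omega>. \<phi> (- (ereal (1 / real n) * elog (EBEL_ratio w H (\<lambda>j. X j \<omega>) n (H \<mu>\<^sub>0))))))
        \<longlonglongrightarrow> (\<integral>\<omega>. \<phi> (- g_fun (f \<omega>) (Y \<omega>)) \<partial>completion Q)"
      using lim unfolding int_eq by simp
  qed auto
  show ?thesis using AE_min conv by blast
qed

end
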